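(* Let $d\geq 1$ and $2\leq p<+\infty$. Let $(X_n)_{n\geq 0}$ be independent and identically distributed real random variables, not almost surely constant, such that $\mathbb{E}[X_1]=0$ and $\mathbb{E}[|X_1|^k]<+\infty$ for all $k\geq 1$. Let $(c_n)_{n\ge 0}$ be a sequence of scalars such that $u=\sum_{n\geq 0}c_n\varphi_n$ belongs to $\mathcal{Z}_\varphi^{-2\beta(d)\left(\frac12-\frac1p\right)}(\mathbb{R}^d)$, i.e. $$\sum_{j=1}^{+\infty} j^{\gamma(d)+\frac{2\beta(d)}{p}}\max_{n\in I(j)}|c_n|^2<+\infty .$$ Then the random series $u^\omega=\sum_{n\geq 0}X_n(\omega)c_n\varphi_n$ converges almost surely in $L^p(\mathbb{R}^d)$.
   Context: $H=-\Delta+|x|^2$ is the harmonic oscillator on $L^2(\mathbb{R}^d)$; its eigenvalues, counted with multiplicity, are $d=\lambda_0<\lambda_1\leq\lambda_2\leq\cdots$ (as a set, the spectrum is $d+2\mathbb{N}$). $(\varphi_n)_{n\geq 0}$ is any fixed orthonormal basis of $L^2(\mathbb{R}^d)$ with $H\varphi_n=\lambda_n\varphi_n$. For $j\geq 1$, $I(j)=\{n\in\mathbb{N}: 2j\leq\lambda_n<2(j+1)\}$ (a maximum over an empty $I(j)$ is $0$). The exponents are $\gamma(1)=-\frac16$, $\beta(1)=\frac16$, and $\gamma(d)=\frac d2-1$, $\beta(d)=\frac d2$ for $d\geq 2$ (so $\beta(d)=d-1-\gamma(d)$). For $s\in\mathbb{R}$, $\mathcal{Z}^s_\varphi(\mathbb{R}^d)$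 is the space of $u=\sum_n c_n\varphi_n$ with $\|u\|^2_{\mathcal{Z}^s_\varphi}=\sum_{j\geq 1}j^{s+d-1}\max_{n\in I(j)}|c_n|^2<+\infty$. *)

theory Defs
  imports "HOL-Probability.Probability"
begin

text \<open>
  \<open>\<real>\<^sup>d\<close> is an arbitrary \<open>'a::euclidean_space\<close> with \<open>DIM('a) = d\<close>; elements of
  \<open>L\<^sup>p(\<real>\<^sup>d)\<close> are given by Borel representatives with respect to \<^const>\<open>lborel\<close>.
\<close>

definition Lp :: "real \<Rightarrow> ('a::euclidean_space \<Rightarrow> complex) set" where
  "Lp p = {f. f \<in> borel_measurable lborel \<and> integrable lborel (\<lambda>x. norm (f x) powr p)}"

definition Lp_norm :: "real \<Rightarrow> ('a::euclidean_space \<Rightarrow> complex) \<Rightarrow> real" where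
  "Lp_norm p f = (LINT x|lborel. norm (f x) powr p) powr (1 / p)"

text \<open>
  Membership in \<open>L\<^sup>p\<close> is required of the sequence as well as of its limit: the Bochner integral of
  a non-integrable function is \<open>0\<close>, so \<open>Lp_norm\<close> is meaningless outside \<open>Lp p\<close>.
\<close>
definition Lp_tendsto ::
    "real \<Rightarrow> (nat \<Rightarrow> 'a::euclidean_space \<Rightarrow> complex) \<Rightarrow> ('a \<Rightarrow> complex) \<Rightarrow> bool" where
  "Lp_tendsto p F g \<longleftrightarrow>
     (\<forall>N. F N \<in> Lp p) \<and> g \<in> Lp p \<and> (\<lambda>N. Lp_norm p (\<lambda>x. F N x - g x)) \<longlonglongrightarrow> 0"

definition Lp_convergent ::
    "real \<Rightarrow> (nat \<Rightarrow> 'a::euclidean_space \<Rightarrow> complex) \<Rightarrow> bool" where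
  "Lp_convergent p F \<longleftrightarrow> (\<exists>g. Lp_tendsto p F g)"

definition L2_inner ::
    "('a::euclidean_space \<Rightarrow> complex) \<Rightarrow> ('a \<Rightarrow> complex) \<Rightarrow> complex" where
  "L2_inner f g = (LINT x|lborel. f x * cnj (g x))"

definition L2_orthonormal_basis :: "(nat \<Rightarrow> 'a::euclidean_space \<Rightarrow> complex) \<Rightarrow> bool" where
  "L2_orthonormal_basis \<phi> \<longleftrightarrow>
     (\<forall>n. \<phi> n \<in> Lp 2) \<and>
     (\<forall>m n. L2_inner (\<phi> m) (\<phi> n) = (if m = n then 1 else 0)) \<and>
     (\<forall>f\<in>Lp 2. Lp_tendsto 2 (\<lambda>N x. \<Sum>n<N. L2_inner f (\<phi> n) * \<phi> n x) f)"

definition partial_deriv ::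
    "'a::euclidean_space \<Rightarrow> ('a \<Rightarrow> complex) \<Rightarrow> 'a \<Rightarrow> complex" where
  "partial_deriv b f = (\<lambda>x. frechet_derivative f (at x) b)"

text \<open>
  The list \<open>bs\<close> of basis vectors plays the role of a multi-index.  Differentiability of all iterated
  partial derivatives amounts to \<open>C\<^sup>\<infinity>\<close>.
\<close>
definition schwartz :: "('a::euclidean_space \<Rightarrow> complex) set" where
  "schwartz = {\<psi>. \<forall>bs. set bs \<subseteq> Basis \<longrightarrow>
      (\<forall>x. foldr partial_deriv bs \<psi> differentiable (at x)) \<and>
      (\<forall>k::nat. \<exists>C. \<forall>x. norm x ^ k * norm (foldr partial_deriv bs \<psi> x) \<le> C)}"

definition laplacian :: "('a::euclidean_space \<Rightarrow> complex) \<Rightarrow> 'a \<Rightarrow> complex" where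
  "laplacian f x = (\<Sum>b\<in>Basis. partial_deriv b (partial_deriv b f) x)"

text \<open>
  The graph of the self-adjoint operator \<open>H = -\<Delta> + |x|\<^sup>2\<close> on \<open>L\<^sup>2(\<real>\<^sup>d)\<close>, with its maximal domain
  \<open>{u \<in> L\<^sup>2. Hu \<in> L\<^sup>2}\<close>: \<open>harmonic_oscillator u f\<close> means that \<open>u\<close> is in the domain and \<open>H u = f\<close>,
  where \<open>H u\<close> is taken in the sense of tempered distributions.
\<close>
definition harmonic_oscillator ::
    "('a::euclidean_space \<Rightarrow> complex) \<Rightarrow> ('a \<Rightarrow> complex) \<Rightarrow> bool" where
  "harmonic_oscillator u f \<longleftrightarrow> u \<in> Lp 2 \<and> f \<in> Lp 2 \<and>
     (\<forall>\<psi>\<in>schwartz.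
        (LINT x|lborel. u x * (- laplacian \<psi> x + of_real ((norm x)\<^sup>2) * \<psi> x)) =
        (LINT x|lborel. f x * \<psi> x))"

text \<open>
  Since the eigenfunctions form a basis and \<open>eig\<close> is nondecreasing, \<open>eig\<close> is necessarily the
  enumeration of all eigenvalues of \<open>H\<close> counted with multiplicity; in particular
  \<open>eig 0 = d < eig 1\<close> and the range of \<open>eig\<close> is \<open>d + 2\<nat>\<close>.
\<close>
definition harmonic_eigenbasis ::
    "(nat \<Rightarrow> real) \<Rightarrow> (nat \<Rightarrow> 'a::euclidean_space \<Rightarrow> complex) \<Rightarrow> bool" where
  "harmonic_eigenbasis eig \<phi> \<longleftrightarrow>
     incseq eig \<and> L2_orthonormal_basis \<phi> \<and>
     (\<forall>n. harmonic_oscillator (\<phi> n) (\<lambda>x. of_real (eig n) * \<phi> n x))"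

definition eig_block :: "(nat \<Rightarrow> real) \<Rightarrow> nat \<Rightarrow> nat set" where
  "eig_block eig j = {n. 2 * real j \<le> eig n \<and> eig n < 2 * (real j + 1)}"

definition gamma_exp :: "nat \<Rightarrow> real" where
  "gamma_exp d = (if d = 1 then - 1 / 6 else real d / 2 - 1)"

definition beta_exp :: "nat \<Rightarrow> real" where
  "beta_exp d = (if d = 1 then 1 / 6 else real d / 2)"

text \<open>
  \<open>u = \<Sum>\<^sub>n c\<^sub>n \<phi>\<^sub>n\<close> is represented by its coefficient sequence, because for negative \<open>s\<close> it need
  not be a function.  For the eigenvalues of \<open>H\<close> every \<open>eig_block eig j\<close> is finite, so \<^const>\<open>Max\<close> is
  a genuine maximum; inserting \<open>0\<close> only affects the empty block.
\<close>
definition Z_space :: "nat \<Rightarrow> (nat \<Rightarrow> real) \<Rightarrow> real \<Rightarrow> (nat \<Rightarrow> complex) set" where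
  "Z_space d eig s = {c. summable (\<lambda>i. let j = Suc i in
      real j powr (s + real d - 1) * Max (insert 0 ((\<lambda>n. (norm (c n))\<^sup>2) ` eig_block eig j)))}"

text \<open>
  With the smoothness index \<open>s = -2\<beta>(1/2 - 1/p)\<close>, the weight \<open>j\<^sup>s\<^sup>+\<^sup>d\<^sup>-\<^sup>1\<close> is \<open>j\<close> to the power
  \<open>\<gamma> + 2\<beta>/p\<close>.
\<close>
lemma Z_weight_exponent:
  assumes "d \<ge> 1"
  shows "- 2 * beta_exp d * (1 / 2 - 1 / p) + real d - 1 = gamma_exp d + 2 * beta_exp d / p"
  using assms by (auto simp: beta_exp_def gamma_exp_def algebra_simps)

end

theory Submission
  imports Defs "HOL-Computational_Algebra.Formal_Power_Series"
begin

text \<open>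
  Fubini reduces the moments of the \<open>L\<^sup>p\<close> norm of a partial sum to moments, at fixed \<open>x\<close>, of sums
  of independent centered variables; these are controlled by the square function
  \<open>(\<Sum>\<^sub>n |c\<^sub>n \<phi>\<^sub>n(x)|\<^sup>2)\<^sup>p\<^sup>/\<^sup>2\<close>.  A maximal inequality for the submartingale of partial sums
  then upgrades smallness of the tails in expectation to almost sure convergence.

  For the square function, the sum of \<open>|\<phi>\<^sub>n(x)|\<^sup>2\<close> over an eigenspace is the spectral function
  of \<open>H\<close>, independent of the basis, so it may be computed from products of Hermite functions.
  The generating function \<open>S(x) = \<Sum>\<^sub>n h\<^sub>n(x)\<^sup>2 t\<^sup>n\<close> satisfies
  \<open>S(x) S(y) = S(\<surd>(x\<^sup>2 + y\<^sup>2)) S(0)\<close>, which makes the spectral function in dimension \<open>d\<close> a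
  coefficient of \<open>S(|x|) S(0)\<^sup>d\<^sup>-\<^sup>1\<close>; WKB bounds for \<open>h\<^sub>n\<close> in the allowed, turning and forbidden
  regions bound it uniformly by \<open>j\<^sup>\<gamma>\<close>.  Interpolating with its integral, of order \<open>j\<^sup>d\<^sup>-\<^sup>1\<close>,
  yields the exponent \<open>\<gamma> + 2\<beta>/p\<close>.
\<close>

section \<open>Hermite functions\<close>

text \<open>The obstacle is that \<open>\<phi>\<close> is an arbitrary eigenbasis: a single
  \<open>\<phi> n\<close> has no formula, and only sums of \<open>|\<phi> n|^2\<close> over an
  eigenspace compare with Hermite functions. Randomness suits this, since the moments see nothing
  but the square function. In dimension one the peak of \<open>h_n^2\<close> at the turning point,
  of size \<open>n^(-1/6)\<close>, is unavoidable and gives \<open>gamma_exp 1\<close>. In dimension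
  two, bounding both factors of a product by such peaks would give only \<open>k^(2/3)\<close>. A
  coefficient of \<open>S(|x|) S(0)\<close>, however, is a convolution in the index at a fixed
  radius against \<open>h_n(0)^2 \<le> (n+1)^(-1/2)\<close>, and the few indices whose turning point
  is near that radius are averaged out. This gives a constant, \<open>gamma_exp 2 = 0\<close>, and
  each further factor \<open>S(0)\<close> adds \<open>1/2\<close>. The product rule for
  \<open>S\<close> is what Mehler's formula \<open>S(x) = S(0) exp(-x^2 (1-t)/(1+t))\<close>
  predicts; a derivative in the polar angle proves it coefficient by coefficient, without summing
  the series. Small tails in expectation alone would give almost sure convergence along a
  subsequence only, whence the maximal inequality.\<close>

fun hermite_fun :: "nat \<Rightarrow> real \<Rightarrow> real" where
  "hermite_fun 0 x = exp (- x\<^sup>2 / 2) / sqrt (sqrt pi)"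
| "hermite_fun (Suc 0) x = sqrt 2 * x * hermite_fun 0 x"
| "hermite_fun (Suc (Suc n)) x =
     sqrt (2 / (real n + 2)) * x * hermite_fun (Suc n) x - sqrt ((real n + 1) / (real n + 2)) * hermite_fun n x"

text \<open>At \<open>n = 0\<close> the truncated index \<open>n - 1\<close> is harmless because its
  factor \<open>sqrt (2 * real n)\<close> vanishes; the same convention is used in all formulas with
  \<open>n - 1\<close> below.\<close>

lemma hermite_fun_rec:
  "2 * x * hermite_fun n x =
     sqrt (2 * real n) * hermite_fun (n - 1) x + sqrt (2 * (real n + 1)) * hermite_fun (Suc n) x"
proof (cases n)
  case 0
  have "sqrt 2 * (sqrt 2 * t) = 2 * t" for t :: real
    by (simp flip: mult.assoc)
  then show ?thesis using 0 by (simp add: mult.assoc)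
next
  case (Suc m)
  have s: "sqrt (2 * real m + 4) > 0" by simp
  have e: "real m + 2 = (sqrt (2 * real m + 4))\<^sup>2 / 2" by simp
  have a: "sqrt (2 * real m + 4) * sqrt (2 / (real m + 2)) = 2"
  proof -
    have "(2 * real m + 4) * (2 / (real m + 2)) = 4" by (simp add: field_simps)
    then have "sqrt ((2 * real m + 4) * (2 / (real m + 2))) = 2" by simp
    then show ?thesis by (simp only: real_sqrt_mult)
  qed
  have b: "sqrt (2 * real m + 4) * sqrt ((real m + 1) / (real m + 2)) = sqrt (2 * (real m + 1))"
  proof -
    have "(2 * real m + 4) * ((real m + 1) / (real m + 2)) = 2 * (real m + 1)" by (simp add: field_simps)
    then show ?thesis by (simp only: real_sqrt_mult [symmetric])
  qed
  have "sqrt (2 * real m + 4) * hermite_fun (Suc (Suc m)) x =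
    (sqrt (2 * real m + 4) * sqrt (2 / (real m + 2))) * x * hermite_fun (Suc m) x -
    (sqrt (2 * real m + 4) * sqrt ((real m + 1) / (real m + 2))) * hermite_fun m x"
    by (simp add: algebra_simps)
  also have "\<dots> = 2 * x * hermite_fun (Suc m) x - sqrt (2 * (real m + 1)) * hermite_fun m x"
    by (simp only: a b)
  finally show ?thesis using Suc by (simp add: algebra_simps)
qed

text \<open>The operator \<open>d/dx + x\<close> lowers the index. The proof differentiates the
  three-term recurrence, so the induction needs both predecessors.\<close>

lemma hermite_fun_deriv:
  "(hermite_fun n has_real_derivative sqrt (2 * real n) * hermite_fun (n - 1) x - x * hermite_fun n x) (at x)"
proof (induction n arbitrary: x rule: induct_nat_012)
  have D0: "(hermite_fun 0 has_real_derivative - x * hermite_fun 0 x) (at x)" for x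
    unfolding hermite_fun.simps(1)
    by (rule DERIV_cong[OF DERIV_cdivide[OF DERIV_fun_exp[OF DERIV_cdivide[OF DERIV_minus[OF DERIV_power[OF DERIV_ident]]]]]])
      simp
  {
    case 0
    show ?case by (rule DERIV_cong[OF D0]) simp
  next
  case 1
  have "((\<lambda>x. sqrt 2 * x * hermite_fun 0 x) has_real_derivative
     sqrt 2 * hermite_fun 0 x + (- x * hermite_fun 0 x) * (sqrt 2 * x)) (at x)"
    by (rule derivative_eq_intros D0 refl)+ simp
  then show ?case by (simp add: algebra_simps)
  }
next
  case (ge2 n)
  let ?a = "sqrt (2 / (real n + 2))" and ?b = "sqrt ((real n + 1) / (real n + 2))"
  have D: "(hermite_fun (Suc (Suc n)) has_real_derivative
      ?a * (hermite_fun (Suc n) x + x * (sqrt (2 * (real n + 1)) * hermite_fun n x - x * hermite_fun (Suc n) x))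
      - ?b * (sqrt (2 * real n) * hermite_fun (n - 1) x - x * hermite_fun n x)) (at x)"
    unfolding hermite_fun.simps
    by (rule derivative_eq_intros ge2 refl)+ (simp add: algebra_simps)
  have r: "sqrt (2 * real n) * hermite_fun (n - 1) x = 2 * x * hermite_fun n x - sqrt (2 * (real n + 1)) * hermite_fun (Suc n) x"
    using hermite_fun_rec[of x n] by (simp add: algebra_simps)
  have a: "?a * sqrt (2 * (real n + 1)) = 2 * ?b"
  proof -
    have "2 / (real n + 2) * (2 * (real n + 1)) = 4 * ((real n + 1) / (real n + 2))" by simp
    then have "sqrt (2 / (real n + 2) * (2 * (real n + 1))) = sqrt (4 * ((real n + 1) / (real n + 2)))" by metis
    then show ?thesis by (simp only: real_sqrt_mult) simp
  qed
  have b: "?b * sqrt (2 * (real n + 1)) = ?a * (n + 1)"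
  proof -
    have "?b * sqrt (2 * (real n + 1)) = sqrt 2 * (sqrt (real n + 1) * sqrt (real n + 1)) / sqrt (real n + 2)"
      unfolding real_sqrt_divide real_sqrt_mult by simp
    then show ?thesis by (simp add: real_sqrt_divide algebra_simps)
  qed
  have c: "sqrt (2 * (real n + 2)) = ?a * (n + 2)"
  proof -
    have e: "real n + 2 = sqrt (real n + 2) * sqrt (real n + 2)" by simp
    have "?a * (n + 2) = sqrt 2 / sqrt (real n + 2) * (real n + 2)" by (simp add: real_sqrt_divide add.commute)
    also have "\<dots> = sqrt 2 / sqrt (real n + 2) * (sqrt (real n + 2) * sqrt (real n + 2))"
      using e by metis
    also have "\<dots> = sqrt 2 * sqrt (real n + 2)" by (simp del: real_sqrt_mult_self)
    also have "\<dots> = sqrt (2 * (real n + 2))" by (simp only: real_sqrt_mult)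
    finally show ?thesis ..
  qed
  have "?a * (hermite_fun (Suc n) x + x * (sqrt (2 * (real n + 1)) * hermite_fun n x - x * hermite_fun (Suc n) x))
      - ?b * (sqrt (2 * real n) * hermite_fun (n - 1) x - x * hermite_fun n x)
     = ?a * hermite_fun (Suc n) x + (?a * sqrt (2 * (real n + 1))) * x * hermite_fun n x
       - ?a * x * x * hermite_fun (Suc n) x
      - ?b * 2 * x * hermite_fun n x + (?b * sqrt (2 * (real n + 1))) * hermite_fun (Suc n) x
      + ?b * x * hermite_fun n x"
    unfolding r by (simp add: algebra_simps)
  also have "\<dots> = ?a * (n + 2) * hermite_fun (Suc n) x
       - x * (?a * x * hermite_fun (Suc n) x - ?b * hermite_fun n x)"
    unfolding a b by (simp add: algebra_simps)
  also have "\<dots> = sqrt (2 * (real n + 2)) * hermite_fun (Suc n) x - x * hermite_fun (Suc (Suc n)) x"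
    unfolding c hermite_fun.simps ..
  finally show ?case by (intro DERIV_cong[OF D]) (simp add: add.commute)
qed

text \<open>The lowering and the raising form of the derivative. Differentiating the raising form
  leads from \<open>Suc n\<close> back to \<open>n\<close>, so the second derivative closes up in
  one step.\<close>

lemma hermite_fun_raise:
  "sqrt (2 * real n) * hermite_fun (n - 1) x - x * hermite_fun n x
     = x * hermite_fun n x - sqrt (2 * (real n + 1)) * hermite_fun (Suc n) x"
  using hermite_fun_rec[of x n] by simp

lemma hermite_fun_deriv2:
  "((\<lambda>x. sqrt (2 * real n) * hermite_fun (n - 1) x - x * hermite_fun n x) has_real_derivative
      (x\<^sup>2 - (2 * real n + 1)) * hermite_fun n x) (at x)"
proof -
  have e: "(\<lambda>x. sqrt (2 * real n) * hermite_fun (n - 1) x - x * hermite_fun n x) =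
    (\<lambda>x. x * hermite_fun n x - sqrt (2 * (real n + 1)) * hermite_fun (Suc n) x)"
    using hermite_fun_raise by auto
  show ?thesis unfolding e
  proof (rule DERIV_cong)
    show "((\<lambda>x. x * hermite_fun n x - sqrt (2 * (real n + 1)) * hermite_fun (Suc n) x) has_real_derivative
      (1 * hermite_fun n x + (sqrt (2 * real n) * hermite_fun (n - 1) x - x * hermite_fun n x) * x)
      - sqrt (2 * (real n + 1)) * (sqrt (2 * real (Suc n)) * hermite_fun (Suc n - 1) x - x * hermite_fun (Suc n) x)) (at x)"
      by (intro DERIV_diff DERIV_mult[OF DERIV_ident] DERIV_cmult hermite_fun_deriv)
    have "sqrt (2 * (real n + 1)) * sqrt (2 * real (Suc n)) = 2 * (real n + 1)"
      by (simp add: add.commute)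
    then have "sqrt (2 * (real n + 1)) * (sqrt (2 * real (Suc n)) * hermite_fun (Suc n - 1) x - x * hermite_fun (Suc n) x)
       = 2 * (real n + 1) * hermite_fun n x - x * (sqrt (2 * (real n + 1)) * hermite_fun (Suc n) x)"
      by (simp add: algebra_simps)
    moreover have r: "sqrt (2 * real n) * hermite_fun (n - 1) x =
        2 * x * hermite_fun n x - sqrt (2 * (real n + 1)) * hermite_fun (Suc n) x"
      using hermite_fun_rec[of x n] by simp
    ultimately show "(1 * hermite_fun n x + (sqrt (2 * real n) * hermite_fun (n - 1) x - x * hermite_fun n x) * x)
      - sqrt (2 * (real n + 1)) * (sqrt (2 * real (Suc n)) * hermite_fun (Suc n - 1) x - x * hermite_fun (Suc n) x)
      = (x\<^sup>2 - (2 * real n + 1)) * hermite_fun n x"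
      unfolding r by (simp add: algebra_simps power2_eq_square)
  qed
qed

declare hermite_fun.simps(3) [simp del]

text \<open>At the origin the recurrence links indices of equal parity and multiplies the square by
  \<open>(n+1)/(n+2)\<close>; the bound is carried over by \<open>(n+1)(n+3) \<le> (n+2)^2\<close>.
  It serves twice: for the initial energy and for the coefficients of \<open>S(0)\<close>.\<close>

lemma hermite_fun_0_sq: "(hermite_fun n 0)\<^sup>2 \<le> 1 / sqrt (real n + 1)"
proof (induction n rule: induct_nat_012)
  case 0
  have "sqrt pi \<ge> 1" using pi_ge_two by simp
  then show ?case by (simp add: power_divide)
next
  case 1 show ?case by simp
next
  case (ge2 n)
  have "(hermite_fun (Suc (Suc n)) 0)\<^sup>2 = (real n+1)/(real n+2) * (hermite_fun n 0)\<^sup>2"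
    by (simp add: hermite_fun.simps(3) power_mult_distrib add.commute)
  also have "\<dots> \<le> (real n+1)/(real n+2) * (1 / sqrt (real n + 1))"
    using ge2(1) by (intro mult_left_mono) auto
  also have "\<dots> = sqrt (real n + 1) / (n+2)"
    proof -
    have "(real n + 1) * (1 / sqrt (real n + 1)) = sqrt (real n + 1)"
      using real_div_sqrt[of "real n + 1"] by simp
    then have "(real n + 1) * (1 / sqrt (real n + 1)) / (real n + 2) = sqrt (real n + 1) / (real n + 2)" by simp
    then show ?thesis by (simp add: algebra_simps)
  qed
  also have "\<dots> \<le> 1 / sqrt (real n + 3)"
  proof -
    have "sqrt (real n + 1) * sqrt (real n + 3) = sqrt ((real n+1)*(real n+3))" by (simp add: real_sqrt_mult)
    also have "\<dots> \<le> sqrt ((real n+2)\<^sup>2)"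
      by (intro real_sqrt_le_mono) (simp add: power2_eq_square algebra_simps)
    finally show ?thesis by (simp add: field_simps)
  qed
  finally show ?case by (simp add: add.commute)
qed

text \<open>The WKB energy at the origin, bounded independently of \<open>n\<close>; by
  \<open>hermite_fun_deriv\<close> the second term contains the squared derivative at
  \<open>0\<close>.\<close>

lemma hermite_fun_energy_0:
  "sqrt (2 * real n + 1) * (hermite_fun n 0)\<^sup>2 +
     (sqrt (2 * real n) * hermite_fun (n - 1) 0)\<^sup>2 / sqrt (2 * real n + 1) \<le> 4"
proof -
  have "sqrt (2 * real n + 1) * (hermite_fun n 0)\<^sup>2 \<le> sqrt (2 * real n + 1) * (1 / sqrt (real n + 1))"
    using hermite_fun_0_sq by (intro mult_left_mono) auto
  also have "\<dots> = sqrt ((2 * real n + 1) / (real n+1))" by (simp add: real_sqrt_divide add.commute)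
  also have "\<dots> \<le> sqrt 4" by (intro real_sqrt_le_mono) (simp add: field_simps)
  finally have 1: "sqrt (2 * real n + 1) * (hermite_fun n 0)\<^sup>2 \<le> 2" by simp
  have 2: "(sqrt (2 * real n) * hermite_fun (n - 1) 0)\<^sup>2 / sqrt (2 * real n + 1) \<le> 2"
  proof (cases n)
    case (Suc m)
    have "(sqrt (2 * real n) * hermite_fun (n - 1) 0)\<^sup>2 / sqrt (2 * real n + 1) = 2 * n / sqrt (2 * real n + 1) * (hermite_fun m 0)\<^sup>2"
      by (simp add: power_mult_distrib Suc)
    also have "\<dots> \<le> 2 * n / sqrt (2 * real n + 1) * (1 / sqrt n)"
      using hermite_fun_0_sq[of m] Suc by (intro mult_left_mono) (auto simp: add.commute)
    also have "\<dots> \<le> 2 * n / sqrt n * (1 / sqrt n)"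
      using Suc by (intro mult_right_mono divide_left_mono) (auto simp del: of_nat_Suc)
    also have "\<dots> = 2" using Suc by (simp add: field_simps)
    finally show ?thesis .
  qed simp
  show ?thesis using 1 2 by simp
qed

section \<open>Pointwise bounds for solutions of the oscillator equation\<close>

text \<open>The equation \<open>h'' = (x^2 - l) h\<close> as a first-order system. \<open>K\<close>
  bounds the WKB energy at \<open>0\<close>, and the limit at infinity selects the decaying solution
  beyond the turning point \<open>sqrt l\<close>.\<close>

locale oscillator_ode =
  fixes h g :: "real \<Rightarrow> real" and l :: real and K :: real
  assumes l: "l \<ge> 1"
    and dh: "\<And>x. (h has_real_derivative g x) (at x)"
    and dg: "\<And>x. (g has_real_derivative (x\<^sup>2 - l) * h x) (at x)"
    and energy_0: "sqrt l * (h 0)\<^sup>2 + (g 0)\<^sup>2 / sqrt l \<le> K"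
    and lim: "(h \<longlongrightarrow> 0) at_top"
begin

definition "Q x = l - x\<^sup>2"
text \<open>Liouville-Green normalisation: \<open>v\<close> removes the amplitude
  \<open>Q^(-1/4)\<close>, \<open>w\<close> is \<open>v' / sqrt Q\<close>, and \<open>psi\<close> is
  the error that keeps \<open>(v, w)\<close> from being an exact rotation with angular speed
  \<open>sqrt Q\<close>.\<close>

definition "v x = Q x powr (1/4) * h x"
definition "w x = Q x powr (-1/4) * g x - x / 2 * Q x powr (-5/4) * h x"
definition "psi x = Q x powr (-3/2) / 2 + 5/4 * x\<^sup>2 * Q x powr (-5/2)"

lemma K_nonneg: "K \<ge> 0"
proof -
  have "0 \<le> sqrt l * (h 0)\<^sup>2 + (g 0)\<^sup>2 / sqrt l" using l by simp
  then show ?thesis using energy_0 by linarith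
qed

lemma dQ: "(Q has_real_derivative - 2 * x) (at x)"
  unfolding Q_def by (auto intro!: derivative_eq_intros)

lemma dQpowr:
  assumes "Q x > 0"
  shows "((\<lambda>x. Q x powr a) has_real_derivative - 2 * a * x * Q x powr (a - 1)) (at x)"
  using DERIV_powr[OF dQ assms DERIV_const[of a]] assms
  by (simp add: powr_diff field_simps)

lemma Qpowr_add: "Q x > 0 \<Longrightarrow> Q x powr a * Q x powr b = Q x powr (a + b)"
  by (simp add: powr_add)

lemma dv:
  assumes "Q x > 0"
  shows "(v has_real_derivative Q x powr (1/2) * w x) (at x)"
proof -
  have "(v has_real_derivative - 2 * (1/4) * x * Q x powr (1/4 - 1) * h x + Q x powr (1/4) * g x) (at x)"
    unfolding v_def by (rule dQpowr assms derivative_eq_intros dh refl)+ simp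
  moreover have "Q x powr (1/2) * w x =
    (Q x powr (1/2) * Q x powr (-1/4)) * g x - x / 2 * (Q x powr (1/2) * Q x powr (-5/4)) * h x"
    unfolding w_def by (simp add: algebra_simps)
  ultimately show ?thesis using assms by (simp only: Qpowr_add) simp
qed

lemma dw:
  assumes "Q x > 0"
  shows "(w has_real_derivative - (Q x powr (1/2)) * v x - psi x * v x) (at x)"
proof -
  have "(w has_real_derivative
     (- 2 * (-1/4) * x * Q x powr (-1/4 - 1) * g x + Q x powr (-1/4) * ((x\<^sup>2 - l) * h x))
     - ((1 / 2 * Q x powr (-5/4) + x / 2 * (- 2 * (-5/4) * x * Q x powr (-5/4 - 1))) * h x
        + x / 2 * Q x powr (-5/4) * g x)) (at x)"
    unfolding w_def
    by (rule DERIV_cong[OF DERIV_diff[OF DERIV_mult[OF dQpowr dg]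
           DERIV_mult[OF DERIV_mult[OF DERIV_cdivide[OF DERIV_ident] dQpowr] dh]]])
      (use assms in \<open>simp_all add: algebra_simps\<close>)
  moreover have "Q x powr (-1/4) * ((x\<^sup>2 - l) * h x) = - (Q x powr (3/4) * h x)"
  proof -
    have "Q x powr (3/4) = Q x powr (-1/4 + 1)" by simp
    also have "\<dots> = Q x powr (-1/4) * Q x" using assms by (subst powr_add) simp
    finally have q: "Q x powr (3/4) = Q x powr (-1/4) * Q x" .
    show ?thesis unfolding q by (simp add: Q_def algebra_simps)
  qed
  moreover have "- (Q x powr (1/2)) * v x - psi x * v x =
     - (Q x powr (1/2) * Q x powr (1/4)) * h x - (Q x powr (-3/2) * Q x powr (1/4)) / 2 * h x
     - 5/4 * x\<^sup>2 * (Q x powr (-5/2) * Q x powr (1/4)) * h x"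
    unfolding v_def psi_def by (simp add: algebra_simps)
  ultimately show ?thesis using assms
    by (simp only: Qpowr_add) (simp add: algebra_simps power2_eq_square)
qed

definition "E x = (v x)\<^sup>2 + (w x)\<^sup>2"
text \<open>An explicit majorant of the integral of \<open>psi\<close>: its derivative has the
  coefficient \<open>3/2\<close> where \<open>psi\<close> has \<open>5/4\<close>.\<close>

definition "A x = x * Q x powr (-3/2) / 2"

lemma dE:
  assumes "Q x > 0"
  shows "(E has_real_derivative - 2 * psi x * v x * w x) (at x)"
  unfolding E_def
  by (rule derivative_eq_intros dv dw assms refl)+ (simp add: algebra_simps)

lemma dA:
  assumes "Q x > 0"
  shows "(A has_real_derivative Q x powr (-3/2) / 2 + 3/2 * x\<^sup>2 * Q x powr (-5/2)) (at x)"
  unfolding A_def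
  by (rule DERIV_cong[OF DERIV_cdivide[OF DERIV_mult[OF DERIV_ident dQpowr[OF assms]]]])
    (simp add: power2_eq_square field_simps)

text \<open>Gronwall's argument: the rotation preserves \<open>E\<close>, only \<open>psi\<close>
  changes it, and \<open>|2 v w| \<le> E\<close>.\<close>

lemma E_bound:
  assumes "0 \<le> x" "Q x > 0"
  shows "E x \<le> K * exp (A x)"
proof -
  have "E x * exp (- A x) \<le> E 0 * exp (- A 0)"
  proof (rule DERIV_nonpos_imp_nonincreasing[OF assms(1)])
    fix y assume y: "0 \<le> y" "y \<le> x"
    have "y\<^sup>2 \<le> x\<^sup>2" using y by (intro power_mono) auto
    then have Qy: "Q y > 0" using assms(2) by (simp add: Q_def)
    let ?a = "Q y powr (-3/2) / 2 + 3/2 * y\<^sup>2 * Q y powr (-5/2)"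
    have D: "((\<lambda>x. E x * exp (- A x)) has_real_derivative
       exp (- A y) * (- 2 * psi y * v y * w y - E y * ?a)) (at y)"
      by (rule derivative_eq_intros dE dA Qy refl)+ (simp add: algebra_simps)
    have p: "0 \<le> psi y" "psi y \<le> ?a"
      unfolding psi_def using Qy by (auto intro!: mult_right_mono add_nonneg_nonneg)
    have "- 2 * v y * w y \<le> E y"
      unfolding E_def using sum_squares_bound[of "v y" "- w y"] by simp
    then have "psi y * (- 2 * v y * w y) \<le> psi y * E y"
      using p by (intro mult_left_mono) auto
    also have "\<dots> \<le> ?a * E y" using p by (intro mult_right_mono) (auto simp: E_def)
    finally have "- 2 * psi y * v y * w y - E y * ?a \<le> 0" by (simp add: algebra_simps)
    then have "exp (- A y) * (- 2 * psi y * v y * w y - E y * ?a) \<le> 0"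
      by (simp add: mult_nonneg_nonpos)
    with D show "\<exists>z. ((\<lambda>x. E x * exp (- A x)) has_real_derivative z) (at y) \<and> z \<le> 0" by blast
  qed
  moreover have "E 0 * exp (- A 0) \<le> K"
  proof -
    have "(l powr (1/4))\<^sup>2 = sqrt l" "(l powr (-1/4))\<^sup>2 = 1 / sqrt l"
      using l by (simp_all add: powr_half_sqrt powr_minus_divide power2_eq_square flip: powr_add)
    then show ?thesis
      using energy_0 by (simp add: E_def A_def v_def w_def Q_def power_mult_distrib)
  qed
  ultimately have "E x * exp (- A x) \<le> K" by linarith
  then have "E x * exp (- A x) * exp (A x) \<le> K * exp (A x)" by (intro mult_right_mono) auto
  then show ?thesis by (simp add: exp_minus field_simps)
qed

text \<open>\<open>m^3 = sqrt l\<close> is the turning point and \<open>1 / m\<close> the width of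
  the Airy zone around it; \<open>Q = m^2\<close> marks the inner edge of this zone.\<close>

definition "m = l powr (1/6)"

lemma m_ge1: "m \<ge> 1" unfolding m_def using l by (simp add: ge_one_powr_ge_zero)
lemma m2: "m\<^sup>2 = l powr (1/3)" unfolding m_def using l by (simp flip: powr_realpow add: powr_powr)
lemma m3: "m ^ 3 = sqrt l" unfolding m_def using l by (simp flip: powr_realpow powr_half_sqrt add: powr_powr)
lemma m6: "m ^ 6 = l" unfolding m_def using l by (simp flip: powr_realpow add: powr_powr)

text \<open>Since \<open>x \<le> m^3\<close> and \<open>Q^(-3/2) \<le> m^(-3)\<close>, the exponent
  \<open>A x\<close> is at most \<open>1/2\<close>, and \<open>exp (1/2) \<le> 2\<close>.\<close>

lemma E_bound2:
  assumes "0 \<le> x" "Q x \<ge> m\<^sup>2"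
  shows "E x \<le> 2 * K"
proof -
  have Q0: "Q x > 0" using assms m_ge1 by (smt (verit) zero_less_power)
  have "x\<^sup>2 \<le> l" using Q0 by (simp add: Q_def)
  then have x: "x \<le> m ^ 3" unfolding m3 using assms(1) l by (simp add: real_le_rsqrt)
  have "Q x powr (-3/2) \<le> (m\<^sup>2) powr (-3/2)"
    using assms m_ge1 by (intro powr_mono2') auto
  also have "\<dots> = 1 / m ^ 3"
  proof -
    have "(m\<^sup>2) powr (3/2) = (m powr 2) powr (3/2)" using m_ge1 by (simp add: powr_numeral)
    also have "\<dots> = m powr 3" by (simp only: powr_powr) simp
    also have "\<dots> = m ^ 3" using m_ge1 by (simp add: powr_numeral)
    finally show ?thesis by (simp add: powr_minus_divide)
  qed
  finally have "x * Q x powr (-3/2) \<le> m ^ 3 * (1 / m ^ 3)"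
    using x assms m_ge1 by (intro mult_mono) auto
  then have "A x \<le> 1/2" using m_ge1 by (simp add: A_def)
  then have "exp (A x) \<le> exp (1/2)" by simp
  also have "\<dots> \<le> 2"
  proof -
    have "exp (1/2::real) * exp (1/2) = exp 1" by (simp flip: exp_add)
    also have "\<dots> \<le> 2 * 2" using exp_le by simp
    finally have "(exp (1/2::real))\<^sup>2 \<le> 2\<^sup>2" by (simp add: power2_eq_square)
    then show ?thesis by (rule power2_le_imp_le) simp
  qed
  finally have "K * exp (A x) \<le> K * 2" using K_nonneg by (intro mult_left_mono)
  then show ?thesis using E_bound[OF assms(1) Q0] by simp
qed

lemma h_bound_inner:
  assumes "0 \<le> x" "Q x \<ge> m\<^sup>2"
  shows "(h x)\<^sup>2 * sqrt (Q x) \<le> 2 * K"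
proof -
  have Q0: "Q x > 0" using assms m_ge1 by (smt (verit) zero_less_power)
  have "(v x)\<^sup>2 \<le> E x" by (simp add: E_def)
  moreover have "(v x)\<^sup>2 = (h x)\<^sup>2 * sqrt (Q x)"
  proof -
    have "(Q x powr (1/4))\<^sup>2 = sqrt (Q x)"
      using Q0 by (simp add: powr_half_sqrt power2_eq_square flip: powr_add)
    then show ?thesis by (simp add: v_def power_mult_distrib)
  qed
  ultimately show ?thesis using E_bound2[OF assms] by simp
qed

definition "x0 = sqrt (l - m\<^sup>2)"

lemma x0: "0 \<le> x0" "Q x0 = m\<^sup>2" "x0 \<le> m ^ 3" "m ^ 3 - x0 \<le> 1 / m"
proof -
  have "m\<^sup>2 \<le> m ^ 6" using m_ge1 by (intro power_increasing) auto
  then have ml: "m\<^sup>2 \<le> l" by (simp add: m6)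
  then show 0: "0 \<le> x0" "Q x0 = m\<^sup>2" by (auto simp: x0_def Q_def)
  show 1: "x0 \<le> m ^ 3" unfolding x0_def m3 by simp
  have "(m ^ 3 - x0) * m ^ 3 \<le> (m ^ 3 - x0) * (m ^ 3 + x0)"
    using 0 1 by (intro mult_left_mono) auto
  also have "\<dots> = m ^ 6 - x0\<^sup>2" by (simp add: algebra_simps power2_eq_square flip: power_add)
  also have "\<dots> = m ^ 2" using ml by (simp add: x0_def m6)
  finally have "((m ^ 3 - x0) * m) * m\<^sup>2 \<le> 1 * m\<^sup>2"
    by (simp add: power3_eq_cube power2_eq_square mult.assoc)
  then have "(m ^ 3 - x0) * m \<le> 1" using m_ge1 by (subst (asm) mult_le_cancel_right) auto
  then show "m ^ 3 - x0 \<le> 1 / m" using m_ge1 by (simp add: field_simps)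
qed

text \<open>Return from the WKB variables to \<open>h\<close> and \<open>g\<close> at the edge of
  the Airy zone: the term with \<open>h\<close> costs \<open>2 K m\<close>, and solving the
  definition of \<open>w\<close> for \<open>g\<close> costs \<open>5 K m\<close>. The weight
  \<open>m^2\<close> is the size of \<open>Q\<close> there, as the next estimate requires.\<close>

lemma g_x0: "m\<^sup>2 * (h x0)\<^sup>2 + (g x0)\<^sup>2 \<le> 7 * K * m"
proof -
  have m: "m > 0" using m_ge1 by simp
  have h: "(h x0)\<^sup>2 * m \<le> 2 * K"
    using h_bound_inner[of x0] x0 m by (simp add: x0)
  have p1: "(m\<^sup>2) powr (-1/4) = 1 / sqrt m"
  proof -
    have "(m\<^sup>2) powr (1/4) = (m powr 2) powr (1/4)" using m by (simp add: powr_numeral)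
    also have "\<dots> = m powr (1/2)" by (simp only: powr_powr) simp
    finally show ?thesis using m by (simp add: powr_minus_divide powr_half_sqrt)
  qed
  have p5: "(m\<^sup>2) powr (-5/4) = 1 / (sqrt m * m\<^sup>2)"
  proof -
    have "(m\<^sup>2) powr (-5/4) = (m\<^sup>2) powr (-1/4 + (-1))" by simp
    also have "\<dots> = (m\<^sup>2) powr (-1/4) * (m\<^sup>2) powr (-1)" by (rule powr_add)
    also have "\<dots> = 1 / sqrt m * (1 / m\<^sup>2)" unfolding p1 using m by (simp add: powr_minus_divide)
    finally show ?thesis by simp
  qed
  have w2: "(w x0)\<^sup>2 \<le> 2 * K" using E_bound2[of x0] x0 zero_le_power2[of "v x0"] unfolding E_def by linarith
  have "s * (1 / s * G - X / 2 * (1 / (s * M)) * H) = G - X / 2 / M * H" if "s > 0" for s G X M H :: real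
    using that by (simp add: right_diff_distrib)
  from this[of "sqrt m" "g x0" x0 "m\<^sup>2" "h x0"]
  have "sqrt m * w x0 = g x0 - x0 / 2 / m\<^sup>2 * h x0"
    unfolding w_def x0(2) p1 p5 using m by simp
  then have g: "g x0 = sqrt m * w x0 + x0 / 2 / m\<^sup>2 * h x0" by linarith
  have sq: "(s + t)\<^sup>2 \<le> 2 * (s\<^sup>2 + t\<^sup>2)" for s t :: real
    using sum_squares_bound[of s t] by (simp add: power2_sum)
  have "(g x0)\<^sup>2 \<le> 2 * ((sqrt m * w x0)\<^sup>2 + (x0 / 2 / m\<^sup>2 * h x0)\<^sup>2)"
    unfolding g by (rule sq)
  moreover have "(sqrt m * w x0)\<^sup>2 \<le> m * (2 * K)"
    using w2 m by (simp add: power_mult_distrib mult_left_mono)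
  moreover have "(x0 / 2 / m\<^sup>2 * h x0)\<^sup>2 \<le> K * m / 2"
  proof -
    have "x0\<^sup>2 \<le> (m ^ 3)\<^sup>2" using x0 by (intro power_mono) auto
    then have "(x0 / 2 / m\<^sup>2 * h x0)\<^sup>2 \<le> (m ^ 3)\<^sup>2 / 4 / (m\<^sup>2)\<^sup>2 * (h x0)\<^sup>2"
      unfolding power_mult_distrib power_divide by (intro mult_right_mono divide_right_mono) auto
    also have "\<dots> = m / 4 * ((h x0)\<^sup>2 * m)"
    proof -
      have "(m ^ 3)\<^sup>2 = m\<^sup>2 * (m\<^sup>2)\<^sup>2" by (simp flip: power_add power_mult)
      then show ?thesis using m by (simp add: power2_eq_square)
    qed
    also have "\<dots> \<le> m / 4 * (2 * K)" using h m by (intro mult_left_mono) auto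
    finally show ?thesis by (simp add: field_simps)
  qed
  moreover have "m\<^sup>2 * (h x0)\<^sup>2 \<le> 2 * K * m"
    using mult_left_mono[OF h, of m] m by (simp add: power2_eq_square algebra_simps)
  ultimately show ?thesis by (simp add: algebra_simps)
qed

text \<open>Inside the zone \<open>0 \<le> Q \<le> m^2\<close>, so \<open>m^2 h^2 + g^2\<close>
  grows at rate at most \<open>m\<close> over a length of at most \<open>1 / m\<close>. The factor
  is \<open>exp 1 \<le> 3\<close>, whence \<open>21 = 7 * 3\<close>.\<close>

lemma h_bound_turning:
  assumes "x0 \<le> x" "x \<le> m ^ 3"
  shows "(h x)\<^sup>2 * m \<le> 21 * K"
proof -
  have m: "m > 0" using m_ge1 by simp
  define G where "G x = m\<^sup>2 * (h x)\<^sup>2 + (g x)\<^sup>2" for x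
  have "G x * exp (- m * (x - x0)) \<le> G x0 * exp (- m * (x0 - x0))"
  proof (rule DERIV_nonpos_imp_nonincreasing[OF assms(1)])
    fix y assume y: "x0 \<le> y" "y \<le> x"
    have "x0\<^sup>2 \<le> y\<^sup>2" using y x0 by (intro power_mono) auto
    moreover have "y\<^sup>2 \<le> (m ^ 3)\<^sup>2" using y x0 assms by (intro power_mono) auto
    ultimately have Q: "0 \<le> Q y" "Q y \<le> m\<^sup>2"
      using x0(2) m6 by (auto simp: Q_def simp flip: power_mult)
    have "(G has_real_derivative 2 * m\<^sup>2 * h y * g y + 2 * g y * ((y\<^sup>2 - l) * h y)) (at y)"
      unfolding G_def by (rule derivative_eq_intros dh dg refl)+ (simp add: algebra_simps)
    then have dG: "(G has_real_derivative 2 * (m * h y) * g y * (m\<^sup>2 - Q y) / m) (at y)"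
      by (rule DERIV_cong) (use m in \<open>simp add: Q_def field_simps\<close>)
    have D: "((\<lambda>x. G x * exp (- m * (x - x0))) has_real_derivative
       exp (- m * (y - x0)) * (2 * (m * h y) * g y * (m\<^sup>2 - Q y) / m - m * G y)) (at y)"
      by (rule derivative_eq_intros dG refl)+ (simp add: algebra_simps)
    have "2 * (m * h y) * g y \<le> G y"
      unfolding G_def using sum_squares_bound[of "m * h y" "g y"] by (simp add: power_mult_distrib)
    then have "2 * (m * h y) * g y * (m\<^sup>2 - Q y) / m \<le> G y * (m\<^sup>2 - Q y) / m"
      using Q m by (intro divide_right_mono mult_right_mono) auto
    also have "\<dots> \<le> G y * m\<^sup>2 / m"
      using Q m by (intro divide_right_mono mult_left_mono) (auto simp: G_def)
    also have "\<dots> = m * G y" using m by (simp add: power2_eq_square)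
    finally have "2 * (m * h y) * g y * (m\<^sup>2 - Q y) / m - m * G y \<le> 0" by simp
    then have "exp (- m * (y - x0)) * (2 * (m * h y) * g y * (m\<^sup>2 - Q y) / m - m * G y) \<le> 0"
      by (simp add: mult_nonneg_nonpos)
    with D show "\<exists>z. ((\<lambda>x. G x * exp (- m * (x - x0))) has_real_derivative z) (at y) \<and> z \<le> 0"
      by blast
  qed
  also have "\<dots> \<le> 7 * K * m" using g_x0 by (simp add: G_def)
  finally have "G x * exp (- m * (x - x0)) \<le> 7 * K * m" .
  moreover have "exp (- 1) \<le> exp (- m * (x - x0))"
  proof -
    have "x - x0 \<le> 1 / m" using x0 assms by simp
    then have "m * (x - x0) \<le> 1" using m by (simp add: field_simps)
    then show ?thesis by simp
  qed
  then have "G x * exp (- 1) \<le> G x * exp (- m * (x - x0))"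
    by (intro mult_left_mono) (auto simp: G_def)
  ultimately have "G x * exp (- 1) \<le> 7 * K * m" by linarith
  then have "G x \<le> 7 * K * m * exp 1" by (simp add: exp_minus field_simps)
  also have "\<dots> \<le> 7 * K * m * 3" using exp_le K_nonneg m by (intro mult_left_mono) auto
  finally have "m\<^sup>2 * (h x)\<^sup>2 \<le> 7 * K * m * 3"
    unfolding G_def using zero_le_power2[of "g x"] by linarith
  then have "m * ((h x)\<^sup>2 * m) \<le> m * (21 * K)"
    by (simp add: power2_eq_square algebra_simps)
  then show ?thesis using m by simp
qed

definition "a = sqrt l"

lemma a: "a \<ge> 1" "a\<^sup>2 = l" "a = m ^ 3" unfolding a_def m3 using l by auto

lemma diff_l: "x\<^sup>2 - l = (x - a) * (x + a)"
  using a(2) by (simp add: power2_eq_square algebra_simps)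

lemma dh2: "((\<lambda>x. (h x)\<^sup>2) has_real_derivative 2 * h x * g x) (at x)"
  by (rule derivative_eq_intros dh refl)+ simp

lemma dhg: "((\<lambda>x. 2 * h x * g x) has_real_derivative 2 * (g x)\<^sup>2 + 2 * (x\<^sup>2 - l) * (h x)\<^sup>2) (at x)"
  by (rule derivative_eq_intros dh dg refl)+ (simp add: power2_eq_square algebra_simps)

text \<open>Beyond the turning point \<open>h\<^sup>2\<close> is convex; tending to \<open>0\<close>, it must decrease.\<close>

lemma hg_nonpos:
  assumes "a \<le> x"
  shows "2 * h x * g x \<le> 0"
proof (rule ccontr)
  assume "\<not> ?thesis"
  then have pos: "2 * h x * g x > 0" by simp
  have mono: "2 * h x * g x \<le> 2 * h y * g y" if "x \<le> y" for y
  proof (rule DERIV_nonneg_imp_nondecreasing[OF that])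
    fix z assume z: "x \<le> z" "z \<le> y"
    have "a\<^sup>2 \<le> z\<^sup>2" using z assms a(1) by (intro power_mono) auto
    then have "0 \<le> 2 * (g z)\<^sup>2 + 2 * (z\<^sup>2 - l) * (h z)\<^sup>2" using a(2) by simp
    with dhg show "\<exists>y. ((\<lambda>x. 2 * h x * g x) has_real_derivative y) (at z) \<and> 0 \<le> y" by blast
  qed
  have inc: "(h x)\<^sup>2 \<le> (h y)\<^sup>2" if "x \<le> y" for y
  proof (rule DERIV_nonneg_imp_nondecreasing[OF that])
    fix z assume z: "x \<le> z" "z \<le> y"
    then show "\<exists>y. ((\<lambda>x. (h x)\<^sup>2) has_real_derivative y) (at z) \<and> 0 \<le> y"
      using dh2 mono[of z] pos by (meson less_imp_le order_trans)
  qed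
  have "((\<lambda>x. (h x)\<^sup>2) \<longlongrightarrow> 0\<^sup>2) at_top" by (intro tendsto_intros lim)
  then have "(h x)\<^sup>2 \<le> 0\<^sup>2"
    by (rule tendsto_lowerbound) (auto intro!: eventually_at_top_linorderI[of x] inc)
  then show False using pos by simp
qed

lemma h_antimono:
  assumes "a \<le> x" "x \<le> y"
  shows "(h y)\<^sup>2 \<le> (h x)\<^sup>2"
proof (rule DERIV_nonpos_imp_nonincreasing[OF assms(2)])
  fix z assume "x \<le> z" "z \<le> y"
  then show "\<exists>y. ((\<lambda>x. (h x)\<^sup>2) has_real_derivative y) (at z) \<and> y \<le> 0"
    using dh2 hg_nonpos[of z] assms by (meson order_trans)
qed

lemma h_bound_uniform:
  assumes "0 \<le> x"
  shows "(h x)\<^sup>2 * m \<le> 21 * K"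
proof -
  consider "x \<le> x0" | "x0 \<le> x" "x \<le> a" | "a \<le> x" by linarith
  then show ?thesis
  proof cases
    case 1
    have "x\<^sup>2 \<le> x0\<^sup>2" using 1 assms by (intro power_mono) auto
    then have Q: "m\<^sup>2 \<le> Q x" using x0(2) by (simp add: Q_def)
    then have "sqrt (m\<^sup>2) \<le> sqrt (Q x)" by (rule real_sqrt_le_mono)
    then have "m \<le> sqrt (Q x)" using m_ge1 by simp
    then have "(h x)\<^sup>2 * m \<le> (h x)\<^sup>2 * sqrt (Q x)" by (intro mult_left_mono) auto
    then show ?thesis using h_bound_inner[OF assms Q] K_nonneg by linarith
  next
    case 2
    then show ?thesis using h_bound_turning a by simp
  next
    case 3
    have "(h x)\<^sup>2 * m \<le> (h a)\<^sup>2 * m" using h_antimono[OF _ 3] m_ge1 by (intro mult_right_mono) auto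
    also have "\<dots> \<le> 21 * K" using h_bound_turning[of a] a x0 by simp
    finally show ?thesis .
  qed
qed

lemma h_bound_allowed:
  assumes "0 \<le> x" "Q x > 0"
  shows "(h x)\<^sup>2 * sqrt (Q x) \<le> 21 * K"
proof (cases "m\<^sup>2 \<le> Q x")
  case True
  then show ?thesis using h_bound_inner[OF assms(1)] K_nonneg by fastforce
next
  case False
  then have "sqrt (Q x) \<le> m" using m_ge1 by (intro real_le_lsqrt) auto
  then have "(h x)\<^sup>2 * sqrt (Q x) \<le> (h x)\<^sup>2 * m" by (intro mult_left_mono) auto
  then show ?thesis using h_bound_uniform[OF assms(1)] by linarith
qed

text \<open>On \<open>[a, x]\<close> one has \<open>(h^2)''(y) \<ge> 2 (y^2 - l) h(x)^2\<close>,
  because \<open>h^2\<close> decreases. Integrating this against \<open>y - a\<close> by parts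
  leaves \<open>h(a)^2\<close> and a boundary term with the sign given by \<open>hg_nonpos\<close>.
  Algebraic decay is enough for the sums over the index later.\<close>

lemma h_decay:
  assumes "a \<le> x"
  shows "(h x)\<^sup>2 * ((x - a) ^ 3 * (x + a)) \<le> 2 * (h a)\<^sup>2"
proof -
  \<comment> \<open>\<open>R\<close> is the antiderivative of \<open>2 (y - a)^2 (y + a)\<close>
    that vanishes at \<open>a\<close>; in \<open>P\<close> the first two terms are the part
    integrated by parts.\<close>
  define R where "R y = (y - a) ^ 4 / 2 + 4 / 3 * a * (y - a) ^ 3" for y
  define P where "P y = (h y)\<^sup>2 - (y - a) * (2 * h y * g y) + (h x)\<^sup>2 * R y" for y
  have "P x \<le> P a"
  proof (rule DERIV_nonpos_imp_nonincreasing[OF assms])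
    fix y assume y: "a \<le> y" "y \<le> x"
    have dR: "(R has_real_derivative 2 * (y - a)\<^sup>2 * (y + a)) (at y)"
      unfolding R_def
      by (rule DERIV_cong[OF DERIV_add[OF DERIV_cdivide[OF DERIV_power[OF DERIV_diff[OF DERIV_ident DERIV_const]]]
            DERIV_cmult[OF DERIV_power[OF DERIV_diff[OF DERIV_ident DERIV_const]]]]])
        (simp add: eval_nat_numeral field_simps)
    have D: "(P has_real_derivative - (y - a) * (2 * (g y)\<^sup>2 + 2 * (y\<^sup>2 - l) * (h y)\<^sup>2)
       + (h x)\<^sup>2 * (2 * (y - a)\<^sup>2 * (y + a))) (at y)"
      unfolding P_def
      by (rule DERIV_cong[OF DERIV_add[OF DERIV_diff[OF dh2 DERIV_mult[OF DERIV_diff[OF DERIV_ident DERIV_const] dhg]]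
            DERIV_cmult[OF dR]]]) (simp add: algebra_simps)
    have "(h x)\<^sup>2 * (2 * (y - a)\<^sup>2 * (y + a)) \<le> (h y)\<^sup>2 * (2 * (y - a)\<^sup>2 * (y + a))"
      using h_antimono[OF y] y a(1) by (intro mult_right_mono mult_nonneg_nonneg) auto
    also have "\<dots> = (y - a) * (2 * (y\<^sup>2 - l) * (h y)\<^sup>2)"
      unfolding diff_l by (simp add: power2_eq_square algebra_simps)
    also have "\<dots> \<le> (y - a) * (2 * (g y)\<^sup>2 + 2 * (y\<^sup>2 - l) * (h y)\<^sup>2)"
      using y by (intro mult_left_mono) auto
    finally have "- (y - a) * (2 * (g y)\<^sup>2 + 2 * (y\<^sup>2 - l) * (h y)\<^sup>2)
       + (h x)\<^sup>2 * (2 * (y - a)\<^sup>2 * (y + a)) \<le> 0"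
      by (simp only: minus_mult_left[symmetric])
    with D show "\<exists>z. (P has_real_derivative z) (at y) \<and> z \<le> 0" by blast
  qed
  moreover have "P a = (h a)\<^sup>2" by (simp add: P_def R_def)
  moreover have "(x - a) * (2 * h x * g x) \<le> 0"
    using assms by (intro mult_nonneg_nonpos[OF _ hg_nonpos[OF assms]]) simp
  ultimately have "(h x)\<^sup>2 * R x \<le> (h a)\<^sup>2"
    unfolding P_def using zero_le_power2[of "h x"] by linarith
  moreover have "(x - a) ^ 3 * (x + a) \<le> 2 * R x"
  proof -
    have "2 * R x - (x - a) ^ 3 * (x + a) = 2 / 3 * a * (x - a) ^ 3"
    proof -
      have "2 * (t ^ 4 / 2 + 4 / 3 * a * t ^ 3) - t ^ 3 * (t + 2 * a) = 2 / 3 * a * t ^ 3" for t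
        by (simp add: eval_nat_numeral algebra_simps)
      from this[of "x - a"] show ?thesis unfolding R_def by (simp add: add.commute)
    qed
    also have "\<dots> \<ge> 0" using a(1) assms by simp
    finally show ?thesis by simp
  qed
  then have "(h x)\<^sup>2 * ((x - a) ^ 3 * (x + a)) \<le> (h x)\<^sup>2 * (2 * R x)"
    by (intro mult_left_mono) auto
  ultimately show ?thesis by simp
qed

text \<open>The target contains \<open>(x - a)^2 (x + a)^2\<close>, whereas \<open>h_decay\<close>
  controls \<open>(x - a)^3 (x + a)\<close>. The fact \<open>key\<close> trades one factor
  \<open>x + a\<close> for \<open>9 (x - a) m^4\<close>, which is where the distance from the
  turning point enters. The constant is \<open>378 = 9 * 2 * 21\<close>.\<close>

lemma h_bound_forbidden:
  assumes "0 \<le> x" "x\<^sup>2 - l \<ge> m\<^sup>2"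
  shows "(h x)\<^sup>2 * (x\<^sup>2 - l)\<^sup>2 \<le> 378 * K * sqrt l"
proof -
  have m: "m > 0" using m_ge1 by simp
  have "a\<^sup>2 \<le> x\<^sup>2" using assms a(2) zero_le_power2[of m] by linarith
  then have ax: "a \<le> x" using assms(1) by (rule power2_le_imp_le)
  have Q: "x\<^sup>2 - l = (x - a) * (x + a)" by (rule diff_l)
  have key: "x + a \<le> 9 * (x - a) * m ^ 4"
  proof (cases "x \<le> 2 * a")
    case True
    have "(x + a) * (x + a) \<le> (3 * a) * (3 * a)"
      using True ax a(1) by (intro mult_mono) auto
    also have "\<dots> = 9 * m\<^sup>2 * m ^ 4" unfolding a(3) by (simp add: eval_nat_numeral)
    also have "\<dots> \<le> 9 * ((x - a) * (x + a)) * m ^ 4"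
      using assms(2) Q m by (intro mult_right_mono mult_left_mono) auto
    finally have "(x + a) * (x + a) \<le> (9 * (x - a) * m ^ 4) * (x + a)" by (simp add: algebra_simps)
    then show ?thesis using ax a(1) by (subst (asm) mult_le_cancel_right) auto
  next
    case False
    have "1 \<le> m ^ 4" using m_ge1 by simp
    then have "9 * (x - a) * 1 \<le> 9 * (x - a) * m ^ 4"
      using ax by (intro mult_left_mono) auto
    moreover have "x + a \<le> 9 * (x - a) * 1" using False a(1) by simp
    ultimately show ?thesis by (rule order_trans[rotated])
  qed
  have "(h x)\<^sup>2 * (x\<^sup>2 - l)\<^sup>2 = (h x)\<^sup>2 * ((x - a)\<^sup>2 * (x + a)) * (x + a)"
    unfolding Q by (simp add: power2_eq_square algebra_simps)
  also have "\<dots> \<le> (h x)\<^sup>2 * ((x - a)\<^sup>2 * (x + a)) * (9 * (x - a) * m ^ 4)"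
    using key ax a(1) by (intro mult_left_mono) auto
  also have "\<dots> = 9 * m ^ 4 * ((h x)\<^sup>2 * ((x - a) ^ 3 * (x + a)))"
    by (simp add: power2_eq_square power3_eq_cube algebra_simps)
  also have "\<dots> \<le> 9 * m ^ 4 * (2 * (h a)\<^sup>2)"
    using h_decay[OF ax] m by (intro mult_left_mono) auto
  also have "\<dots> = 18 * m ^ 3 * ((h a)\<^sup>2 * m)" by (simp add: eval_nat_numeral algebra_simps)
  also have "\<dots> \<le> 18 * m ^ 3 * (21 * K)"
    using h_bound_uniform[of a] a(1) m by (intro mult_left_mono) auto
  finally show ?thesis unfolding m3 by (simp add: algebra_simps)
qed

end

section \<open>Convolutions in the index of sequences with WKB bounds\<close>

lemma sum_inverse_sqrt_le: "(\<Sum>l<n. 1 / sqrt (real l + 1)) \<le> 2 * sqrt n"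
proof (induction n)
  case (Suc n)
  have "(sqrt (real n + 1) - sqrt n) * (sqrt (real n + 1) + sqrt n) = 1"
    by (simp add: algebra_simps)
  moreover have "(sqrt (real n + 1) - sqrt n) * (sqrt (real n + 1) + sqrt n) \<le>
     (sqrt (real n + 1) - sqrt n) * (2 * sqrt (real n + 1))"
    by (intro mult_left_mono) auto
  ultimately have "1 \<le> (2 * (sqrt (real n + 1) - sqrt n)) * sqrt (real n + 1)" by (simp add: algebra_simps)
  then have "1 / sqrt (real n + 1) \<le> 2 * (sqrt (real n + 1) - sqrt n)"
    by (subst pos_divide_le_eq) auto
  then show ?case using Suc by (simp add: add.commute)
qed simp

lemma sum_inverse_square_tail_le:
  assumes "1 \<le> n"
  shows "(\<Sum>l=n..k. 1 / (real l)\<^sup>2) \<le> 2 / n"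
proof (cases "n \<le> k")
  case True
  then have "(\<Sum>l=n..k. 1 / (real l)\<^sup>2) \<le> 2 / n - 1 / k"
  proof (induction k rule: dec_induct)
    case base
    have "1 * real n \<le> real n * real n" using assms by (intro mult_right_mono) auto
    then show ?case using assms by (simp add: power2_eq_square field_simps)
  next
    case (step k)
    have k: "real k > 0" using step assms by simp
    have "1 / (real (Suc k))\<^sup>2 \<le> 1 / (real k * real (Suc k))"
      unfolding power2_eq_square using k by (intro divide_left_mono mult_right_mono) auto
    also have "\<dots> = 1 / k - 1 / Suc k" using k by (simp add: field_simps)
    finally show ?case using step by simp
  qed
  moreover have "1 / real k \<ge> 0" by simp
  ultimately show ?thesis by linarith
qed simp

text \<open>A discrete Beta integral with parameters \<open>1/2\<close>. With
  \<open>a = sqrt (i + 1)\<close> and \<open>b = sqrt (n - i + 1)\<close>, the inequality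
  \<open>a + b \<ge> sqrt (n + 1)\<close> allows a partial fraction decomposition of
  \<open>1 / (a b)\<close>.\<close>

lemma sum_inverse_sqrt_convolution_le:
  "(\<Sum>i\<le>n. 1 / (sqrt (real i + 1) * sqrt (real (n - i) + 1))) \<le> 6"
proof -
  have *: "1 / (sqrt (real i + 1) * sqrt (real (n - i) + 1)) \<le>
      sqrt 2 / sqrt (real n + 1) * (1 / sqrt (real i + 1) + 1 / sqrt (real (n - i) + 1))"
    if "i \<le> n" for i
  proof -
    define a b where "a = sqrt (real i + 1)" and "b = sqrt (real (n - i) + 1)"
    have ab: "a > 0" "b > 0" by (auto simp: a_def b_def)
    have "real n + 1 \<le> a\<^sup>2 + b\<^sup>2" using that by (simp add: a_def b_def of_nat_diff)
    also have "\<dots> \<le> (a + b)\<^sup>2" using ab by (simp add: power2_sum)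
    finally have "sqrt (real n + 1) \<le> a + b" using ab by (intro real_le_lsqrt) auto
    also have "\<dots> \<le> sqrt 2 * (a + b)" using ab by simp
    finally have "1 \<le> sqrt 2 / sqrt (real n + 1) * (a + b)" by (simp add: field_simps)
    then have "1 / (a * b) \<le> (sqrt 2 / sqrt (real n + 1) * (a + b)) / (a * b)"
      using ab by (intro divide_right_mono) auto
    also have "\<dots> = sqrt 2 / sqrt (real n + 1) * (1 / a + 1 / b)" using ab by (simp add: field_simps)
    finally show ?thesis by (simp add: a_def b_def)
  qed
  have s: "(\<Sum>i\<le>n. 1 / sqrt (real i + 1)) \<le> 2 * sqrt (real n + 1)"
    using sum_inverse_sqrt_le[of "Suc n"] by (simp add: lessThan_Suc_atMost add.commute)
  have r: "(\<Sum>i\<le>n. 1 / sqrt (real (n - i) + 1)) = (\<Sum>i\<le>n. 1 / sqrt (real i + 1))"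
    by (rule sum.reindex_bij_witness[of _ "\<lambda>i. n - i" "\<lambda>i. n - i"]) auto
  have "(\<Sum>i\<le>n. 1 / (sqrt (real i + 1) * sqrt (real (n - i) + 1))) \<le>
    (\<Sum>i\<le>n. sqrt 2 / sqrt (real n + 1) * (1 / sqrt (real i + 1) + 1 / sqrt (real (n - i) + 1)))"
    by (intro sum_mono *) auto
  also have "\<dots> = sqrt 2 / sqrt (real n + 1) * (2 * (\<Sum>i\<le>n. 1 / sqrt (real i + 1)))"
    by (simp only: sum.distrib r flip: sum_distrib_left) simp
  also have "\<dots> \<le> sqrt 2 / sqrt (real n + 1) * (2 * (2 * sqrt (real n + 1)))"
    by (intro mult_left_mono s) auto
  also have "\<dots> = 4 * sqrt 2" by simp
  also have "\<dots> \<le> 4 * (3/2)"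
    by (intro mult_left_mono real_le_lsqrt) (auto simp: power2_eq_square)
  finally show ?thesis by simp
qed

text \<open>The roles are exchanged here: the radius is fixed, with square \<open>r2\<close>, and
  the squared Hermite functions at that radius form a sequence \<open>a\<close> in the index. One
  constant \<open>C\<close> serves all three regions.\<close>

locale wkb_bounds =
  fixes a :: "nat \<Rightarrow> real" and r2 :: real and C :: real
  assumes nonneg: "\<And>n. 0 \<le> a n" and C: "0 \<le> C"
    and uniform: "\<And>n. a n * (2 * real n + 1) powr (1/6) \<le> C"
    and allowed: "\<And>n. r2 < 2 * real n + 1 \<Longrightarrow> a n * sqrt (2 * real n + 1 - r2) \<le> C"
    and forbidden: "\<And>n. (2 * real n + 1) powr (1/3) \<le> r2 - (2 * real n + 1) \<Longrightarrow>
       a n * (r2 - (2 * real n + 1))\<^sup>2 \<le> C * sqrt (2 * real n + 1)"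
begin

text \<open>With \<open>i = k - n\<close>, the transition zone in the index has about
  \<open>m^2\<close> terms. In it the uniform bound \<open>2 C / m\<close> meets a sum of
  \<open>i^(-1/2)\<close> of order \<open>m\<close>. Beyond it the decay \<open>C m^3 / i^2\<close>,
  together with \<open>sqrt (i + 1) \<ge> m\<close> and a tail sum of order \<open>m^(-2)\<close>,
  is again of order \<open>C\<close>.\<close>

lemma sum_forbidden:
  assumes "2 * real k + 1 \<le> r2"
  shows "(\<Sum>n\<le>k. a n / sqrt (real (k - n) + 1)) \<le> 7 * C"
proof -
  define l where "l = 2 * real k + 1"
  define m where "m = l powr (1/6)"
  have l1: "l \<ge> 1" by (simp add: l_def)
  have m1: "m \<ge> 1" unfolding m_def using l1 by (simp add: ge_one_powr_ge_zero)
  have m_pow: "m ^ i = l powr (real i / 6)" for i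
    using l1 by (simp add: m_def powr_powr flip: powr_realpow)
  have m6: "m ^ 6 = l" using l1 by (simp add: m_pow)
  have m3: "m ^ 3 = sqrt l" using l1 by (simp add: m_pow powr_half_sqrt)
  have m2: "m ^ 2 = l powr (1/3)" using l1 by (simp add: m_pow)
  define N where "N = nat \<lceil>m\<^sup>2\<rceil>"
  have N: "m\<^sup>2 \<le> real N" "real N \<le> 2 * m\<^sup>2" "1 \<le> N"
  proof -
    have "1 \<le> m\<^sup>2" using m1 by simp
    then show "m\<^sup>2 \<le> real N" "real N \<le> 2 * m\<^sup>2" unfolding N_def by linarith+
    then show "1 \<le> N" using \<open>1 \<le> m\<^sup>2\<close> by linarith
  qed
  have near: "a (k - i) \<le> 2 * C / m" if i: "i \<le> k" "real i < m\<^sup>2" for i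
  proof -
    have e: "2 * real (k - i) + 1 = l - 2 * real i" using i by (simp add: l_def of_nat_diff)
    \<comment> \<open>The uniform bound at index \<open>k - i\<close> must not be much weaker than
      at \<open>k\<close>. For \<open>m > 2\<close> the shift satisfies
      \<open>i < m^2 \<le> l / 16\<close>; for \<open>m \<le> 2\<close> the left side is at most
      \<open>1\<close>.\<close>
    have "(m / 2) ^ 6 \<le> 2 * real (k - i) + 1"
    proof (cases "m \<le> 2")
      case True
      have "(m / 2) ^ 6 \<le> 1 ^ 6" using True m1 by (intro power_mono) auto
      then show ?thesis by simp
    next
      case False
      have "(2::real) ^ 4 \<le> m ^ 4" using False by (intro power_mono) auto
      then have "m\<^sup>2 * 16 \<le> m\<^sup>2 * m ^ 4" by (intro mult_left_mono) auto
      also have "\<dots> = l" by (simp add: m6 flip: power_add)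
      finally have "m\<^sup>2 * 16 \<le> l" .
      moreover have "(m / 2) ^ 6 = l / 64" by (simp add: power_divide m6)
      ultimately show ?thesis unfolding e using i(2) l1 by linarith
    qed
    then have "((m / 2) ^ 6) powr (1/6) \<le> (2 * real (k - i) + 1) powr (1/6)"
      using m1 by (intro powr_mono2) auto
    moreover have "((m / 2) ^ 6) powr (1/6) = m / 2"
    proof -
      have "((m / 2) ^ 6) powr (1/6) = ((m / 2) powr 6) powr (1/6)" using m1 by (simp add: powr_numeral)
      also have "\<dots> = m / 2" using m1 by (simp only: powr_powr) simp
      finally show ?thesis .
    qed
    ultimately have "a (k - i) * (m / 2) \<le> a (k - i) * (2 * real (k - i) + 1) powr (1/6)"
      using nonneg by (intro mult_left_mono) auto
    also have "\<dots> \<le> C" by (rule uniform)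
    finally show ?thesis using m1 by (simp add: field_simps)
  qed
  have far: "a (k - i) \<le> C * m ^ 3 / 4 * (1 / (real i)\<^sup>2)" if i: "i \<le> k" "m\<^sup>2 \<le> real i" for i
  proof -
    have i0: "real i > 0" using i(2) m1 by (smt (verit) one_le_power)
    have d: "2 * real i \<le> r2 - (2 * real (k - i) + 1)" using i assms by (simp add: of_nat_diff)
    have kl: "2 * real (k - i) + 1 \<le> l" by (simp add: l_def)
    have "(2 * real (k - i) + 1) powr (1/3) \<le> l powr (1/3)" using kl by (intro powr_mono2) auto
    also have "\<dots> \<le> r2 - (2 * real (k - i) + 1)" using i(2) d i0 unfolding m2 by linarith
    finally have "a (k - i) * (r2 - (2 * real (k - i) + 1))\<^sup>2 \<le> C * sqrt (2 * real (k - i) + 1)"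
      by (rule forbidden)
    also have "\<dots> \<le> C * m ^ 3" unfolding m3 using kl C by (intro mult_left_mono) auto
    finally have "a (k - i) * (r2 - (2 * real (k - i) + 1))\<^sup>2 \<le> C * m ^ 3" .
    moreover have "a (k - i) * (2 * real i)\<^sup>2 \<le> a (k - i) * (r2 - (2 * real (k - i) + 1))\<^sup>2"
      using d by (intro mult_left_mono power_mono nonneg) auto
    ultimately have "a (k - i) * (2 * real i)\<^sup>2 \<le> C * m ^ 3" by linarith
    then show ?thesis using i0 by (simp add: field_simps power2_eq_square)
  qed
  have "(\<Sum>n\<le>k. a n / sqrt (real (k - n) + 1)) = (\<Sum>i\<le>k. a (k - i) / sqrt (real i + 1))"
    by (rule sum.reindex_bij_witness[of _ "\<lambda>i. k - i" "\<lambda>i. k - i"]) auto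
  also have "\<dots> \<le> (\<Sum>i\<le>k. (if i < N then 2 * C / m * (1 / sqrt (real i + 1)) else 0)
       + (if N \<le> i then C * m ^ 3 / 4 / m * (1 / (real i)\<^sup>2) else 0))"
  proof (rule sum_mono)
    fix i assume "i \<in> {..k}"
    then have ik: "i \<le> k" by simp
    show "a (k - i) / sqrt (real i + 1) \<le> (if i < N then 2 * C / m * (1 / sqrt (real i + 1)) else 0)
       + (if N \<le> i then C * m ^ 3 / 4 / m * (1 / (real i)\<^sup>2) else 0)"
    proof (cases "i < N")
      case True
      then have "real i < m\<^sup>2" unfolding N_def by linarith
      from divide_right_mono[OF near[OF ik this], of "sqrt (real i + 1)"] True show ?thesis by simp
    next
      case False
      then have i: "m\<^sup>2 \<le> real i" using N by linarith
      have "m \<le> sqrt (real i + 1)" using i m1 by (intro real_le_rsqrt) auto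
      have "a (k - i) / sqrt (real i + 1) \<le> C * m ^ 3 / 4 * (1 / (real i)\<^sup>2) / sqrt (real i + 1)"
        using far[OF ik i] by (intro divide_right_mono) auto
      also have "\<dots> \<le> C * m ^ 3 / 4 * (1 / (real i)\<^sup>2) / m"
        using \<open>m \<le> sqrt (real i + 1)\<close> m1 C by (intro divide_left_mono) auto
      finally show ?thesis using False by (simp add: algebra_simps)
    qed
  qed
  also have "\<dots> = 2 * C / m * (\<Sum>i | i \<le> k \<and> i < N. 1 / sqrt (real i + 1))
     + C * m ^ 3 / 4 / m * (\<Sum>i=N..k. 1 / (real i)\<^sup>2)"
  proof -
    have 1: "{..k} \<inter> {i. i < N} = {i. i \<le> k \<and> i < N}" "{..k} \<inter> {i. N \<le> i} = {N..k}" by auto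
    show ?thesis by (simp only: sum.distrib sum.inter_restrict[symmetric] finite_atMost sum_distrib_left)
       (simp add: sum.If_cases 1)
  qed
  also have "\<dots> \<le> 2 * C / m * (2 * sqrt N) + C * m ^ 3 / 4 / m * (2 / N)"
  proof (intro add_mono mult_left_mono)
    have "(\<Sum>i | i \<le> k \<and> i < N. 1 / sqrt (real i + 1)) \<le> (\<Sum>i<N. 1 / sqrt (real i + 1))"
      by (rule sum_mono2) auto
    then show "(\<Sum>i | i \<le> k \<and> i < N. 1 / sqrt (real i + 1)) \<le> 2 * sqrt N"
      using sum_inverse_sqrt_le[of N] by linarith
  qed (use N m1 C sum_inverse_square_tail_le in auto)
  also have "\<dots> \<le> 2 * C / m * (2 * (3/2 * m)) + C * m ^ 3 / 4 / m * (2 / m\<^sup>2)"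
  proof (intro add_mono mult_left_mono)
    have "real N \<le> (3/2 * m)\<^sup>2" using N(2) by (simp add: power2_eq_square)
    then show "sqrt N \<le> 3/2 * m" using m1 by (intro real_le_lsqrt) auto
    show "2 / real N \<le> 2 / m\<^sup>2" using N m1 by (intro divide_left_mono) auto
  qed (use m1 C in auto)
  also have "\<dots> = 6 * C + C / 2" using m1 by (simp add: power2_eq_square power3_eq_cube)
  finally show ?thesis using C by linarith
qed

text \<open>The indices are split at the first allowed one, \<open>s\<close>. The forbidden part
  contributes \<open>7 C\<close>; the allowed part is a convolution of two inverse square roots and
  contributes \<open>6 C\<close>.\<close>

lemma sum_convolution:
  "(\<Sum>n\<le>k. a n / sqrt (real (k - n) + 1)) \<le> 13 * C"
proof -
  define s where "s = (LEAST s. r2 < 2 * real s + 1)"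
  have ex: "\<exists>s. r2 < 2 * real s + 1"
  proof -
    obtain n where "r2 < real n" using reals_Archimedean2 by blast
    then show ?thesis by (intro exI[of _ n]) simp
  qed
  have s: "r2 < 2 * real s + 1" unfolding s_def using LeastI_ex[OF ex] .
  have below: "2 * real n + 1 \<le> r2" if "n < s" for n
    using that not_less_Least[of n "\<lambda>s. r2 < 2 * real s + 1"] unfolding s_def by linarith
  \<comment> \<open>The allowed bound degenerates only at \<open>n = s\<close>, where
    \<open>2 n + 1 - r2\<close> may be arbitrarily small; there the uniform bound takes
    over.\<close>
  have above: "a n \<le> C / sqrt (real (n - s) + 1)" if n: "s \<le> n" for n
  proof -
    have a: "a n * sqrt (2 * real n + 1 - r2) \<le> C" using s n by (intro allowed) linarith
    have u: "a n \<le> C"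
    proof -
      have "1 \<le> (2 * real n + 1) powr (1/6)" by (simp add: ge_one_powr_ge_zero)
      then have "a n * 1 \<le> a n * (2 * real n + 1) powr (1/6)" by (intro mult_left_mono nonneg)
      then show ?thesis using uniform[of n] by linarith
    qed
    show ?thesis
    proof (cases "n = s")
      case False
      then have "real (n - s) + 1 \<le> 2 * real n + 1 - r2" using s n by (simp add: of_nat_diff)
      then have "a n * sqrt (real (n - s) + 1) \<le> a n * sqrt (2 * real n + 1 - r2)"
        by (intro mult_left_mono nonneg) auto
      then have "a n * sqrt (real (n - s) + 1) \<le> C" using a by linarith
      then show ?thesis by (simp add: field_simps)
    qed (use u in simp)
  qed
  have "(\<Sum>n\<le>k. a n / sqrt (real (k - n) + 1)) =
    (\<Sum>n | n \<le> k \<and> n < s. a n / sqrt (real (k - n) + 1)) + (\<Sum>n=s..k. a n / sqrt (real (k - n) + 1))"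
    by (subst sum.union_disjoint[symmetric]) (auto intro!: sum.cong)
  also have "(\<Sum>n | n \<le> k \<and> n < s. a n / sqrt (real (k - n) + 1)) \<le> 7 * C"
  proof (cases s)
    case (Suc s')
    \<comment> \<open>If \<open>s \<le> k\<close>, then \<open>sum_forbidden\<close> reaches only up
      to \<open>s - 1\<close>; replacing \<open>k\<close> by \<open>k'\<close> in the denominators
      can only increase the terms.\<close>
    define k' where "k' = min k s'"
    have "(\<Sum>n | n \<le> k \<and> n < s. a n / sqrt (real (k - n) + 1)) \<le>
       (\<Sum>n | n \<le> k \<and> n < s. a n / sqrt (real (k' - n) + 1))"
      by (intro sum_mono divide_left_mono nonneg) (auto simp: k'_def intro!: mult_pos_pos)
    also have "\<dots> = (\<Sum>n\<le>k'. a n / sqrt (real (k' - n) + 1))"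
      by (intro sum.cong) (auto simp: k'_def Suc)
    also have "\<dots> \<le> 7 * C"
      by (intro sum_forbidden below) (auto simp: k'_def Suc)
    finally show ?thesis .
  qed (use C in simp)
  also have "(\<Sum>n=s..k. a n / sqrt (real (k - n) + 1)) \<le> 6 * C"
  proof (cases "s \<le> k")
    case True
    have "(\<Sum>n=s..k. a n / sqrt (real (k - n) + 1)) \<le>
       (\<Sum>n=s..k. C / sqrt (real (n - s) + 1) / sqrt (real (k - n) + 1))"
      by (intro sum_mono divide_right_mono above) auto
    also have "\<dots> = (\<Sum>i\<le>k - s. C / sqrt (real i + 1) / sqrt (real (k - s - i) + 1))"
      by (rule sum.reindex_bij_witness[of _ "\<lambda>i. i + s" "\<lambda>n. n - s"]) (use True in auto)
    also have "\<dots> = C * (\<Sum>i\<le>k - s. 1 / (sqrt (real i + 1) * sqrt (real (k - s - i) + 1)))"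
      by (simp add: sum_distrib_left)
    also have "\<dots> \<le> C * 6"
      by (intro mult_left_mono sum_inverse_sqrt_convolution_le C)
    finally show ?thesis by simp
  qed (use C in simp)
  finally show ?thesis by simp
qed

end

section \<open>The generating function of the squared Hermite functions\<close>

text \<open>One term of the exponential series at \<open>y = x^2 / 2\<close> bounds the even powers,
  and \<open>|x|^k \<le> 1 + x^(2k)\<close> reduces all powers to these.\<close>

lemma power_times_gaussian_bounded: "\<exists>C. \<forall>x::real. \<bar>x\<bar> ^ k * exp (- x\<^sup>2 / 2) \<le> C"
proof (intro exI allI)
  fix x :: real
  define y where "y = x\<^sup>2 / 2"
  have y: "y \<ge> 0" by (simp add: y_def)
  have "sum (\<lambda>n. inverse (fact n) * y ^ n) {k} \<le> (\<Sum>n. inverse (fact n) * y ^ n)"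
    by (rule sum_le_suminf[OF summable_exp]) (use y in auto)
  also have "\<dots> = exp y" using exp_converges[of y, THEN sums_unique] by (simp add: field_simps)
  finally have "y ^ k \<le> fact k * exp y" by (simp add: field_simps)
  then have "2 ^ k * (y ^ k * exp (- y)) \<le> 2 ^ k * fact k" by (simp add: exp_minus field_simps)
  moreover have "(x\<^sup>2) ^ k = 2 ^ k * y ^ k" by (simp add: y_def power_divide)
  ultimately have 1: "(x\<^sup>2) ^ k * exp (- y) \<le> 2 ^ k * fact k" by (simp add: mult.assoc)
  have "\<bar>x\<bar> ^ k \<le> 1 + (\<bar>x\<bar> ^ k)\<^sup>2"
    using sum_squares_bound[of "\<bar>x\<bar> ^ k" 1] zero_le_power[OF abs_ge_zero, of x k]
    unfolding power_one mult_1_right by linarith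
  also have "(\<bar>x\<bar> ^ k)\<^sup>2 = (x\<^sup>2) ^ k" by (metis power2_abs power_mult mult.commute)
  finally have "\<bar>x\<bar> ^ k * exp (- y) \<le> (1 + (x\<^sup>2) ^ k) * exp (- y)" by (intro mult_right_mono) auto
  also have "\<dots> \<le> 1 + 2 ^ k * fact k" using 1 y by (simp add: algebra_simps add_mono)
  finally show "\<bar>x\<bar> ^ k * exp (- x\<^sup>2 / 2) \<le> 1 + 2 ^ k * fact k" by (simp add: y_def)
qed

lemma hermite_fun_decay: "\<exists>C. \<forall>x. \<bar>x\<bar> ^ k * \<bar>hermite_fun n x\<bar> \<le> C"
proof (induction n arbitrary: k rule: induct_nat_012)
  case 0
  obtain C where C: "\<And>x::real. \<bar>x\<bar> ^ k * exp (- x\<^sup>2 / 2) \<le> C"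
    using power_times_gaussian_bounded by blast
  have "\<bar>x\<bar> ^ k * \<bar>hermite_fun 0 x\<bar> \<le> C / sqrt (sqrt pi)" for x
    using divide_right_mono[OF C[of x], of "sqrt (sqrt pi)"] by (simp add: abs_divide)
  then show ?case by blast
next
  case 1
  obtain C where C: "\<And>x::real. \<bar>x\<bar> ^ Suc k * exp (- x\<^sup>2 / 2) \<le> C"
    using power_times_gaussian_bounded by blast
  have "\<bar>x\<bar> ^ k * \<bar>hermite_fun (Suc 0) x\<bar> \<le> sqrt 2 * C / sqrt (sqrt pi)" for x
    using divide_right_mono[OF mult_left_mono[OF C[of x], of "sqrt 2"], of "sqrt (sqrt pi)"]
    by (simp add: abs_mult algebra_simps)
  then show ?case by blast
next
  case (ge2 n)
  obtain C where C: "\<And>x. \<bar>x\<bar> ^ Suc k * \<bar>hermite_fun (Suc n) x\<bar> \<le> C" using ge2(2) by blast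
  obtain D where D: "\<And>x. \<bar>x\<bar> ^ k * \<bar>hermite_fun n x\<bar> \<le> D" using ge2(1) by blast
  have "\<bar>x\<bar> ^ k * \<bar>hermite_fun (Suc (Suc n)) x\<bar> \<le>
     sqrt (2 / (real n + 2)) * C + sqrt ((real n + 1) / (real n + 2)) * D" for x
  proof -
    let ?a = "sqrt (2 / (real n + 2))" and ?b = "sqrt ((real n + 1) / (real n + 2))"
    have "\<bar>hermite_fun (Suc (Suc n)) x\<bar> \<le> \<bar>?a * x * hermite_fun (Suc n) x\<bar> + \<bar>?b * hermite_fun n x\<bar>"
      unfolding hermite_fun.simps(3) by (rule abs_triangle_ineq4)
    then have "\<bar>x\<bar> ^ k * \<bar>hermite_fun (Suc (Suc n)) x\<bar> \<le>
        \<bar>x\<bar> ^ k * (\<bar>?a * x * hermite_fun (Suc n) x\<bar> + \<bar>?b * hermite_fun n x\<bar>)"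
      by (intro mult_left_mono) auto
    also have "\<dots> = ?a * (\<bar>x\<bar> ^ Suc k * \<bar>hermite_fun (Suc n) x\<bar>) + ?b * (\<bar>x\<bar> ^ k * \<bar>hermite_fun n x\<bar>)"
      by (simp add: abs_mult algebra_simps)
    also have "\<dots> \<le> ?a * C + ?b * D" by (intro add_mono mult_left_mono C D) auto
    finally show ?thesis .
  qed
  then show ?case by blast
qed

lemma hermite_fun_tendsto_0: "(hermite_fun n \<longlongrightarrow> 0) at_infinity"
proof -
  obtain C where C: "\<And>x. \<bar>x\<bar> ^ 1 * \<bar>hermite_fun n x\<bar> \<le> C" using hermite_fun_decay by blast
  have lim: "((\<lambda>x::real. C * inverse x) \<longlongrightarrow> C * 0) at_infinity"
    by (intro tendsto_intros tendsto_inverse_0)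
  have "eventually (\<lambda>x. norm (hermite_fun n x) \<le> norm (C * inverse x)) at_infinity"
    unfolding eventually_at_infinity
  proof (intro exI[of _ 1] allI impI)
    fix x :: real assume "1 \<le> norm x"
    then have x: "\<bar>x\<bar> > 0" by simp
    have "\<bar>hermite_fun n x\<bar> \<le> C / \<bar>x\<bar>" using C[of x] x by (simp add: field_simps)
    also have "\<dots> \<le> \<bar>C\<bar> / \<bar>x\<bar>" by (intro divide_right_mono) auto
    finally show "norm (hermite_fun n x) \<le> norm (C * inverse x)"
      by (simp add: abs_mult divide_inverse)
  qed
  then show ?thesis by (rule Lim_null_comparison) (use tendsto_norm[OF lim] in simp)
qed

text \<open>\<open>1512 = 378 * 4\<close> is the largest of the three constants of
  \<open>oscillator_ode\<close>, with \<open>K = 4\<close> from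
  \<open>hermite_fun_energy_0\<close>.\<close>

lemma hermite_fun_wkb_bounds:
  assumes "0 \<le> r"
  shows "wkb_bounds (\<lambda>n. (hermite_fun n r)\<^sup>2) (r\<^sup>2) 1512"
proof
  fix n
  interpret oscillator_ode "hermite_fun n" "\<lambda>x. sqrt (2 * real n) * hermite_fun (n - 1) x - x * hermite_fun n x"
     "2 * real n + 1" 4
  proof
    show "(hermite_fun n \<longlongrightarrow> 0) at_top"
      using hermite_fun_tendsto_0 by (rule tendsto_mono[OF at_top_le_at_infinity])
  qed (use hermite_fun_deriv hermite_fun_deriv2 hermite_fun_energy_0[of n] in auto)
  show "0 \<le> (hermite_fun n r)\<^sup>2" "(0::real) \<le> 1512" by auto
  show "(hermite_fun n r)\<^sup>2 * (2 * real n + 1) powr (1 / 6) \<le> 1512"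
    using h_bound_uniform[OF assms] by (simp add: m_def)
  show "(hermite_fun n r)\<^sup>2 * sqrt (2 * real n + 1 - r\<^sup>2) \<le> 1512" if "r\<^sup>2 < 2 * real n + 1"
    using h_bound_allowed[OF assms] that by (simp add: Q_def)
  show "(hermite_fun n r)\<^sup>2 * (r\<^sup>2 - (2 * real n + 1))\<^sup>2 \<le> 1512 * sqrt (2 * real n + 1)"
    if "(2 * real n + 1) powr (1 / 3) \<le> r\<^sup>2 - (2 * real n + 1)"
    using h_bound_forbidden[OF assms] that by (simp add: m2)
qed

text \<open>The series \<open>S(x)\<close> of the overview. As a formal power series it raises no
  question of convergence, and the nonzero factor \<open>hermite_sq 0\<close> can be
  cancelled.\<close>

definition hermite_sq :: "real \<Rightarrow> real fps" where
  "hermite_sq x = Abs_fps (\<lambda>n. (hermite_fun n x)\<^sup>2)"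

text \<open>In polar coordinates the angular derivative of each coefficient telescopes.\<close>

lemma hermite_sq_mult_polar:
  "hermite_sq (r * cos t) * hermite_sq (r * sin t) = hermite_sq r * hermite_sq 0"
proof (rule fps_ext)
  fix k
  define e where "e t = (\<Sum>i\<le>k. (hermite_fun i (r * cos t))\<^sup>2 * (hermite_fun (k - i) (r * sin t))\<^sup>2)" for t
  have "(e has_real_derivative 0) (at t)" for t
  proof -
    define X Y where "X = r * cos t" and "Y = r * sin t"
    define D where "D n x = sqrt (2 * real n) * hermite_fun (n - 1) x - x * hermite_fun n x" for n x
    define s where "s n = sqrt (2 * real n)" for n
    \<comment> \<open>By the recurrence, the angular derivative of a summand is a difference of two
      terms, each shifting one unit of index between the two factors: \<open>d i\<close> shifts it
      from \<open>k - i\<close> to \<open>i\<close>, and \<open>d' i\<close> is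
      \<open>d (i - 1)\<close>. The last term \<open>d k\<close> vanishes because
      \<open>s 0 = 0\<close>.\<close>
    define d where "d i = s (k - i) * s (Suc i) * hermite_fun (k - i - 1) Y * hermite_fun (Suc i) X
       * hermite_fun i X * hermite_fun (k - i) Y" for i
    define d' where "d' i = (if i = 0 then 0 else d (i - 1))" for i
    have dX: "((\<lambda>t. hermite_fun n (r * cos t)) has_real_derivative D n X * (- Y)) (at t)" for n
      unfolding D_def X_def Y_def
      by (rule DERIV_chain2[OF hermite_fun_deriv]) (auto intro!: derivative_eq_intros)
    have dY: "((\<lambda>t. hermite_fun n (r * sin t)) has_real_derivative D n Y * X) (at t)" for n
      unfolding D_def X_def Y_def
      by (rule DERIV_chain2[OF hermite_fun_deriv]) (auto intro!: derivative_eq_intros)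
    have rec: "2 * x * hermite_fun n x = s n * hermite_fun (n - 1) x + s (Suc n) * hermite_fun (Suc n) x" for n x
      using hermite_fun_rec[of x n] by (simp add: s_def add.commute)
    have "(e has_real_derivative (\<Sum>i\<le>k.
        (2 * hermite_fun i X * (D i X * (- Y))) * (hermite_fun (k - i) Y)\<^sup>2
      + (2 * hermite_fun (k - i) Y * (D (k - i) Y * X)) * (hermite_fun i X)\<^sup>2)) (at t)"
      unfolding e_def X_def[symmetric]
    proof (intro DERIV_sum)
      fix i
      show "((\<lambda>t. (hermite_fun i (r * cos t))\<^sup>2 * (hermite_fun (k - i) (r * sin t))\<^sup>2) has_real_derivative
         (2 * hermite_fun i X * (D i X * (- Y))) * (hermite_fun (k - i) Y)\<^sup>2
      + (2 * hermite_fun (k - i) Y * (D (k - i) Y * X)) * (hermite_fun i X)\<^sup>2) (at t)"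
        by (rule DERIV_cong[OF DERIV_mult[OF DERIV_power[OF dX] DERIV_power[OF dY]]])
          (simp add: X_def Y_def)
    qed
    moreover have "(2 * hermite_fun i X * (D i X * (- Y))) * (hermite_fun (k - i) Y)\<^sup>2
      + (2 * hermite_fun (k - i) Y * (D (k - i) Y * X)) * (hermite_fun i X)\<^sup>2 = d i - d' i" if "i \<le> k" for i
    proof -
      define j where "j = k - i"
      have "(2 * hermite_fun i X * (D i X * (- Y))) * (hermite_fun j Y)\<^sup>2
        + (2 * hermite_fun j Y * (D j Y * X)) * (hermite_fun i X)\<^sup>2
        = hermite_fun i X * hermite_fun j Y *
          (s j * hermite_fun (j - 1) Y * (2 * X * hermite_fun i X)
           - s i * hermite_fun (i - 1) X * (2 * Y * hermite_fun j Y))"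
        unfolding D_def s_def by (simp add: algebra_simps power2_eq_square)
      also have "\<dots> = hermite_fun i X * hermite_fun j Y *
          (s j * s (Suc i) * hermite_fun (j - 1) Y * hermite_fun (Suc i) X
           - s i * s (Suc j) * hermite_fun (i - 1) X * hermite_fun (Suc j) Y)"
        unfolding rec by (simp add: algebra_simps)
      also have "\<dots> = d i - d' i"
      proof (cases i)
        case 0
        moreover have "s 0 = 0" by (simp add: s_def)
        ultimately show ?thesis by (simp add: d_def d'_def j_def)
      next
        case (Suc i')
        then have "k - i' = Suc j" using that by (simp add: j_def)
        then have "d' i = s (Suc j) * s i * hermite_fun j Y * hermite_fun i X
            * hermite_fun (i - 1) X * hermite_fun (Suc j) Y"
          using Suc by (simp add: d_def d'_def)
        moreover have "d i = s j * s (Suc i) * hermite_fun (j - 1) Y * hermite_fun (Suc i) X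
            * hermite_fun i X * hermite_fun j Y"
          by (simp add: d_def j_def)
        ultimately show ?thesis by (simp only:) (simp add: algebra_simps)
      qed
      finally show ?thesis by (simp add: j_def)
    qed
    moreover have "(\<Sum>i\<le>k. d i - d' i) = 0"
    proof -
      have "(\<Sum>i\<le>n. d i - d' i) = d n" for n
        by (induction n) (simp_all add: d'_def)
      moreover have "d k = 0" by (simp add: d_def s_def)
      ultimately show ?thesis by simp
    qed
    ultimately show ?thesis by (auto intro: DERIV_cong)
  qed
  then have "e t = e 0" by (intro DERIV_isconst_all) auto
  then show "fps_nth (hermite_sq (r * cos t) * hermite_sq (r * sin t)) k =
     fps_nth (hermite_sq r * hermite_sq 0) k"
    by (simp add: fps_mult_nth hermite_sq_def e_def atLeast0AtMost)
qed

lemma hermite_sq_mult: "hermite_sq x * hermite_sq y = hermite_sq (sqrt (x\<^sup>2 + y\<^sup>2)) * hermite_sq 0"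
proof -
  define R where "R = sqrt (x\<^sup>2 + y\<^sup>2)"
  show ?thesis
  proof (cases "R = 0")
    case False
    have "(x / R)\<^sup>2 + (y / R)\<^sup>2 = 1"
      using False by (simp add: R_def power_divide flip: add_divide_distrib) 
    then obtain t where "x / R = cos t" "y / R = sin t" using sincos_total_2pi_le by metis
    then have "x = R * cos t" "y = R * sin t" using False by (auto simp: field_simps)
    then have "hermite_sq x * hermite_sq y = hermite_sq R * hermite_sq 0"
      using hermite_sq_mult_polar[of R t] by simp
    then show ?thesis unfolding R_def .
  next
    case True
    then have "x = 0" "y = 0" by (simp_all add: R_def sum_power2_eq_zero_iff)
    moreover have "sqrt (x\<^sup>2 + y\<^sup>2) = 0" using True unfolding R_def .
    ultimately show ?thesis by (simp only:)
  qed
qed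

lemma hermite_sq_0_nonzero: "hermite_sq 0 \<noteq> 0"
proof
  assume "hermite_sq 0 = 0"
  then have "fps_nth (hermite_sq 0) 0 = 0" by simp
  then show False by (simp add: hermite_sq_def)
qed

text \<open>Evenness comes from the product rule with \<open>y = 0\<close>, after cancelling
  \<open>hermite_sq 0\<close>.\<close>

lemma hermite_sq_abs: "hermite_sq \<bar>x\<bar> = hermite_sq x"
proof -
  have "hermite_sq \<bar>x\<bar> * hermite_sq 0 = hermite_sq x * hermite_sq 0"
    by (subst hermite_sq_mult[of x 0]) simp
  then show ?thesis using hermite_sq_0_nonzero mult_right_cancel by blast
qed

lemma prod_hermite_sq:
  assumes "finite B" "B \<noteq> {}"
  shows "(\<Prod>b\<in>B. hermite_sq (f b)) = hermite_sq (sqrt (\<Sum>b\<in>B. (f b)\<^sup>2)) * hermite_sq 0 ^ (card B - 1)"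
  using assms
proof (induction rule: finite_ne_induct)
  case (singleton b)
  then show ?case by (simp add: hermite_sq_abs)
next
  case (insert b B)
  have c: "card (insert b B) - 1 = Suc (card B - 1)"
    using insert by (simp add: card_gt_0_iff)
  have "(\<Prod>b\<in>insert b B. hermite_sq (f b)) =
     hermite_sq (f b) * hermite_sq (sqrt (\<Sum>b\<in>B. (f b)\<^sup>2)) * hermite_sq 0 ^ (card B - 1)"
    using insert by (simp add: mult.assoc)
  also have "hermite_sq (f b) * hermite_sq (sqrt (\<Sum>b\<in>B. (f b)\<^sup>2)) =
     hermite_sq (sqrt (\<Sum>b\<in>insert b B. (f b)\<^sup>2)) * hermite_sq 0"
    using insert by (subst hermite_sq_mult) (simp add: sum_nonneg)
  finally show ?case unfolding c by (simp add: mult.assoc)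
qed

text \<open>Here \<open>d\<close> counts the factors \<open>S(0)\<close>, so the space dimension is
  \<open>d + 1\<close> and the exponent is \<open>gamma_exp (d + 1)\<close>. The WKB bounds enter
  only in the base case, through \<open>sum_convolution\<close>; a further factor has coefficients
  at most \<open>(n+1)^(-1/2)\<close>, whose sum adds \<open>1/2\<close> to the exponent.\<close>

lemma hermite_sq_power_bound:
  assumes "d \<ge> 1"
  shows "\<exists>C\<ge>0. \<forall>k. \<forall>r\<ge>0. fps_nth (hermite_sq r * hermite_sq 0 ^ d) k \<le> C * (real k + 1) powr ((real d - 1) / 2)"
  using assms
proof (induction d rule: dec_induct)
  case base
  show ?case
  proof (intro exI[of _ "13 * 1512"] conjI allI impI)
    fix k and r :: real assume "0 \<le> r"
    interpret wkb_bounds "\<lambda>n. (hermite_fun n r)\<^sup>2" "r\<^sup>2" 1512 using \<open>0 \<le> r\<close> by (rule hermite_fun_wkb_bounds)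
    have "fps_nth (hermite_sq r * hermite_sq 0 ^ 1) k = (\<Sum>n\<le>k. (hermite_fun n r)\<^sup>2 * (hermite_fun (k - n) 0)\<^sup>2)"
      by (simp add: fps_mult_nth hermite_sq_def atLeast0AtMost)
    also have "\<dots> \<le> (\<Sum>n\<le>k. (hermite_fun n r)\<^sup>2 * (1 / sqrt (real (k - n) + 1)))"
      by (intro sum_mono mult_left_mono hermite_fun_0_sq) auto
    also have "\<dots> \<le> 13 * 1512" using sum_convolution[of k] by simp
    finally show "fps_nth (hermite_sq r * hermite_sq 0 ^ 1) k \<le> 13 * 1512 * (real k + 1) powr ((real 1 - 1) / 2)"
      by simp
  qed simp
next
  case (step d)
  then obtain C where C: "C \<ge> 0"
    "\<And>k r. r \<ge> 0 \<Longrightarrow> fps_nth (hermite_sq r * hermite_sq 0 ^ d) k \<le> C * (real k + 1) powr ((real d - 1) / 2)"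
    by blast
  show ?case
  proof (intro exI[of _ "2 * C"] conjI allI impI)
    fix k and r :: real assume r: "0 \<le> r"
    have "fps_nth (hermite_sq r * hermite_sq 0 ^ Suc d) k = fps_nth ((hermite_sq r * hermite_sq 0 ^ d) * hermite_sq 0) k"
      by (simp add: mult_ac)
    also have "\<dots> = (\<Sum>n\<le>k. fps_nth (hermite_sq r * hermite_sq 0 ^ d) n * (hermite_fun (k - n) 0)\<^sup>2)"
      by (simp only: fps_mult_nth[of _ "hermite_sq 0"]) (simp add: hermite_sq_def atLeast0AtMost)
    also have "\<dots> \<le> (\<Sum>n\<le>k. C * (real k + 1) powr ((real d - 1) / 2) * (1 / sqrt (real (k - n) + 1)))"
    proof (intro sum_mono mult_mono)
      fix n assume n: "n \<in> {..k}"
      have "fps_nth (hermite_sq r * hermite_sq 0 ^ d) n \<le> C * (real n + 1) powr ((real d - 1) / 2)"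
        using C r by blast
      also have "\<dots> \<le> C * (real k + 1) powr ((real d - 1) / 2)"
        using n step.hyps(1) C(1) by (intro mult_left_mono powr_mono2) auto
      finally show "fps_nth (hermite_sq r * hermite_sq 0 ^ d) n \<le> C * (real k + 1) powr ((real d - 1) / 2)" .
      show "(hermite_fun (k - n) 0)\<^sup>2 \<le> 1 / sqrt (real (k - n) + 1)"
        by (rule hermite_fun_0_sq)
    qed (use C(1) in auto)
    also have "\<dots> = C * (real k + 1) powr ((real d - 1) / 2) * (\<Sum>n\<le>k. 1 / sqrt (real n + 1))"
      unfolding sum_distrib_left[symmetric]
      by (rule arg_cong[where f = "(*) _"], rule sum.reindex_bij_witness[of _ "\<lambda>i. k - i" "\<lambda>i. k - i"]) auto
    also have "\<dots> \<le> C * (real k + 1) powr ((real d - 1) / 2) * (2 * sqrt (real k + 1))"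
      using sum_inverse_sqrt_le[of "Suc k"] C(1)
      by (intro mult_left_mono) (auto simp: lessThan_Suc_atMost add.commute)
    also have "\<dots> = 2 * C * ((real k + 1) powr ((real d - 1) / 2) * (real k + 1) powr (1 / 2))"
      by (simp add: powr_half_sqrt)
    also have "\<dots> = 2 * C * (real k + 1) powr ((real (Suc d) - 1) / 2)"
      by (simp add: diff_divide_distrib flip: powr_add)
    finally show "fps_nth (hermite_sq r * hermite_sq 0 ^ Suc d) k \<le> 2 * C * (real k + 1) powr ((real (Suc d) - 1) / 2)" .
  qed (use C(1) in simp)
qed

lemma hermite_sq_uniform:
  "fps_nth (hermite_sq x) k \<le> 1512 * (real k + 1) powr (- 1 / 6)"
proof -
  interpret wkb_bounds "\<lambda>n. (hermite_fun n \<bar>x\<bar>)\<^sup>2" "\<bar>x\<bar>\<^sup>2" 1512 by (rule hermite_fun_wkb_bounds) simp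
  have "(hermite_fun k \<bar>x\<bar>)\<^sup>2 * (real k + 1) powr (1/6) \<le> (hermite_fun k \<bar>x\<bar>)\<^sup>2 * (2 * real k + 1) powr (1/6)"
    by (intro mult_left_mono powr_mono2) auto
  also have "\<dots> \<le> 1512" by (rule uniform)
  finally have "(hermite_fun k \<bar>x\<bar>)\<^sup>2 \<le> 1512 * (real k + 1) powr (- 1 / 6)"
    by (simp add: powr_minus_divide field_simps)
  then have "fps_nth (hermite_sq \<bar>x\<bar>) k \<le> 1512 * (real k + 1) powr (- 1 / 6)"
    by (simp add: hermite_sq_def)
  then show ?thesis by (simp only: hermite_sq_abs)
qed

section \<open>Orthogonality and completeness of the Hermite functions\<close>

lemma integral_derivative_eq_0:
  fixes F f :: "real \<Rightarrow> real"
  assumes D: "\<And>x. (F has_real_derivative f x) (at x)"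
    and cont: "\<And>x. isCont f x" and int: "integrable lborel f"
    and lim: "(F \<longlongrightarrow> 0) at_infinity"
  shows "(LINT x|lborel. f x) = 0"
proof -
  have top: "((F \<circ> real_of_ereal) \<longlongrightarrow> 0) (at_left \<infinity>)"
    unfolding tendsto_compose_filtermap at_left_PInf filtermap_filtermap
    using lim by (auto simp: filtermap_ident tendsto_mono[OF at_top_le_at_infinity])
  have bot: "((F \<circ> real_of_ereal) \<longlongrightarrow> 0) (at_right (- \<infinity>))"
    unfolding tendsto_compose_filtermap at_right_MInf filtermap_filtermap
    using lim by (auto simp: filtermap_ident tendsto_mono[OF at_bot_le_at_infinity])
  have "(LBINT x=-\<infinity>..\<infinity>. f x) = 0 - 0"
    by (rule interval_integral_FTC_integrable[OF _ _ _ _ bot top])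
      (use D cont int in \<open>auto simp: has_real_derivative_iff_has_vector_derivative set_integrable_def\<close>)
  then show ?thesis by (simp add: interval_lebesgue_integral_def set_lebesgue_integral_def)
qed

lemma integrable_inverse_1_plus_square_UNIV: "integrable lborel (\<lambda>x::real. inverse (1 + x\<^sup>2))"
  using integrable_inverse_1_plus_square by (simp add: set_integrable_def)

lemma hermite_fun_isCont: "isCont (hermite_fun n) x"
  using hermite_fun_deriv DERIV_isCont by blast

lemma hermite_fun_continuous_on [continuous_intros]:
  "continuous_on A f \<Longrightarrow> continuous_on A (\<lambda>x. hermite_fun n (f x))"
  by (rule continuous_on_compose2[of UNIV "hermite_fun n"])
    (auto simp: continuous_on_eq_continuous_at hermite_fun_isCont)

lemma hermite_fun_measurable [measurable]: "hermite_fun n \<in> borel_measurable borel"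
  using hermite_fun_continuous_on[of UNIV "\<lambda>x. x"] by (intro borel_measurable_continuous_onI) auto

lemma integrable_hermite_fun_mult: "integrable lborel (\<lambda>x. hermite_fun m x * hermite_fun n x)"
proof -
  obtain A where A: "\<And>x. \<bar>x\<bar> ^ 0 * \<bar>hermite_fun m x\<bar> \<le> A" using hermite_fun_decay by blast
  obtain B where B: "\<And>x. \<bar>x\<bar> ^ 0 * \<bar>hermite_fun n x\<bar> \<le> B" using hermite_fun_decay by blast
  obtain C where C: "\<And>x. \<bar>x\<bar> ^ 2 * \<bar>hermite_fun n x\<bar> \<le> C" using hermite_fun_decay by blast
  show ?thesis
  proof (rule Bochner_Integration.integrable_bound)
    show "integrable lborel (\<lambda>x::real. A * (B + C) * inverse (1 + x\<^sup>2))"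
      by (intro integrable_mult_right integrable_inverse_1_plus_square_UNIV)
    show "AE x in lborel. norm (hermite_fun m x * hermite_fun n x) \<le> norm (A * (B + C) * inverse (1 + x\<^sup>2))"
    proof (rule AE_I2)
      fix x :: real
      have p: "0 < 1 + x\<^sup>2" by (simp add: add_pos_nonneg)
      have "\<bar>hermite_fun n x\<bar> * (1 + x\<^sup>2) \<le> B + C" using B[of x] C[of x] by (simp add: algebra_simps)
      then have "\<bar>hermite_fun n x\<bar> \<le> (B + C) * inverse (1 + x\<^sup>2)" using p by (simp add: field_simps)
      then have "\<bar>hermite_fun m x\<bar> * \<bar>hermite_fun n x\<bar> \<le> A * ((B + C) * inverse (1 + x\<^sup>2))"
        using A[of x] by (intro mult_mono) (auto intro: order_trans[OF abs_ge_zero])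
      then show "norm (hermite_fun m x * hermite_fun n x) \<le> norm (A * (B + C) * inverse (1 + x\<^sup>2))"
        unfolding real_norm_def abs_mult[symmetric] mult.assoc by (rule order_trans[OF _ abs_ge_self])
    qed
  qed simp
qed

definition hermite_inner :: "nat \<Rightarrow> nat \<Rightarrow> real" where
  "hermite_inner m n = (LINT x|lborel. hermite_fun m x * hermite_fun n x)"

text \<open>The two ladder operators are adjoint: integrate \<open>(h_m h_n)'\<close>, using the
  raising form for \<open>h_m\<close> and the lowering form for \<open>h_n\<close>, so that the
  terms with \<open>x\<close> cancel.\<close>

lemma hermite_inner_shift:
  "sqrt (2 * (real m + 1)) * hermite_inner (Suc m) n = sqrt (2 * real n) * hermite_inner m (n - 1)"
proof -
  let ?f = "\<lambda>x. sqrt (2 * real n) * (hermite_fun m x * hermite_fun (n - 1) x)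
       - sqrt (2 * (real m + 1)) * (hermite_fun (Suc m) x * hermite_fun n x)"
  have "(LINT x|lborel. ?f x) = 0"
  proof (rule integral_derivative_eq_0[where F = "\<lambda>x. hermite_fun m x * hermite_fun n x"])
    fix x
    have r: "sqrt (2 * real m) * hermite_fun (m - 1) x =
        2 * x * hermite_fun m x - sqrt (2 * (real m + 1)) * hermite_fun (Suc m) x"
      using hermite_fun_rec[of x m] by simp
    show "((\<lambda>x. hermite_fun m x * hermite_fun n x) has_real_derivative ?f x) (at x)"
      by (rule DERIV_cong[OF DERIV_mult[OF hermite_fun_deriv hermite_fun_deriv]])
        (simp only: r, simp add: algebra_simps)
    show "isCont ?f x" by (intro continuous_intros hermite_fun_isCont)
    show "integrable lborel ?f"
      by (intro Bochner_Integration.integrable_diff integrable_mult_right integrable_hermite_fun_mult)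
    show "((\<lambda>x. hermite_fun m x * hermite_fun n x) \<longlongrightarrow> 0) at_infinity"
      using tendsto_mult[OF hermite_fun_tendsto_0 hermite_fun_tendsto_0] by simp
  qed
  also have "(LINT x|lborel. ?f x) = sqrt (2 * real n) * hermite_inner m (n - 1)
       - sqrt (2 * (real m + 1)) * hermite_inner (Suc m) n"
    unfolding hermite_inner_def
    by (subst Bochner_Integration.integral_diff) (auto intro!: integrable_mult_right integrable_hermite_fun_mult)
  finally show ?thesis by simp
qed

lemma hermite_inner_commute: "hermite_inner m n = hermite_inner n m"
  unfolding hermite_inner_def by (simp add: mult.commute)

lemma hermite_inner_0_0: "hermite_inner 0 0 = 1"
proof -
  have "hermite_fun 0 x * hermite_fun 0 x = normal_density 0 (1 / sqrt 2) x" for x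
    by (simp add: normal_density_def power_divide power2_eq_square flip: exp_add)
  then show ?thesis unfolding hermite_inner_def by simp
qed

lemma hermite_fun_orthonormal: "hermite_inner m n = (if m = n then 1 else 0)"
proof (induction m arbitrary: n)
  case 0
  show ?case
  proof (cases n)
    case 0
    then show ?thesis by (simp add: hermite_inner_0_0)
  next
    case (Suc k)
    then show ?thesis using hermite_inner_shift[of k 0] hermite_inner_commute[of 0 n] by simp
  qed
next
  case (Suc m)
  have "sqrt (2 * (real m + 1)) * hermite_inner (Suc m) n = sqrt (2 * real n) * (if m = n - 1 then 1 else 0)"
    unfolding hermite_inner_shift Suc ..
  then show ?case by (cases n) (auto simp: add.commute split: if_splits)
qed

section \<open>Products of Hermite functions in several variables\<close>

lemma
  fixes f :: "'a::euclidean_space \<Rightarrow> real \<Rightarrow> real"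
  assumes f: "\<And>b. b \<in> Basis \<Longrightarrow> integrable lborel (f b)"
  shows integrable_lborel_prod: "integrable lborel (\<lambda>y::'a. \<Prod>b\<in>Basis. f b (y \<bullet> b))"
    and integral_lborel_prod: "(LINT y|lborel. (\<Prod>b\<in>Basis. f b (y \<bullet> b))) = (\<Prod>b\<in>Basis. (LINT x|lborel. f b x))"
proof -
  interpret product_sigma_finite "\<lambda>_::'a. lborel :: real measure" by standard
  let ?T = "\<lambda>g::'a \<Rightarrow> real. \<Sum>b\<in>Basis. g b *\<^sub>R b"
  have T: "?T \<in> (\<Pi>\<^sub>M b\<in>Basis. lborel) \<rightarrow>\<^sub>M borel" by measurable
  have meas: "(\<lambda>y::'a. \<Prod>b\<in>Basis. f b (y \<bullet> b)) \<in> borel_measurable borel"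
  proof (rule borel_measurable_prod)
    fix b :: 'a assume "b \<in> Basis"
    then have [measurable]: "f b \<in> borel_measurable borel" using f by (simp add: borel_measurable_integrable)
    show "(\<lambda>y. f b (y \<bullet> b)) \<in> borel_measurable borel" by measurable
  qed
  have e: "(\<Prod>b\<in>Basis. f b (?T g \<bullet> b)) = (\<Prod>b\<in>Basis. f b (g b))" for g
    by (intro prod.cong) auto
  show "integrable lborel (\<lambda>y::'a. \<Prod>b\<in>Basis. f b (y \<bullet> b))"
    by (subst lborel_eq, subst integrable_distr_eq[OF T meas])
      (simp only: e product_integrable_prod[OF finite_Basis f])
  show "(LINT y|lborel. (\<Prod>b\<in>Basis. f b (y \<bullet> b))) = (\<Prod>b\<in>Basis. (LINT x|lborel. f b x))"
    by (subst lborel_eq, subst integral_distr[OF T meas])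
      (simp only: e product_integral_prod[OF finite_Basis f])
qed

definition hermite_nd :: "('a::euclidean_space \<Rightarrow> nat) \<Rightarrow> 'a \<Rightarrow> real" where
  "hermite_nd \<alpha> y = (\<Prod>b\<in>Basis. hermite_fun (\<alpha> b) (y \<bullet> b))"

lemma hermite_nd_measurable [measurable]: "hermite_nd \<alpha> \<in> borel_measurable borel"
  unfolding hermite_nd_def[abs_def] by measurable

lemma integrable_hermite_nd_mult: "integrable lborel (\<lambda>y. hermite_nd \<alpha> y * hermite_nd \<beta> y)"
  unfolding hermite_nd_def prod.distrib[symmetric]
  by (rule integrable_lborel_prod[of "\<lambda>b x. hermite_fun (\<alpha> b) x * hermite_fun (\<beta> b) x"])
    (rule integrable_hermite_fun_mult)

text \<open>\<open>hermite_nd\<close> depends on a multi-index only through its values on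
  \<open>Basis\<close>, hence the pointwise condition in place of an equality of functions.\<close>

lemma hermite_nd_orthonormal:
  "(LINT y|lborel. hermite_nd \<alpha> y * hermite_nd \<beta> y) = (if \<forall>b\<in>Basis. \<alpha> b = \<beta> b then 1 else 0)"
proof -
  have "(LINT y|lborel. hermite_nd \<alpha> y * hermite_nd \<beta> y) = (\<Prod>b\<in>Basis. hermite_inner (\<alpha> b) (\<beta> b))"
    unfolding hermite_nd_def prod.distrib[symmetric] hermite_inner_def
    by (rule integral_lborel_prod[of "\<lambda>b x. hermite_fun (\<alpha> b) x * hermite_fun (\<beta> b) x"])
      (rule integrable_hermite_fun_mult)
  then show ?thesis by (auto simp: hermite_fun_orthonormal prod_eq_1_iff)
qed

section \<open>Polynomials times the Gaussian as Schwartz functions\<close>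

definition gaussian :: "'a::euclidean_space \<Rightarrow> real" where
  "gaussian y = exp (- (norm y)\<^sup>2 / 2)"

text \<open>Polynomials times the Gaussian, generated by operations rather than given in a normal
  form, so that differentiability, decay and stability under derivatives are all plain inductions.
  Any linear functional is allowed as a factor, not only coordinates.\<close>

inductive_set gauss_poly :: "('a::euclidean_space \<Rightarrow> complex) set" where
  gaussian: "(\<lambda>y. of_real (gaussian y)) \<in> gauss_poly"
| add: "f \<in> gauss_poly \<Longrightarrow> g \<in> gauss_poly \<Longrightarrow> (\<lambda>y. f y + g y) \<in> gauss_poly"
| scale: "f \<in> gauss_poly \<Longrightarrow> (\<lambda>y. c * f y) \<in> gauss_poly"
| linear: "f \<in> gauss_poly \<Longrightarrow> (\<lambda>y. of_real (y \<bullet> b) * f y) \<in> gauss_poly"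

lemma gaussian_has_derivative:
  "(gaussian has_derivative (\<lambda>v. - (y \<bullet> v) * gaussian y)) (at y)"
proof -
  have "((\<lambda>y. exp (- (y \<bullet> y) / 2)) has_derivative (\<lambda>v. - (y \<bullet> v) * exp (- (y \<bullet> y) / 2))) (at y)"
    by (auto intro!: derivative_eq_intros simp: inner_commute)
  then show ?thesis unfolding gaussian_def[abs_def] by (simp add: power2_norm_eq_inner)
qed

text \<open>The derivative in each fixed direction stays in the class. This makes iterated partial
  derivatives accessible, which is what membership in \<open>schwartz\<close> asks for.\<close>

lemma gauss_poly_has_derivative:
  assumes "f \<in> gauss_poly"
  shows "\<exists>f'. (\<forall>y. (f has_derivative (\<lambda>v. f' v y)) (at y)) \<and> (\<forall>v. f' v \<in> gauss_poly)"
  using assms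
proof induction
  case gaussian
  have "((\<lambda>y::'a. complex_of_real (gaussian y)) has_derivative
     (\<lambda>v. - 1 * (of_real (y \<bullet> v) * of_real (gaussian y)))) (at y)" for y
    using has_derivative_of_real[OF gaussian_has_derivative[of y], where 'a = complex] by simp
  then show ?case
    by (intro exI[of _ "\<lambda>v y. - 1 * (of_real (y \<bullet> v) * of_real (gaussian y))"] conjI allI gauss_poly.intros)
next
  case (add f g)
  then obtain f' g' where "\<And>y. (f has_derivative (\<lambda>v. f' v y)) (at y)" "\<And>v. f' v \<in> gauss_poly"
    "\<And>y. (g has_derivative (\<lambda>v. g' v y)) (at y)" "\<And>v. g' v \<in> gauss_poly" by blast
  then show ?case
    by (intro exI[of _ "\<lambda>v y. f' v y + g' v y"] conjI allI gauss_poly.intros has_derivative_add) auto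
next
  case (scale f c)
  then obtain f' where "\<And>y. (f has_derivative (\<lambda>v. f' v y)) (at y)" "\<And>v. f' v \<in> gauss_poly" by blast
  then show ?case
    by (intro exI[of _ "\<lambda>v y. c * f' v y"] conjI allI gauss_poly.intros has_derivative_mult_right) auto
next
  case (linear f b)
  then obtain f' where f': "\<And>y. (f has_derivative (\<lambda>v. f' v y)) (at y)" "\<And>v. f' v \<in> gauss_poly" by blast
  have d: "((\<lambda>y. of_real (y \<bullet> b)) has_derivative (\<lambda>v. complex_of_real (v \<bullet> b))) (at y)" for y :: 'a
    by (auto intro!: derivative_eq_intros)
  have "((\<lambda>y. of_real (y \<bullet> b) * f y) has_derivative
     (\<lambda>v. of_real (y \<bullet> b) * f' v y + of_real (v \<bullet> b) * f y)) (at y)" for y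
    by (rule has_derivative_mult[OF d f'(1)])
  then show ?case
    using f'(2) linear.hyps
    by (intro exI[of _ "\<lambda>v y. of_real (y \<bullet> b) * f' v y + of_real (v \<bullet> b) * f y"] conjI allI gauss_poly.intros) auto
qed

lemma gauss_poly_differentiable: "f \<in> gauss_poly \<Longrightarrow> f differentiable (at y)"
  using gauss_poly_has_derivative differentiable_def by blast

lemma gauss_poly_partial_deriv: "f \<in> gauss_poly \<Longrightarrow> partial_deriv b f \<in> gauss_poly"
proof -
  assume "f \<in> gauss_poly"
  then obtain f' where f': "\<And>y. (f has_derivative (\<lambda>v. f' v y)) (at y)" "\<And>v. f' v \<in> gauss_poly"
    using gauss_poly_has_derivative by blast
  have "partial_deriv b f y = f' b y" for y
    unfolding partial_deriv_def using frechet_derivative_at[OF f'(1), of y, symmetric] by simp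
  then have "partial_deriv b f = f' b" by blast
  then show ?thesis using f'(2) by simp
qed

lemma norm_le_exp_norm_sq:
  assumes "d > 0"
  shows "norm y \<le> (1 + 1 / d) * exp (d * (norm y)\<^sup>2)"
proof -
  have "norm y \<le> 1 + (norm y)\<^sup>2"
    using sum_squares_bound[of "norm y" 1] norm_ge_zero[of y] unfolding power_one mult_1_right by linarith
  also have "\<dots> \<le> (1 + 1 / d) * (1 + d * (norm y)\<^sup>2)"
    using assms by (simp add: algebra_simps)
  also have "\<dots> \<le> (1 + 1 / d) * exp (d * (norm y)\<^sup>2)"
    using assms by (intro mult_left_mono exp_ge_add_one_self) auto
  finally show ?thesis .
qed

text \<open>The rate \<open>s\<close> ranges over everything below \<open>1/2\<close> because a
  linear factor costs some of it: half of the gap \<open>1/2 - s\<close> absorbs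
  \<open>norm y\<close>.\<close>

lemma gauss_poly_bound:
  assumes "f \<in> gauss_poly" "s < 1 / 2"
  shows "\<exists>C\<ge>0. \<forall>y. norm (f y) \<le> C * exp (- s * (norm y)\<^sup>2)"
  using assms
proof (induction arbitrary: s)
  case gaussian
  have "norm (complex_of_real (gaussian y)) \<le> 1 * exp (- s * (norm y)\<^sup>2)" for y :: 'a
    using gaussian mult_right_mono[of s "1/2" "(norm y)\<^sup>2"] by (simp add: gaussian_def)
  then show ?case by (intro exI[of _ 1]) auto
next
  case (add f g)
  then obtain C D where "C \<ge> 0" "\<And>y. norm (f y) \<le> C * exp (- s * (norm y)\<^sup>2)"
    "D \<ge> 0" "\<And>y. norm (g y) \<le> D * exp (- s * (norm y)\<^sup>2)" by meson
  then show ?case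
    by (intro exI[of _ "C + D"]) (auto simp: distrib_right intro!: norm_triangle_mono)
next
  case (scale f c)
  then obtain C where "C \<ge> 0" "\<And>y. norm (f y) \<le> C * exp (- s * (norm y)\<^sup>2)" by meson
  then show ?case
    by (intro exI[of _ "norm c * C"]) (auto simp: norm_mult mult.assoc intro!: mult_left_mono)
next
  case (linear f b)
  define d where "d = (1 / 2 - s) / 2"
  have d: "d > 0" "s + d < 1 / 2" using linear.prems by (auto simp: d_def field_simps)
  obtain C where C: "C \<ge> 0" "\<And>y. norm (f y) \<le> C * exp (- (s + d) * (norm y)\<^sup>2)"
    using linear.IH[OF d(2)] by blast
  have "norm (of_real (y \<bullet> b) * f y) \<le> norm b * (1 + 1 / d) * C * exp (- s * (norm y)\<^sup>2)" for y
  proof -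
    have "norm (of_real (y \<bullet> b) * f y) = \<bar>y \<bullet> b\<bar> * norm (f y)" by (simp add: norm_mult)
    also have "\<dots> \<le> (norm y * norm b) * (C * exp (- (s + d) * (norm y)\<^sup>2))"
      by (intro mult_mono Cauchy_Schwarz_ineq2 C) auto
    also have "\<dots> = norm y * (norm b * C * exp (- (s + d) * (norm y)\<^sup>2))" by simp
    also have "\<dots> \<le> ((1 + 1 / d) * exp (d * (norm y)\<^sup>2)) * (norm b * C * exp (- (s + d) * (norm y)\<^sup>2))"
      using C by (intro mult_right_mono norm_le_exp_norm_sq d) auto
    also have "\<dots> = norm b * (1 + 1 / d) * C * (exp (d * (norm y)\<^sup>2) * exp (- (s + d) * (norm y)\<^sup>2))"
      by simp
    also have "exp (d * (norm y)\<^sup>2) * exp (- (s + d) * (norm y)\<^sup>2) = exp (- s * (norm y)\<^sup>2)"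
      by (simp add: algebra_simps flip: exp_add)
    finally show ?thesis .
  qed
  moreover have "norm b * (1 + 1 / d) * C \<ge> 0" using C d by simp
  ultimately show ?case by blast
qed

lemma gauss_poly_subset_schwartz: "gauss_poly \<subseteq> schwartz"
proof
  fix f :: "'a \<Rightarrow> complex" assume f: "f \<in> gauss_poly"
  have g: "foldr partial_deriv bs f \<in> gauss_poly" for bs
    by (induction bs) (auto simp: f gauss_poly_partial_deriv)
  have "\<exists>C. \<forall>y. norm y ^ k * norm (g y) \<le> C" if g: "g \<in> gauss_poly" for k and g :: "'a \<Rightarrow> complex"
  proof -
    obtain C where C: "C \<ge> 0" "\<And>y. norm (g y) \<le> C * exp (- (1/4) * (norm y)\<^sup>2)"
      using gauss_poly_bound[OF g, of "1/4"] by auto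
    obtain D where D: "\<And>x::real. \<bar>x\<bar> ^ k * exp (- x\<^sup>2 / 2) \<le> D"
      using power_times_gaussian_bounded by blast
    have "norm y ^ k * norm (g y) \<le> C * sqrt 2 ^ k * D" for y
    proof -
      have "norm y ^ k * norm (g y) \<le> norm y ^ k * (C * exp (- (1/4) * (norm y)\<^sup>2))"
        by (intro mult_left_mono C) auto
      also have "\<dots> = C * sqrt 2 ^ k * (\<bar>norm y / sqrt 2\<bar> ^ k * exp (- (norm y / sqrt 2)\<^sup>2 / 2))"
        by (simp add: power_divide)
      also have "\<dots> \<le> C * sqrt 2 ^ k * D" by (intro mult_left_mono D) (use C in auto)
      finally show ?thesis .
    qed
    then show ?thesis by blast
  qed
  with g show "f \<in> schwartz" unfolding schwartz_def using gauss_poly_differentiable by blast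
qed

text \<open>The product \<open>hermite_fun n x * exp (x^2 / 2)\<close> is the normalised Hermite
  polynomial, so the claim is closure under multiplication by a polynomial in
  \<open>y \<bullet> b\<close>.\<close>

lemma gauss_poly_hermite_factor:
  assumes "f \<in> gauss_poly"
  shows "(\<lambda>y. of_real (hermite_fun n (y \<bullet> b) * exp ((y \<bullet> b)\<^sup>2 / 2)) * f y) \<in> gauss_poly"
proof (induction n rule: induct_nat_012)
  have h0: "hermite_fun 0 x * exp (x\<^sup>2 / 2) = 1 / sqrt (sqrt pi)" for x
    by (simp flip: exp_add)
  {
    case 0
    show ?case unfolding h0 by (rule gauss_poly.scale[OF assms])
  next
    case 1
    have "(\<lambda>y. complex_of_real (sqrt 2 / sqrt (sqrt pi)) * (of_real (y \<bullet> b) * f y)) \<in> gauss_poly"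
      by (intro gauss_poly.intros assms)
    moreover have eq: "hermite_fun (Suc 0) x * exp (x\<^sup>2 / 2) = sqrt 2 / sqrt (sqrt pi) * x" for x
    proof -
      have "hermite_fun (Suc 0) x * exp (x\<^sup>2 / 2) = sqrt 2 * x * (hermite_fun 0 x * exp (x\<^sup>2 / 2))"
        by (simp only: hermite_fun.simps(2) mult.assoc)
      then show ?thesis unfolding h0 by simp
    qed
    ultimately show ?case by (simp only: eq of_real_mult mult.assoc)
  }
next
  case (ge2 n)
  have "(\<lambda>y. complex_of_real (sqrt (2 / (real n + 2))) *
       (of_real (y \<bullet> b) * (of_real (hermite_fun (Suc n) (y \<bullet> b) * exp ((y \<bullet> b)\<^sup>2 / 2)) * f y))
     + complex_of_real (- sqrt ((real n + 1) / (real n + 2))) *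
       (of_real (hermite_fun n (y \<bullet> b) * exp ((y \<bullet> b)\<^sup>2 / 2)) * f y)) \<in> gauss_poly"
    by (intro gauss_poly.intros ge2)
  then show ?case by (simp add: hermite_fun.simps(3) algebra_simps)
qed

lemma gaussian_eq_prod: "gaussian y = (\<Prod>b\<in>Basis. exp (- (y \<bullet> b)\<^sup>2 / 2))"
  unfolding gaussian_def power2_norm_eq_inner
  by (subst euclidean_inner) (simp add: exp_sum sum_negf sum_divide_distrib power2_eq_square flip: exp_sum)

lemma hermite_nd_in_gauss_poly: "(\<lambda>y. complex_of_real (hermite_nd \<alpha> y)) \<in> gauss_poly"
proof -
  have "finite S \<Longrightarrow> (\<lambda>y. complex_of_real ((\<Prod>b\<in>S. hermite_fun (\<alpha> b) (y \<bullet> b) * exp ((y \<bullet> b)\<^sup>2 / 2)) * gaussian y)) \<in> gauss_poly"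
    for S :: "'a set"
  proof (induction S rule: finite_induct)
    case empty
    then show ?case by (simp add: gauss_poly.gaussian)
  next
    case (insert b S)
    then show ?case using gauss_poly_hermite_factor[OF insert.IH, of "\<alpha> b" b] by (simp add: mult.assoc)
  qed
  from this[OF finite_Basis] show ?thesis
    by (simp add: gaussian_eq_prod hermite_nd_def mult.assoc flip: prod.distrib exp_add)
qed

text \<open>\<open>u\<close> carries the whole dependence on the coordinate \<open>b\<close> and
  \<open>R\<close> none of it; along the line \<open>x + t b\<close> the function is therefore
  \<open>u\<close> times a constant.\<close>

lemma partial_deriv_factor:
  fixes f :: "'a::euclidean_space \<Rightarrow> complex"
  assumes b: "b \<in> Basis" and f: "f differentiable (at x)"
    and fact: "\<And>y. f y = of_real (u (y \<bullet> b)) * R y"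
    and R: "\<And>y t. R (y + t *\<^sub>R b) = R y"
    and u: "(u has_real_derivative u') (at (x \<bullet> b))"
  shows "partial_deriv b f x = of_real u' * R x"
proof -
  have "(f has_derivative frechet_derivative f (at x)) (at (x + 0 *\<^sub>R b))"
    using f frechet_derivative_works by auto
  moreover have "((\<lambda>t. x + t *\<^sub>R b) has_derivative (\<lambda>t. t *\<^sub>R b)) (at 0)"
    by (auto intro!: derivative_eq_intros)
  ultimately have "((\<lambda>t. f (x + t *\<^sub>R b)) has_derivative (\<lambda>t. frechet_derivative f (at x) (t *\<^sub>R b))) (at 0)"
    by (rule has_derivative_compose[rotated])
  then have 1: "((\<lambda>t. f (x + t *\<^sub>R b)) has_vector_derivative frechet_derivative f (at x) b) (at 0)"
    unfolding has_vector_derivative_def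
    by (rule has_derivative_eq_rhs)
      (use f linear_frechet_derivative linear_scale in \<open>fastforce simp: fun_eq_iff\<close>)
  have "(u has_real_derivative u') (at (0 + x \<bullet> b))" using u by simp
  then have "((\<lambda>t. u (t + x \<bullet> b)) has_real_derivative u') (at 0)" by (rule DERIV_shift[THEN iffD1])
  then have "((\<lambda>t. complex_of_real (u (t + x \<bullet> b)) * R x) has_vector_derivative of_real u' * R x) (at 0)"
    by (intro has_vector_derivative_mult_left has_vector_derivative_of_real)
      (simp add: has_real_derivative_iff_has_vector_derivative)
  moreover have "f (x + t *\<^sub>R b) = complex_of_real (u (t + x \<bullet> b)) * R x" for t
    using b by (simp add: fact R inner_add_left add.commute)
  ultimately have "((\<lambda>t. f (x + t *\<^sub>R b)) has_vector_derivative of_real u' * R x) (at 0)" by simp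
  from vector_derivative_unique_at[OF 1 this] show ?thesis by (simp add: partial_deriv_def)
qed

lemma hermite_nd_partial_deriv2:
  fixes x :: "'a::euclidean_space"
  assumes b: "b \<in> Basis"
  shows "partial_deriv b (partial_deriv b (\<lambda>y. complex_of_real (hermite_nd \<alpha> y))) x =
    of_real (((x \<bullet> b)\<^sup>2 - (2 * real (\<alpha> b) + 1)) * hermite_nd \<alpha> x)"
proof -
  define R where "R y = complex_of_real (\<Prod>b'\<in>Basis - {b}. hermite_fun (\<alpha> b') (y \<bullet> b'))" for y :: 'a
  have R: "R (y + t *\<^sub>R b) = R y" for y t
    unfolding R_def
  proof (intro arg_cong[where f = of_real] prod.cong refl)
    fix b' assume "b' \<in> Basis - {b}"
    then have "b \<bullet> b' = 0" using b by (intro inner_not_same_Basis) auto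
    then show "hermite_fun (\<alpha> b') ((y + t *\<^sub>R b) \<bullet> b') = hermite_fun (\<alpha> b') (y \<bullet> b')"
      by (simp add: inner_add_left)
  qed
  let ?h = "\<lambda>y. complex_of_real (hermite_nd \<alpha> y)"
  have h: "?h y = of_real (hermite_fun (\<alpha> b) (y \<bullet> b)) * R y" for y
    unfolding hermite_nd_def R_def using b by (subst prod.remove[of _ b]) auto
  have p1: "partial_deriv b ?h y = of_real (sqrt (2 * real (\<alpha> b)) * hermite_fun (\<alpha> b - 1) (y \<bullet> b)
      - y \<bullet> b * hermite_fun (\<alpha> b) (y \<bullet> b)) * R y" for y
    by (rule partial_deriv_factor[OF b gauss_poly_differentiable[OF hermite_nd_in_gauss_poly] h R hermite_fun_deriv])
  have "partial_deriv b (partial_deriv b ?h) x =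
     of_real (((x \<bullet> b)\<^sup>2 - (2 * real (\<alpha> b) + 1)) * hermite_fun (\<alpha> b) (x \<bullet> b)) * R x"
    by (rule partial_deriv_factor[OF b
        gauss_poly_differentiable[OF gauss_poly_partial_deriv[OF hermite_nd_in_gauss_poly]] p1 R hermite_fun_deriv2])
  then show ?thesis using h[of x] by simp
qed

lemma hermite_nd_oscillator:
  fixes x :: "'a::euclidean_space"
  shows "- laplacian (\<lambda>y. complex_of_real (hermite_nd \<alpha> y)) x + of_real ((norm x)\<^sup>2) * of_real (hermite_nd \<alpha> x)
     = of_real (2 * real (\<Sum>b\<in>Basis. \<alpha> b) + real DIM('a)) * of_real (hermite_nd \<alpha> x)"
proof -
  have "laplacian (\<lambda>y. complex_of_real (hermite_nd \<alpha> y)) x =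
     of_real ((\<Sum>b\<in>Basis. (x \<bullet> b)\<^sup>2 - (2 * real (\<alpha> b) + 1)) * hermite_nd \<alpha> x)"
    unfolding laplacian_def by (simp add: hermite_nd_partial_deriv2 sum_distrib_right)
  also have "(\<Sum>b\<in>Basis. (x \<bullet> b)\<^sup>2 - (2 * real (\<alpha> b) + 1)) = (norm x)\<^sup>2 - (2 * real (\<Sum>b\<in>Basis. \<alpha> b) + real DIM('a))"
    unfolding power2_norm_eq_inner
    by (subst euclidean_inner) (simp add: sum_subtractf sum.distrib sum_distrib_left power2_eq_square)
  finally show ?thesis by (simp add: algebra_simps)
qed

text \<open>The eigenvalue equation for \<open>u\<close> is a weak one. Tested with a Hermite
  product, itself a Schwartz eigenfunction, it equates two multiples of the same integral.\<close>

lemma harmonic_oscillator_orthogonal: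
  fixes u :: "'a::euclidean_space \<Rightarrow> complex"
  assumes "harmonic_oscillator u (\<lambda>x. of_real l * u x)"
    and "l \<noteq> 2 * real (\<Sum>b\<in>Basis. \<alpha> b) + real DIM('a)"
  shows "(LINT x|lborel. u x * of_real (hermite_nd \<alpha> x)) = 0"
proof -
  let ?I = "LINT x|lborel. u x * of_real (hermite_nd \<alpha> x)"
  let ?m = "2 * real (\<Sum>b\<in>Basis. \<alpha> b) + real DIM('a)"
  have s: "(\<lambda>y. complex_of_real (hermite_nd \<alpha> y)) \<in> schwartz"
    using hermite_nd_in_gauss_poly gauss_poly_subset_schwartz by blast
  have "(LINT x|lborel. u x * (of_real ?m * of_real (hermite_nd \<alpha> x))) =
        (LINT x|lborel. of_real l * u x * of_real (hermite_nd \<alpha> x))"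
    using assms(1) s unfolding harmonic_oscillator_def hermite_nd_oscillator[symmetric] by blast
  then have "of_real ?m * ?I = of_real l * ?I"
    by (simp only: mult.assoc mult.left_commute[of "u _"] integral_mult_right_zero)
  then have "(of_real ?m - of_real l) * ?I = 0" by (simp add: left_diff_distrib)
  moreover have "complex_of_real ?m \<noteq> of_real l" using assms(2) by (metis of_real_eq_iff)
  ultimately show ?thesis by simp
qed

section \<open>Functions determined by their Gaussian averages\<close>

lemma integral_lborel_affine:
  fixes f :: "'a::euclidean_space \<Rightarrow> complex"
  assumes [measurable]: "f \<in> borel_measurable borel" and t: "t \<noteq> 0"
  shows "(LINT y|lborel. f y) = \<bar>t\<bar> ^ DIM('a) *\<^sub>R (LINT w|lborel. f (z + t *\<^sub>R w))"
proof -
  have "(LINT y|lborel. f y) = (LINT y|density (distr lborel borel (\<lambda>x. z + t *\<^sub>R x)) (\<lambda>_. ennreal (\<bar>t\<bar> ^ DIM('a))). f y)"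
    by (subst (1) lborel_affine[OF t, of z]) (simp add: ennreal_power)
  also have "\<dots> = (LINT y|distr lborel borel (\<lambda>x. z + t *\<^sub>R x). (\<bar>t\<bar> ^ DIM('a)) *\<^sub>R f y)"
    by (rule integral_density) auto
  also have "\<dots> = (LINT w|lborel. (\<bar>t\<bar> ^ DIM('a)) *\<^sub>R f (z + t *\<^sub>R w))"
    by (rule integral_distr) auto
  finally show ?thesis by simp
qed

lemma integral_lborel_translate:
  fixes f :: "'a::euclidean_space \<Rightarrow> 'b::{banach, second_countable_topology}"
  assumes [measurable]: "f \<in> borel_measurable borel"
  shows "(LINT y|lborel. f (c + y)) = (LINT y|lborel. f y)"
  by (subst (2) lborel_distr_plus[of c, symmetric]) (rule integral_distr[symmetric], auto)

lemma integrable_lborel_translate: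
  fixes f :: "'a::euclidean_space \<Rightarrow> 'b::{banach, second_countable_topology}"
  assumes "integrable lborel f"
  shows "integrable lborel (\<lambda>y. f (c + y))"
proof -
  have "integrable (distr lborel borel ((+) c)) f" using assms by (simp add: lborel_distr_plus)
  then show ?thesis by (subst (asm) integrable_distr_eq) (use assms in auto)
qed

text \<open>The indicator of a box shifted by a vanishing amount converges except possibly on the
  faces, and these form a null set.\<close>

lemma AE_lborel_box_or_not_cbox: "AE x in lborel. x \<in> box a b \<or> x \<notin> cbox a (b::'a::euclidean_space)"
proof (rule AE_I')
  have "emeasure lborel (cbox a b - box a b) = 0"
  proof (cases "\<forall>i\<in>Basis. a \<bullet> i \<le> b \<bullet> i")
    case True
    have "emeasure lborel (cbox a b - box a b) = emeasure lborel (cbox a b) - emeasure lborel (box a b)"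
      using True by (intro emeasure_Diff) (auto simp: box_subset_cbox emeasure_lborel_box)
    also have "\<dots> = 0" using True by simp
    finally show ?thesis .
  next
    case False
    then have "cbox a b = {}" unfolding box_eq_empty by (auto simp: not_le)
    then show ?thesis by simp
  qed
  then show "cbox a b - box a b \<in> null_sets lborel" by (auto intro: null_setsI)
qed auto

text \<open>
  Averaging \<open>v\<close> over \<open>z + t w\<close> with Gaussian weight in \<open>w\<close> gives \<open>0\<close> for every \<open>z\<close>; integrate
  over \<open>z\<close> in the box, exchange the integrals and let \<open>t\<close> tend to \<open>0\<close>.
\<close>

lemma integral_box_eq_0:
  fixes v :: "'a::euclidean_space \<Rightarrow> complex"
  assumes v: "integrable lborel v" and t0: "t \<longlonglongrightarrow> 0" and t: "\<And>n. t n > 0"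
    and zero: "\<And>n z. (LINT y|lborel. v y * of_real (exp (- ((1 / (t n))\<^sup>2) * (norm (y - z))\<^sup>2))) = 0"
    and g: "integrable lborel (\<lambda>w::'a. exp (- (norm w)\<^sup>2))" "(LINT w|lborel. exp (- (norm (w::'a))\<^sup>2)) > 0"
  shows "(LINT y|lborel. indicator (box a b) y *\<^sub>R v y) = 0"
proof -
  define B where "B = box a b"
  have [measurable]: "v \<in> borel_measurable borel" using v by auto
  have [measurable]: "B \<in> sets borel" by (simp add: B_def)
  define G where "G w = exp (- (norm w)\<^sup>2)" for w :: 'a
  have [measurable]: "G \<in> borel_measurable borel" unfolding G_def[abs_def] by measurable
  define c where "c n w = (LINT z|lborel. indicator B z *\<^sub>R v (z + t n *\<^sub>R w))" for n w
  have vint: "integrable lborel (\<lambda>z. v (z + w))" for w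
    using integrable_lborel_translate[OF v, of w] by (simp add: add.commute)
  have avg: "(LINT w|lborel. G w *\<^sub>R v (z + t n *\<^sub>R w)) = 0" for n z
  proof -
    let ?F = "\<lambda>y. v y * of_real (exp (- ((1 / (t n))\<^sup>2) * (norm (y - z))\<^sup>2))"
    have "\<bar>t n\<bar> ^ DIM('a) *\<^sub>R (LINT w|lborel. ?F (z + t n *\<^sub>R w)) = 0"
      using zero[of n z] by (subst integral_lborel_affine[symmetric]) (use t[of n] in auto)
    moreover have "?F (z + t n *\<^sub>R w) = G w *\<^sub>R v (z + t n *\<^sub>R w)" for w
      using t[of n] by (simp add: G_def power_mult_distrib power_divide scaleR_conv_of_real)
    ultimately show ?thesis using t[of n] by simp
  qed
  have J: "(LINT w|lborel. G w *\<^sub>R c n w) = 0" for n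
  proof -
    let ?f = "\<lambda>w z. G w *\<^sub>R (indicator B z *\<^sub>R v (z + t n *\<^sub>R w))"
    have i: "integrable lborel (\<lambda>z. ?f w z)" for w
    proof -
      have "integrable lborel (\<lambda>z. indicator B z *\<^sub>R v (z + t n *\<^sub>R w))"
        using vint by (intro integrable_mult_indicator) auto
      then show ?thesis by (intro integrable_scaleR_right)
    qed
    have "integrable (lborel \<Otimes>\<^sub>M lborel) (\<lambda>(w, z). ?f w z)"
    proof (rule lborel_pair.Fubini_integrable)
      show "integrable lborel (\<lambda>w. LINT z|lborel. norm (case (w, z) of (w, z) \<Rightarrow> ?f w z))"
      proof (rule Bochner_Integration.integrable_bound)
        show "integrable lborel (\<lambda>w. G w * (LINT z|lborel. norm (v z)))"
          using g(1) by (intro integrable_mult_left) (simp add: G_def)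
        have "(LINT z|lborel. norm (?f w z)) \<le> G w * (LINT z|lborel. norm (v z))" for w
        proof -
          have "(LINT z|lborel. norm (?f w z)) \<le> (LINT z|lborel. G w * norm (v (z + t n *\<^sub>R w)))"
          proof (rule integral_mono)
            show "integrable lborel (\<lambda>z. norm (?f w z))" using i by (rule integrable_norm)
            show "integrable lborel (\<lambda>z. G w * norm (v (z + t n *\<^sub>R w)))"
              using vint by (intro integrable_mult_right integrable_norm)
          qed (auto simp: G_def indicator_def)
          also have "\<dots> = G w * (LINT z|lborel. norm (v (t n *\<^sub>R w + z)))" by (simp add: add.commute)
          also have "(LINT z|lborel. norm (v (t n *\<^sub>R w + z))) = (LINT z|lborel. norm (v z))"
            by (rule integral_lborel_translate) measurable
          finally show ?thesis .
        qed
        then show "AE w in lborel. norm (LINT z|lborel. norm (case (w, z) of (w, z) \<Rightarrow> ?f w z))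
             \<le> norm (G w * (LINT z|lborel. norm (v z)))"
          by (intro AE_I2) (simp add: G_def)
      qed measurable
      show "AE w in lborel. integrable lborel (\<lambda>z. case (w, z) of (w, z) \<Rightarrow> ?f w z)"
        using i by simp
    qed measurable
    then have "(LINT w|lborel. (LINT z|lborel. ?f w z)) = (LINT z|lborel. (LINT w|lborel. ?f w z))"
      by (rule lborel_pair.Fubini_integral[symmetric])
    also have "\<dots> = (LINT z|lborel. indicator B z *\<^sub>R (LINT w|lborel. G w *\<^sub>R v (z + t n *\<^sub>R w)))"
      unfolding integral_scaleR_right[symmetric] by (simp add: mult.commute)
    also have "\<dots> = 0" by (simp add: avg)
    finally show ?thesis by (simp only: c_def integral_scaleR_right)
  qed
  \<comment> \<open>Moving the translation from \<open>v\<close> to the indicator turns the limit in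
    \<open>n\<close> into dominated convergence under \<open>norm (v y)\<close>, in place of
    continuity of translations in \<open>L^1\<close>.\<close>
  have c_shift: "c n w = (LINT y|lborel. indicator B (y - t n *\<^sub>R w) *\<^sub>R v y)" for n w
  proof -
    have "(LINT y|lborel. indicator B (y - t n *\<^sub>R w) *\<^sub>R v y) =
       (LINT y|lborel. indicator B ((t n *\<^sub>R w + y) - t n *\<^sub>R w) *\<^sub>R v (t n *\<^sub>R w + y))"
      by (rule integral_lborel_translate[of "\<lambda>y. indicator B (y - t n *\<^sub>R w) *\<^sub>R v y" "t n *\<^sub>R w", symmetric]) measurable
    then show ?thesis by (simp add: c_def add.commute)
  qed
  have c_lim: "(\<lambda>n. c n w) \<longlonglongrightarrow> (LINT y|lborel. indicator B y *\<^sub>R v y)" for w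
    unfolding c_shift
  proof (rule integral_dominated_convergence)
    show "integrable lborel (\<lambda>y. norm (v y))" using v by (rule integrable_norm)
    have "(\<lambda>n. indicat_real B (y - t n *\<^sub>R w)) \<longlonglongrightarrow> indicator B y" if "y \<in> box a b \<or> y \<notin> cbox a b" for y
    proof -
      have "(\<lambda>n. y - t n *\<^sub>R w) \<longlonglongrightarrow> y - 0 *\<^sub>R w" by (intro tendsto_intros t0)
      then have lim: "(\<lambda>n. y - t n *\<^sub>R w) \<longlonglongrightarrow> y" by simp
      from that have "eventually (\<lambda>n. indicat_real B (y - t n *\<^sub>R w) = indicator B y) sequentially"
      proof
        assume "y \<in> box a b"
        then have "eventually (\<lambda>n. y - t n *\<^sub>R w \<in> box a b) sequentially"
          using lim open_box topological_tendstoD by blast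
        then show ?thesis by eventually_elim (use \<open>y \<in> box a b\<close> in \<open>simp add: B_def\<close>)
      next
        assume "y \<notin> cbox a b"
        then have "eventually (\<lambda>n. y - t n *\<^sub>R w \<in> - cbox a b) sequentially"
          using lim closed_cbox topological_tendstoD open_Compl by (metis ComplI)
        then show ?thesis
          by eventually_elim (use \<open>y \<notin> cbox a b\<close> box_subset_cbox[of a b] in \<open>auto simp: B_def indicator_def\<close>)
      qed
      then show ?thesis by (rule tendsto_eventually)
    qed
    then show "AE y in lborel. (\<lambda>n. indicator B (y - t n *\<^sub>R w) *\<^sub>R v y) \<longlonglongrightarrow> indicator B y *\<^sub>R v y"
      using AE_lborel_box_or_not_cbox[of a b] by (auto intro!: tendsto_scaleR)
    show "AE y in lborel. norm (indicator B (y - t n *\<^sub>R w) *\<^sub>R v y) \<le> norm (v y)" for n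
      by (intro AE_I2) (simp add: indicator_def)
  qed measurable
  have c_meas [measurable]: "c n \<in> borel_measurable borel" for n
    unfolding c_def[abs_def] by measurable
  have "(\<lambda>n. LINT w|lborel. G w *\<^sub>R c n w) \<longlonglongrightarrow> (LINT w|lborel. G w *\<^sub>R (LINT y|lborel. indicator B y *\<^sub>R v y))"
  proof (rule integral_dominated_convergence)
    show "integrable lborel (\<lambda>w. G w * (LINT z|lborel. norm (v z)))"
      using g(1) by (intro integrable_mult_left) (simp add: G_def)
    show "AE w in lborel. (\<lambda>n. G w *\<^sub>R c n w) \<longlonglongrightarrow> G w *\<^sub>R (LINT y|lborel. indicator B y *\<^sub>R v y)"
      by (intro AE_I2 tendsto_intros c_lim)
    have "norm (c n w) \<le> (LINT z|lborel. norm (v z))" for n w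
      unfolding c_shift
    proof (rule order_trans[OF integral_norm_bound integral_mono])
      have "integrable lborel (\<lambda>y. indicator B (y - t n *\<^sub>R w) *\<^sub>R v y)"
        by (rule Bochner_Integration.integrable_bound[OF v]) (auto simp: indicator_def)
      then show "integrable lborel (\<lambda>y. norm (indicator B (y - t n *\<^sub>R w) *\<^sub>R v y))"
        by (rule integrable_norm)
    qed (use v in \<open>auto simp: indicator_def\<close>)
    then show "AE w in lborel. norm (G w *\<^sub>R c n w) \<le> G w * (LINT z|lborel. norm (v z))" for n
      by (intro AE_I2) (simp add: G_def mult_left_mono)
  qed measurable
  then have "(LINT w|lborel. G w *\<^sub>R (LINT y|lborel. indicator B y *\<^sub>R v y)) = 0"
    unfolding J by (simp add: LIMSEQ_const_iff)
  moreover have "(LINT w|lborel. G w *\<^sub>R (LINT y|lborel. indicator B y *\<^sub>R v y)) =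
      (LINT w|lborel. G w) *\<^sub>R (LINT y|lborel. indicator B y *\<^sub>R v y)"
    using g(1) by (intro integral_scaleR_left) (simp add: G_def)
  ultimately show ?thesis using g(2) by (simp add: G_def B_def)
qed

text \<open>The positive and the negative part are densities of finite measures that agree on open
  boxes, an intersection-stable generator of the Borel sets.\<close>

lemma AE_eq_0_if_integral_box_eq_0:
  fixes v :: "'a::euclidean_space \<Rightarrow> real"
  assumes v: "integrable lborel v"
    and zero: "\<And>a b. (LINT y|lborel. indicator (box a b) y * v y) = 0"
  shows "AE y in lborel. v y = 0"
proof -
  have [measurable]: "v \<in> borel_measurable borel" using v by auto
  let ?p = "\<lambda>y. ennreal (v y)" and ?n = "\<lambda>y. ennreal (- v y)"
  have fin: "(\<integral>\<^sup>+y. ?p y \<partial>lborel) < \<infinity>" "(\<integral>\<^sup>+y. ?n y \<partial>lborel) < \<infinity>"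
    using v by (auto simp: real_integrable_def less_top)
  have int: "integrable lborel (\<lambda>y. indicator (box a b) y * v y)" for a b
    using integrable_mult_indicator[OF _ v, of "box a b"] by simp
  have eq: "emeasure (density lborel ?p) (box a b) = emeasure (density lborel ?n) (box a b)" for a b
  proof -
    have e: "(\<integral>\<^sup>+y. ennreal (s * v y) * indicator (box a b) y \<partial>lborel) = (\<integral>\<^sup>+y. ennreal (s * (indicator (box a b) y * v y)) \<partial>lborel)" for s :: real
      by (intro nn_integral_cong) (auto simp: indicator_def)
    have f: "(\<integral>\<^sup>+y. ennreal (indicator (box a b) y * v y) \<partial>lborel) \<noteq> \<infinity>"
      "(\<integral>\<^sup>+y. ennreal (- (indicator (box a b) y * v y)) \<partial>lborel) \<noteq> \<infinity>"
      using int[of a b] by (auto simp: real_integrable_def)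
    have "enn2real (\<integral>\<^sup>+y. ennreal (indicator (box a b) y * v y) \<partial>lborel)
       - enn2real (\<integral>\<^sup>+y. ennreal (- (indicator (box a b) y * v y)) \<partial>lborel) = 0"
      using zero[of a b] real_lebesgue_integral_def[OF int[of a b]] by simp
    then have "(\<integral>\<^sup>+y. ennreal (indicator (box a b) y * v y) \<partial>lborel) =
        (\<integral>\<^sup>+y. ennreal (- (indicator (box a b) y * v y)) \<partial>lborel)"
      using f ennreal_enn2real unfolding less_top infinity_ennreal_def
      by (metis eq_iff_diff_eq_0 less_top)
    then show ?thesis using e[of 1] e[of "-1"] by (simp add: emeasure_density)
  qed
  have "density lborel ?p = density lborel ?n"
  proof (rule measure_eqI_generator_eq)
    let ?E = "range (\<lambda>(a, b). box a b::'a set)"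
    show "Int_stable ?E" by (auto simp: Int_stable_def box_Int_box)
    show "?E \<subseteq> Pow UNIV" "sets (density lborel ?p) = sigma_sets UNIV ?E" "sets (density lborel ?n) = sigma_sets UNIV ?E"
      by (simp_all add: borel_eq_box)
    let ?A = "\<lambda>n::nat. box (- (real n *\<^sub>R One)) (real n *\<^sub>R One) :: 'a set"
    show "range ?A \<subseteq> ?E" "(\<Union>i. ?A i) = UNIV" unfolding UN_box_eq_UNIV by auto
    show "emeasure (density lborel ?p) (?A i) \<noteq> \<infinity>" for i
    proof -
      have "emeasure (density lborel ?p) (?A i) \<le> (\<integral>\<^sup>+y. ?p y \<partial>lborel)"
        by (simp add: emeasure_density) (intro nn_integral_mono, auto simp: indicator_def)
      then show ?thesis using fin by (metis infinity_ennreal_def leD)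
    qed
    show "emeasure (density lborel ?p) X = emeasure (density lborel ?n) X" if "X \<in> ?E" for X
      using that eq by auto
  qed
  then have "AE y in lborel. ?p y = ?n y"
    by (intro sigma_finite_measure.density_unique[OF sigma_finite_lborel]) auto
  then show ?thesis
    by eventually_elim (metis ennreal_eq_0_iff linorder_linear neg_0_le_iff_le neg_le_0_iff_le order_antisym_conv)
qed

lemma AE_eq_0_if_gaussian_averages_eq_0:
  fixes v :: "'a::euclidean_space \<Rightarrow> complex"
  assumes v: "integrable lborel v" and t0: "t \<longlonglongrightarrow> 0" and t: "\<And>n. t n > 0"
    and zero: "\<And>n z. (LINT y|lborel. v y * of_real (exp (- ((1 / (t n))\<^sup>2) * (norm (y - z))\<^sup>2))) = 0"
    and g: "integrable lborel (\<lambda>w::'a. exp (- (norm w)\<^sup>2))" "(LINT w|lborel. exp (- (norm (w::'a))\<^sup>2)) > 0"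
  shows "AE y in lborel. v y = 0"
proof -
  have box: "(LINT y|lborel. indicator (box a b) y *\<^sub>R v y) = 0" for a b
    using assms by (rule integral_box_eq_0)
  have int: "integrable lborel (\<lambda>y. indicator (box a b) y *\<^sub>R v y)" for a b
    by (intro integrable_mult_indicator v) auto
  have "AE y in lborel. Re (v y) = 0"
  proof (rule AE_eq_0_if_integral_box_eq_0)
    fix a b :: 'a
    show "(LINT y|lborel. indicator (box a b) y * Re (v y)) = 0"
      using integral_Re[OF int[of a b]] box[of a b] by simp
  qed (use v in simp)
  moreover have "AE y in lborel. Im (v y) = 0"
  proof (rule AE_eq_0_if_integral_box_eq_0)
    fix a b :: 'a
    show "(LINT y|lborel. indicator (box a b) y * Im (v y)) = 0"
      using integral_Im[OF int[of a b]] box[of a b] by simp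
  qed (use v in simp)
  ultimately show ?thesis by eventually_elim (simp add: complex_eq_iff)
qed

lemma exp_norm_sq_eq_prod:
  "exp (- s * (norm (y::'a::euclidean_space))\<^sup>2) = (\<Prod>b\<in>Basis. exp (- s * (y \<bullet> b)\<^sup>2))"
  unfolding power2_norm_eq_inner
  by (subst euclidean_inner) (simp add: sum_distrib_left power2_eq_square flip: exp_sum sum_negf)

lemma exp_square_eq_normal_density:
  assumes "s > 0"
  shows "exp (- s * x\<^sup>2) = sqrt (pi / s) * normal_density 0 (1 / sqrt (2 * s)) x"
  using assms by (simp add: normal_density_def power_divide real_sqrt_divide)

lemma integrable_exp_norm_sq:
  assumes "s > 0"
  shows "integrable lborel (\<lambda>y::'a::euclidean_space. exp (- s * (norm y)\<^sup>2))"
  unfolding exp_norm_sq_eq_prod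
  by (rule integrable_lborel_prod[where f = "\<lambda>b x. exp (- s * x\<^sup>2)"])
    (simp only: exp_square_eq_normal_density[OF assms], intro integrable_mult_right integrable_normal_density, use assms in simp)

lemma integral_exp_norm_sq_pos:
  assumes "s > 0"
  shows "(LINT y|lborel. exp (- s * (norm (y::'a::euclidean_space))\<^sup>2)) > 0"
proof -
  have 1: "integrable lborel (\<lambda>x::real. exp (- s * x\<^sup>2))"
    unfolding exp_square_eq_normal_density[OF assms] by (intro integrable_mult_right integrable_normal_density, use assms in simp)
  have "(LINT y|lborel. exp (- s * (norm (y::'a))\<^sup>2)) = (\<Prod>b\<in>(Basis::'a set). LINT x|lborel. exp (- s * x\<^sup>2))"
    unfolding exp_norm_sq_eq_prod by (rule integral_lborel_prod[where f = "\<lambda>b x. exp (- s * x\<^sup>2)"]) (rule 1)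
  also have "(LINT x|lborel. exp (- s * x\<^sup>2)) = sqrt (pi / s)"
    unfolding exp_square_eq_normal_density[OF assms] using assms by simp
  finally show ?thesis using assms by simp
qed

section \<open>Completeness of the Hermite products\<close>

lemma Lp_2_D:
  fixes u :: "'a::euclidean_space \<Rightarrow> complex"
  assumes "u \<in> Lp 2"
  shows "u \<in> borel_measurable borel" "integrable lborel (\<lambda>x. (norm (u x))\<^sup>2)"
  using assms by (simp_all add: Lp_def powr_numeral)

lemma integrable_Lp_2_mult:
  fixes u g :: "'a::euclidean_space \<Rightarrow> complex"
  assumes u: "u \<in> Lp 2" and [measurable]: "g \<in> borel_measurable borel"
    and g: "integrable lborel (\<lambda>x. (norm (g x))\<^sup>2)"
  shows "integrable lborel (\<lambda>x. u x * g x)"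
proof (rule Bochner_Integration.integrable_bound)
  note [measurable] = Lp_2_D(1)[OF u]
  show "integrable lborel (\<lambda>x. (norm (u x))\<^sup>2 + (norm (g x))\<^sup>2)"
    using Lp_2_D(2)[OF u] g by (rule Bochner_Integration.integrable_add)
  show "(\<lambda>x. u x * g x) \<in> borel_measurable lborel" by measurable
  show "AE x in lborel. norm (u x * g x) \<le> norm ((norm (u x))\<^sup>2 + (norm (g x))\<^sup>2)"
  proof (rule AE_I2)
    fix x
    have "norm (u x) * norm (g x) \<le> (norm (u x))\<^sup>2 + (norm (g x))\<^sup>2"
      using sum_squares_bound[of "norm (u x)" "norm (g x)"]
        mult_nonneg_nonneg[OF norm_ge_zero norm_ge_zero, of "u x" "g x"] by linarith
    then show "norm (u x * g x) \<le> norm ((norm (u x))\<^sup>2 + (norm (g x))\<^sup>2)"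
      by (simp add: norm_mult)
  qed
qed

lemma integrable_Lp_2_gaussian_bound:
  fixes u g :: "'a::euclidean_space \<Rightarrow> complex"
  assumes u: "u \<in> Lp 2" and [measurable]: "g \<in> borel_measurable borel" and s: "s > 0"
    and g: "\<And>y. norm (g y) \<le> C * exp (- s * (norm y)\<^sup>2)"
  shows "integrable lborel (\<lambda>x. u x * g x)"
proof (rule integrable_Lp_2_mult[OF u])
  show "integrable lborel (\<lambda>x. (norm (g x))\<^sup>2)"
  proof (rule Bochner_Integration.integrable_bound)
    show "integrable lborel (\<lambda>y::'a. C\<^sup>2 * exp (- (2 * s) * (norm y)\<^sup>2))"
      using s by (intro integrable_mult_right integrable_exp_norm_sq) auto
    show "AE x in lborel. norm ((norm (g x))\<^sup>2) \<le> norm (C\<^sup>2 * exp (- (2 * s) * (norm x)\<^sup>2))"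
    proof (rule AE_I2)
      fix x
      have "(norm (g x))\<^sup>2 \<le> (C * exp (- s * (norm x)\<^sup>2))\<^sup>2" using g by (intro power_mono) auto
      also have "\<dots> = C\<^sup>2 * exp (- (2 * s) * (norm x)\<^sup>2)"
        by (simp add: power_mult_distrib flip: exp_double)
      finally show "norm ((norm (g x))\<^sup>2) \<le> norm (C\<^sup>2 * exp (- (2 * s) * (norm x)\<^sup>2))" by simp
    qed
  qed measurable
qed measurable

lemma gauss_poly_measurable: "f \<in> gauss_poly \<Longrightarrow> f \<in> borel_measurable borel"
  using gauss_poly_differentiable
  by (intro borel_measurable_continuous_onI)
    (auto simp: continuous_on_eq_continuous_at intro: differentiable_imp_continuous_within)

lemma integrable_Lp_2_gauss_poly:
  assumes "u \<in> Lp 2" "g \<in> gauss_poly"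
  shows "integrable lborel (\<lambda>x. u x * g x)"
proof -
  obtain C where "\<And>y. norm (g y) \<le> C * exp (- (1/4) * (norm y)\<^sup>2)"
    using gauss_poly_bound[OF assms(2), of "1/4"] by auto
  then show ?thesis
    by (intro integrable_Lp_2_gaussian_bound[OF assms(1) gauss_poly_measurable[OF assms(2)], of "1/4" C]) auto
qed

text \<open>The exponential may be expanded under the integral because its partial sums are
  dominated by \<open>exp |q y|\<close>; the same domination makes every moment finite.\<close>

lemma integral_exp_series_eq_0:
  fixes f :: "'a::euclidean_space \<Rightarrow> complex" and q :: "'a \<Rightarrow> real"
  assumes [measurable]: "f \<in> borel_measurable borel" "q \<in> borel_measurable borel"
    and int: "integrable lborel (\<lambda>y. f y * of_real (exp \<bar>q y\<bar>))"
    and zero: "\<And>n. (LINT y|lborel. f y * of_real (q y ^ n)) = 0"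
  shows "(LINT y|lborel. f y * of_real (exp (q y))) = 0"
proof -
  let ?s = "\<lambda>K y. f y * of_real (\<Sum>n<K. inverse (fact n) * q y ^ n)"
  have exp_eq: "exp x = (\<Sum>n. inverse (fact n) * x ^ n)" for x :: real
    using exp_converges[of x, THEN sums_unique] by (simp add: field_simps)
  have le: "(\<Sum>n\<in>A. inverse (fact n) * \<bar>x\<bar> ^ n) \<le> exp \<bar>x\<bar>" if "finite A" for A and x :: real
    unfolding exp_eq using that by (intro sum_le_suminf summable_exp) auto
  have term_int: "integrable lborel (\<lambda>y. f y * of_real (q y ^ n))" for n
  proof (rule Bochner_Integration.integrable_bound)
    show "integrable lborel (\<lambda>y. of_real (fact n) * (f y * of_real (exp \<bar>q y\<bar>)))"
      by (intro integrable_mult_right int)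
    have "\<bar>q y\<bar> ^ n \<le> fact n * exp \<bar>q y\<bar>" for y
      using le[of "{n}" "q y"] by (simp add: field_simps)
    then have "norm (f y) * \<bar>q y\<bar> ^ n \<le> norm (f y) * (fact n * exp \<bar>q y\<bar>)" for y
      by (intro mult_left_mono) auto
    moreover have "norm (f y * of_real (q y ^ n)) = norm (f y) * \<bar>q y\<bar> ^ n" for y
      by (simp only: norm_mult norm_of_real power_abs)
    moreover have "norm (of_real (fact n) * (f y * of_real (exp \<bar>q y\<bar>))) = norm (f y) * (fact n * exp \<bar>q y\<bar>)" for y
      by (simp add: norm_mult)
    ultimately show "AE y in lborel. norm (f y * of_real (q y ^ n)) \<le> norm (of_real (fact n) * (f y * of_real (exp \<bar>q y\<bar>)))"
      by simp
  qed measurable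
  have "(\<lambda>K. LINT y|lborel. ?s K y) \<longlonglongrightarrow> (LINT y|lborel. f y * of_real (exp (q y)))"
  proof (rule integral_dominated_convergence)
    show "integrable lborel (\<lambda>y. norm (f y * of_real (exp \<bar>q y\<bar>)))" using int by (rule integrable_norm)
    show "AE y in lborel. (\<lambda>K. ?s K y) \<longlonglongrightarrow> f y * of_real (exp (q y))"
      unfolding exp_eq
      by (intro AE_I2 tendsto_intros summable_LIMSEQ summable_exp)
    have "\<bar>\<Sum>n<K. inverse (fact n) * q y ^ n\<bar> \<le> exp \<bar>q y\<bar>" for K y
      using sum_abs[of "\<lambda>n. inverse (fact n) * q y ^ n" "{..<K}"] le[of "{..<K}" "q y"]
      by (simp add: abs_mult power_abs)
    then show "AE y in lborel. norm (?s K y) \<le> norm (f y * of_real (exp \<bar>q y\<bar>))" for K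
      unfolding norm_mult norm_of_real by (intro AE_I2 mult_left_mono) auto
  qed measurable
  moreover have "(LINT y|lborel. ?s K y) = 0" for K
  proof -
    have "(LINT y|lborel. ?s K y) = (LINT y|lborel. (\<Sum>n<K. of_real (inverse (fact n)) * (f y * of_real (q y ^ n))))"
      by (simp add: sum_distrib_left mult_ac)
    also have "\<dots> = (\<Sum>n<K. of_real (inverse (fact n)) * (LINT y|lborel. f y * of_real (q y ^ n)))"
      by (simp only: Bochner_Integration.integral_sum integrable_mult_right term_int integral_mult_right_zero)
    finally show ?thesis by (simp only: zero) simp
  qed
  ultimately show ?thesis by (simp add: LIMSEQ_const_iff)
qed

text \<open>Monomials are encoded as lists of vectors: prepending a vector multiplies by a linear
  functional, which suits the inductions, and \<open>replicate n z\<close> yields the powers in the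
  series of \<open>exp (y \<bullet> z)\<close>.\<close>

definition inner_prod :: "'a::euclidean_space list \<Rightarrow> 'a \<Rightarrow> real" where
  "inner_prod zs y = prod_list (map (\<lambda>z. y \<bullet> z) zs)"

lemma inner_prod_simps [simp]: "inner_prod [] y = 1" "inner_prod (z # zs) y = (y \<bullet> z) * inner_prod zs y"
  "inner_prod (replicate n z) y = (y \<bullet> z) ^ n"
  by (simp_all add: inner_prod_def)

lemma inner_prod_measurable [measurable]: "inner_prod zs \<in> borel_measurable borel"
proof -
  have "(\<lambda>y. inner_prod zs y) \<in> borel_measurable borel" by (induction zs) auto
  then show ?thesis by simp
qed

lemma inner_prod_bound:
  assumes "d > 0"
  shows "\<exists>C\<ge>0. \<forall>y. \<bar>inner_prod zs y\<bar> \<le> C * exp (d * (norm y)\<^sup>2)"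
  using assms
proof (induction zs arbitrary: d)
  case Nil
  then show ?case by (intro exI[of _ 1]) auto
next
  case (Cons z zs)
  then obtain C where C: "C \<ge> 0" "\<And>y. \<bar>inner_prod zs y\<bar> \<le> C * exp (d / 2 * (norm y)\<^sup>2)"
    by (metis half_gt_zero)
  have "\<bar>inner_prod (z # zs) y\<bar> \<le> norm z * (1 + 1 / (d / 2)) * C * exp (d * (norm y)\<^sup>2)" for y
  proof -
    have "\<bar>inner_prod (z # zs) y\<bar> = \<bar>y \<bullet> z\<bar> * \<bar>inner_prod zs y\<bar>" by (simp add: abs_mult)
    also have "\<dots> \<le> (norm y * norm z) * (C * exp (d / 2 * (norm y)\<^sup>2))"
      by (intro mult_mono Cauchy_Schwarz_ineq2 C) auto
    also have "\<dots> = norm y * (norm z * C * exp (d / 2 * (norm y)\<^sup>2))" by simp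
    also have "\<dots> \<le> ((1 + 1 / (d / 2)) * exp (d / 2 * (norm y)\<^sup>2)) * (norm z * C * exp (d / 2 * (norm y)\<^sup>2))"
      using C Cons.prems by (intro mult_right_mono norm_le_exp_norm_sq) auto
    also have "\<dots> = norm z * (1 + 1 / (d / 2)) * C * (exp (d / 2 * (norm y)\<^sup>2) * exp (d / 2 * (norm y)\<^sup>2))" by simp
    finally show ?thesis by (simp flip: exp_add)
  qed
  moreover have "norm z * (1 + 1 / (d / 2)) * C \<ge> 0" using C Cons.prems by simp
  ultimately show ?case by blast
qed

lemma hermite_nd_mult_coord:
  assumes b: "b \<in> Basis"
  shows "(y \<bullet> b) * hermite_nd \<alpha> y = sqrt (2 * real (\<alpha> b)) / 2 * hermite_nd (\<alpha>(b := \<alpha> b - 1)) y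
     + sqrt (2 * (real (\<alpha> b) + 1)) / 2 * hermite_nd (\<alpha>(b := Suc (\<alpha> b))) y"
proof -
  define R where "R = (\<Prod>b'\<in>Basis - {b}. hermite_fun (\<alpha> b') (y \<bullet> b'))"
  have h: "hermite_nd (\<alpha>(b := n)) y = hermite_fun n (y \<bullet> b) * R" for n
    unfolding hermite_nd_def R_def using b by (subst prod.remove[of _ b]) (auto intro!: prod.cong)
  have "2 * ((y \<bullet> b) * hermite_nd \<alpha> y) = (2 * (y \<bullet> b) * hermite_fun (\<alpha> b) (y \<bullet> b)) * R"
    using h[of "\<alpha> b"] by simp
  also have "\<dots> = sqrt (2 * real (\<alpha> b)) * hermite_nd (\<alpha>(b := \<alpha> b - 1)) y
     + sqrt (2 * (real (\<alpha> b) + 1)) * hermite_nd (\<alpha>(b := Suc (\<alpha> b))) y"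
    unfolding hermite_fun_rec h by (simp add: algebra_simps)
  finally show ?thesis by simp
qed

lemma inner_prod_gauss_poly: "f \<in> gauss_poly \<Longrightarrow> (\<lambda>y. of_real (inner_prod zs y) * f y) \<in> gauss_poly"
  by (induction zs) (auto simp: mult.assoc intro: gauss_poly.linear)

text \<open>In place of Fourier uniqueness, the weight \<open>exp (- |y|^2 / 2)\<close> is sharpened
  step by step into narrow Gaussians around arbitrary centres, all of them orthogonal to
  \<open>u * gaussian\<close>; these act as an approximate identity.\<close>

context
  fixes u :: "'a::euclidean_space \<Rightarrow> complex"
  assumes u: "u \<in> Lp 2"
    and orth: "\<And>\<alpha>. (LINT y|lborel. u y * of_real (hermite_nd \<alpha> y)) = 0"
begin

lemma u_measurable: "u \<in> borel_measurable borel"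
  using Lp_2_D(1)[OF u] .

text \<open>Multiplication by a coordinate sends a Hermite product to a combination of two others,
  so the factors of the monomial are moved into \<open>\<alpha>\<close> one at a time; hence
  \<open>\<alpha>\<close> is arbitrary in the induction.\<close>

lemma orth_inner_prod_hermite:
  "(LINT y|lborel. u y * of_real (inner_prod zs y * hermite_nd \<alpha> y)) = 0"
proof (induction zs arbitrary: \<alpha>)
  case Nil
  then show ?case by (simp add: orth)
next
  case (Cons z zs)
  let ?a = "\<lambda>b. (z \<bullet> b) * (sqrt (2 * real (\<alpha> b)) / 2)" and ?c = "\<lambda>b. (z \<bullet> b) * (sqrt (2 * (real (\<alpha> b) + 1)) / 2)"
  let ?I = "\<lambda>\<beta> y. u y * of_real (inner_prod zs y * hermite_nd \<beta> y)"
  have int: "integrable lborel (?I \<beta>)" for \<beta>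
    using integrable_Lp_2_gauss_poly[OF u inner_prod_gauss_poly[OF hermite_nd_in_gauss_poly], of zs \<beta>] by simp
  have "u y * of_real (inner_prod (z # zs) y * hermite_nd \<alpha> y) =
     (\<Sum>b\<in>Basis. of_real (?a b) * ?I (\<alpha>(b := \<alpha> b - 1)) y + of_real (?c b) * ?I (\<alpha>(b := Suc (\<alpha> b))) y)" for y
  proof -
    have "inner_prod (z # zs) y * hermite_nd \<alpha> y = (\<Sum>b\<in>Basis. (z \<bullet> b) * inner_prod zs y * ((y \<bullet> b) * hermite_nd \<alpha> y))"
      by (simp add: euclidean_inner[of y z] sum_distrib_left sum_distrib_right mult_ac)
    also have "\<dots> = (\<Sum>b\<in>Basis. ?a b * (inner_prod zs y * hermite_nd (\<alpha>(b := \<alpha> b - 1)) y)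
        + ?c b * (inner_prod zs y * hermite_nd (\<alpha>(b := Suc (\<alpha> b))) y))"
      by (intro sum.cong refl, subst hermite_nd_mult_coord) (auto simp: algebra_simps)
    finally show ?thesis by (simp add: sum_distrib_left algebra_simps)
  qed
  then have "(LINT y|lborel. u y * of_real (inner_prod (z # zs) y * hermite_nd \<alpha> y)) =
     (\<Sum>b\<in>Basis. of_real (?a b) * (LINT y|lborel. ?I (\<alpha>(b := \<alpha> b - 1)) y)
       + of_real (?c b) * (LINT y|lborel. ?I (\<alpha>(b := Suc (\<alpha> b))) y))"
    by (simp only: Bochner_Integration.integral_sum Bochner_Integration.integral_add integrable_mult_right
        Bochner_Integration.integrable_add int integral_mult_right_zero)
  then show ?case by (simp only: Cons.IH) simp
qed

lemma integrable_inner_prod_exp: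
  assumes "s > 0"
  shows "integrable lborel (\<lambda>y. u y * of_real (inner_prod zs y * exp (- s * (norm y)\<^sup>2)))"
proof -
  note [measurable] = u_measurable
  obtain C where C: "C \<ge> 0" "\<And>y. \<bar>inner_prod zs y\<bar> \<le> C * exp (s / 2 * (norm y)\<^sup>2)"
    using inner_prod_bound[of "s / 2" zs] assms by auto
  show ?thesis
  proof (rule integrable_Lp_2_gaussian_bound[OF u, where s = "s / 2"])
    fix y
    have "norm (complex_of_real (inner_prod zs y * exp (- s * (norm y)\<^sup>2))) = \<bar>inner_prod zs y\<bar> * exp (- s * (norm y)\<^sup>2)"
      by (simp add: abs_mult norm_mult)
    also have "\<dots> \<le> C * exp (s / 2 * (norm y)\<^sup>2) * exp (- s * (norm y)\<^sup>2)" by (intro mult_right_mono C) auto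
    also have "\<dots> = C * exp (- (s / 2) * (norm y)\<^sup>2)" by (simp add: algebra_simps flip: exp_add)
    finally show "norm (complex_of_real (inner_prod zs y * exp (- s * (norm y)\<^sup>2))) \<le> C * exp (- (s / 2) * (norm y)\<^sup>2)" .
  qed (use assms in auto)
qed

text \<open>Since \<open>|y|^2\<close> is the sum of \<open>(y \<bullet> b)^2\<close>, a power of it
  is absorbed by prepending basis vectors twice to \<open>zs\<close>. Integrability is carried along
  because the sum over the basis is integrated term by term.\<close>

lemma orth_norm_power:
  assumes s: "s > 0"
    and zero: "\<And>zs. (LINT y|lborel. u y * of_real (inner_prod zs y * exp (- s * (norm y)\<^sup>2))) = 0"
  shows "(LINT y|lborel. u y * of_real (inner_prod zs y * exp (- s * (norm y)\<^sup>2)) * of_real (((norm y)\<^sup>2) ^ k)) = 0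
    \<and> integrable lborel (\<lambda>y. u y * of_real (inner_prod zs y * exp (- s * (norm y)\<^sup>2)) * of_real (((norm y)\<^sup>2) ^ k))"
proof (induction k arbitrary: zs)
  case 0
  then show ?case using zero integrable_inner_prod_exp[OF s] by simp
next
  case (Suc k)
  let ?I = "\<lambda>zs k y. u y * of_real (inner_prod zs y * exp (- s * (norm y)\<^sup>2)) * of_real (((norm y)\<^sup>2) ^ k)"
  have "?I zs (Suc k) y = (\<Sum>b\<in>Basis. ?I (b # b # zs) k y)" for y
  proof -
    have "(norm y)\<^sup>2 = (\<Sum>b\<in>Basis. (y \<bullet> b) * (y \<bullet> b))"
      unfolding power2_norm_eq_inner by (rule euclidean_inner)
    then have "((norm y)\<^sup>2) ^ Suc k = (\<Sum>b\<in>Basis. (y \<bullet> b) * (y \<bullet> b)) * ((norm y)\<^sup>2) ^ k"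
      by (metis power_Suc)
    then show ?thesis by (simp add: sum_distrib_left sum_distrib_right mult_ac)
  qed
  then show ?case
    using Suc.IH by (simp only: Bochner_Integration.integral_sum Bochner_Integration.integrable_sum) simp
qed

text \<open>
  Expanding \<open>exp (-s|y|\<^sup>2 / 2)\<close> into a power series is legitimate against \<open>exp (-s|y|\<^sup>2)\<close>,
  so the exponent can be raised by the factor \<open>3/2\<close> at a time.
\<close>

lemma orth_inner_prod_exp:
  "(LINT y|lborel. u y * of_real (inner_prod zs y * exp (- ((3/2) ^ k / 2) * (norm y)\<^sup>2))) = 0"
proof (induction k arbitrary: zs)
  case 0
  have c: "hermite_nd (\<lambda>_. 0) y = exp (- (1/2) * (norm y)\<^sup>2) / sqrt (sqrt pi) ^ DIM('a)" for y :: 'a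
    unfolding hermite_nd_def exp_norm_sq_eq_prod by (simp add: prod_dividef)
  have "(LINT y|lborel. u y * of_real (inner_prod zs y * hermite_nd (\<lambda>_. 0) y)) =
     (LINT y|lborel. u y * of_real (inner_prod zs y * exp (- (1/2) * (norm y)\<^sup>2))) / of_real (sqrt (sqrt pi) ^ DIM('a))"
    unfolding c by (simp flip: integral_divide_zero)
  then show ?case using orth_inner_prod_hermite[of zs "\<lambda>_. 0"] by simp
next
  case (Suc k)
  note [measurable] = u_measurable
  define s :: real where "s = (3/2) ^ k / 2"
  have s: "s > 0" by (simp add: s_def)
  let ?f = "\<lambda>y. u y * of_real (inner_prod zs y * exp (- s * (norm y)\<^sup>2))"
  have "(LINT y|lborel. ?f y * of_real (exp (- (s / 2) * (norm y)\<^sup>2))) = 0"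
  proof (rule integral_exp_series_eq_0)
    have "integrable lborel (\<lambda>y. u y * of_real (inner_prod zs y * exp (- (s / 2) * (norm y)\<^sup>2)))"
      using s by (intro integrable_inner_prod_exp) auto
    moreover have "exp (- (s / 2) * (norm y)\<^sup>2) = exp (- s * (norm y)\<^sup>2) * exp \<bar>- (s / 2) * (norm y)\<^sup>2\<bar>" for y :: 'a
      using s by (simp add: abs_mult flip: exp_add)
    ultimately show "integrable lborel (\<lambda>y. ?f y * of_real (exp \<bar>- (s / 2) * (norm y)\<^sup>2\<bar>))"
      by (simp add: mult.assoc)
    fix n
    have "(LINT y|lborel. ?f y * of_real ((- (s / 2) * (norm y)\<^sup>2) ^ n)) =
      of_real ((- (s / 2)) ^ n) * (LINT y|lborel. ?f y * of_real (((norm y)\<^sup>2) ^ n))"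
      unfolding integral_mult_right_zero[symmetric] by (simp only: power_mult_distrib of_real_mult mult_ac)
    also have "\<dots> = 0" using orth_norm_power[OF s Suc.IH[folded s_def], of zs n] by simp
    finally show "(LINT y|lborel. ?f y * of_real ((- (s / 2) * (norm y)\<^sup>2) ^ n)) = 0" .
  qed measurable
  moreover have "exp (- ((3/2) ^ Suc k / 2) * (norm y)\<^sup>2) = exp (- s * (norm y)\<^sup>2) * exp (- (s / 2) * (norm y)\<^sup>2)" for y :: 'a
    by (simp add: s_def algebra_simps flip: exp_add)
  ultimately show ?case by (simp add: mult.assoc)
qed

text \<open>Unlike the raising of the exponent, this takes a single expansion: any Gaussian absorbs
  \<open>exp |y \<bullet> z|\<close>, by
  \<open>|y| |z| \<le> s/2 |y|^2 + |z|^2 / (2 s)\<close>.\<close>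

lemma orth_exp:
  "(LINT y|lborel. u y * of_real (exp (- ((3/2) ^ k / 2) * (norm y)\<^sup>2) * exp (y \<bullet> z))) = 0"
proof -
  note [measurable] = u_measurable
  define s :: real where "s = (3/2) ^ k / 2"
  have s: "s > 0" by (simp add: s_def)
  let ?f = "\<lambda>y. u y * of_real (exp (- s * (norm y)\<^sup>2))"
  have "(LINT y|lborel. ?f y * of_real (exp (y \<bullet> z))) = 0"
  proof (rule integral_exp_series_eq_0)
    have "integrable lborel (\<lambda>y. u y * of_real (exp (- s * (norm y)\<^sup>2) * exp \<bar>y \<bullet> z\<bar>))"
    proof (rule integrable_Lp_2_gaussian_bound[OF u, where s = "s / 2"])
      fix y
      have "\<bar>y \<bullet> z\<bar> \<le> norm y * norm z" by (rule Cauchy_Schwarz_ineq2)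
      also have "\<dots> \<le> s / 2 * (norm y)\<^sup>2 + (norm z)\<^sup>2 / (2 * s)"
      proof -
        have "2 * (s * norm y) * norm z \<le> (s * norm y)\<^sup>2 + (norm z)\<^sup>2" by (rule sum_squares_bound)
        then have "2 * (s * norm y) * norm z / (2 * s) \<le> ((s * norm y)\<^sup>2 + (norm z)\<^sup>2) / (2 * s)"
          using s by (intro divide_right_mono) auto
        then show ?thesis using s by (simp add: add_divide_distrib power_mult_distrib power2_eq_square mult_ac)
      qed
      finally have "exp (- s * (norm y)\<^sup>2) * exp \<bar>y \<bullet> z\<bar> \<le>
          exp (- s * (norm y)\<^sup>2) * exp (s / 2 * (norm y)\<^sup>2 + (norm z)\<^sup>2 / (2 * s))"
        by (intro mult_left_mono) auto
      also have "\<dots> = exp ((norm z)\<^sup>2 / (2 * s)) * exp (- (s / 2) * (norm y)\<^sup>2)"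
        by (simp add: algebra_simps flip: exp_add)
      finally show "norm (complex_of_real (exp (- s * (norm y)\<^sup>2) * exp \<bar>y \<bullet> z\<bar>)) \<le>
          exp ((norm z)\<^sup>2 / (2 * s)) * exp (- (s / 2) * (norm y)\<^sup>2)"
        by (simp add: norm_mult)
    qed (use s in auto)
    then show "integrable lborel (\<lambda>y. ?f y * of_real (exp \<bar>y \<bullet> z\<bar>))" by (simp add: mult.assoc)
    show "(LINT y|lborel. ?f y * of_real ((y \<bullet> z) ^ n)) = 0" for n
      using orth_inner_prod_exp[of "replicate n z" k] by (simp add: s_def mult_ac)
  qed measurable
  then show ?thesis by (simp add: s_def mult.assoc)
qed

text \<open>Completing the square: up to a constant, a Gaussian around \<open>z\<close> times
  \<open>gaussian\<close> is a centred one times an exponential of a linear functional. One factor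
  \<open>gaussian\<close> stays with \<open>u\<close> to make the product integrable.\<close>

lemma orth_gaussian_translate:
  "(LINT y|lborel. (u y * of_real (gaussian y)) * of_real (exp (- (((3/2) ^ k - 1) / 2) * (norm (y - z))\<^sup>2))) = 0"
proof -
  define s :: real where "s = ((3/2) ^ k - 1) / 2"
  have "gaussian y * exp (- s * (norm (y - z))\<^sup>2) =
    exp (- s * (norm z)\<^sup>2) * (exp (- ((3/2) ^ k / 2) * (norm y)\<^sup>2) * exp (y \<bullet> ((2 * s) *\<^sub>R z)))" for y :: 'a
  proof -
    have "- (norm y)\<^sup>2 / 2 + - s * (norm (y - z))\<^sup>2 =
      - s * (norm z)\<^sup>2 + (- ((3/2) ^ k / 2) * (norm y)\<^sup>2 + y \<bullet> ((2 * s) *\<^sub>R z))"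
      unfolding power2_norm_eq_inner s_def
      by (simp add: inner_diff_left inner_diff_right inner_commute field_simps)
    then show ?thesis unfolding gaussian_def by (simp only: exp_add[symmetric])
  qed
  then have "(u y * of_real (gaussian y)) * of_real (exp (- s * (norm (y - z))\<^sup>2)) =
     of_real (exp (- s * (norm z)\<^sup>2)) * (u y * of_real (exp (- ((3/2) ^ k / 2) * (norm y)\<^sup>2) * exp (y \<bullet> ((2 * s) *\<^sub>R z))))" for y
    unfolding mult.assoc of_real_mult[symmetric] by (simp only: mult.left_commute of_real_mult)
  then show ?thesis unfolding s_def[symmetric] by (simp only: integral_mult_right_zero orth_exp) simp
qed

lemma hermite_nd_complete: "AE y in lborel. u y = 0"
proof -
  note [measurable] = u_measurable
  \<comment> \<open>For \<open>k = 0\<close> the exponent in \<open>orth_gaussian_translate\<close>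
    is \<open>0\<close>; starting at \<open>Suc n\<close> makes all of them positive.\<close>
  define s :: "nat \<Rightarrow> real" where "s n = ((3/2) ^ Suc n - 1) / 2" for n
  have s: "s n > 0" for n
  proof -
    have "(1::real) < (3/2) ^ Suc n" by (rule one_less_power) auto
    then show ?thesis by (simp add: s_def)
  qed
  have "AE y in lborel. u y * of_real (gaussian y) = 0"
  proof (rule AE_eq_0_if_gaussian_averages_eq_0[where t = "\<lambda>n. 1 / sqrt (s n)"])
    show "integrable lborel (\<lambda>y. u y * of_real (gaussian y))"
      by (intro integrable_Lp_2_gauss_poly u gauss_poly.gaussian)
    have "s (Suc n) = 3 / 2 * s n + 1 / 4" for n by (simp add: s_def field_simps)
    moreover have "s 0 = 1 / 4" by (simp add: s_def)
    ultimately have "1 / 4 * real n \<le> s n" for n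
    proof (induction n)
      case (Suc n)
      then show ?case using s[of n] by simp
    qed simp
    then have "filterlim s at_top sequentially"
      by (intro filterlim_at_top_mono[OF filterlim_tendsto_pos_mult_at_top[OF tendsto_const _ filterlim_real_sequentially, of "1/4"]])
        auto
    then have "filterlim (\<lambda>n. sqrt (s n)) at_top sequentially"
      by (rule filterlim_compose[OF sqrt_at_top])
    then show "(\<lambda>n. 1 / sqrt (s n)) \<longlonglongrightarrow> 0"
      by (rule tendsto_divide_0[OF tendsto_const filterlim_at_top_imp_at_infinity])
    show "1 / sqrt (s n) > 0" for n using s[of n] by simp
    show "(LINT y|lborel. u y * of_real (gaussian y) *
        of_real (exp (- ((1 / (1 / sqrt (s n)))\<^sup>2) * (norm (y - z))\<^sup>2))) = 0" for n z
      using orth_gaussian_translate[of "Suc n" z] s[of n] by (simp add: s_def)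
    show "integrable lborel (\<lambda>w::'a. exp (- (norm w)\<^sup>2))" using integrable_exp_norm_sq[of 1] by simp
    show "(LINT w|lborel. exp (- (norm (w::'a))\<^sup>2)) > 0" using integral_exp_norm_sq_pos[of 1] by simp
  qed
  then show ?thesis by eventually_elim (simp add: gaussian_def)
qed

end

section \<open>\<open>L\<^sup>p\<close> spaces\<close>

lemma powr_add_le:
  fixes x y p :: real
  assumes "0 \<le> x" "0 \<le> y" "0 \<le> p"
  shows "(x + y) powr p \<le> 2 powr p * (x powr p + y powr p)"
proof -
  have "(x + y) powr p \<le> (2 * max x y) powr p" using assms by (intro powr_mono2) auto
  also have "\<dots> = 2 powr p * max x y powr p" using assms by (simp add: powr_mult)
  also have "\<dots> \<le> 2 powr p * (x powr p + y powr p)" by (intro mult_left_mono) (auto simp: max_def)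
  finally show ?thesis .
qed

lemma norm_add_powr_le:
  fixes a b :: complex
  assumes "0 \<le> p"
  shows "norm (a + b) powr p \<le> 2 powr p * (norm a powr p + norm b powr p)"
proof -
  have "norm (a + b) powr p \<le> (norm a + norm b) powr p"
    using assms by (intro powr_mono2 norm_triangle_ineq) auto
  also have "\<dots> \<le> 2 powr p * (norm a powr p + norm b powr p)" using assms by (intro powr_add_le) auto
  finally show ?thesis .
qed

lemma Lp_D:
  assumes "u \<in> Lp p"
  shows "u \<in> borel_measurable borel" "integrable lborel (\<lambda>x. norm (u x) powr p)"
  using assms by (simp_all add: Lp_def)

lemma Lp_I:
  assumes "u \<in> borel_measurable borel" "(\<integral>\<^sup>+x. ennreal (norm (u x) powr p) \<partial>lborel) < \<infinity>"
  shows "u \<in> Lp p"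
proof -
  note [measurable] = assms(1)
  have "integrable lborel (\<lambda>x. norm (u x) powr p)"
    by (rule integrableI_nonneg) (use assms(2) in auto)
  then show ?thesis using assms(1) by (simp add: Lp_def)
qed

lemma Lp_add:
  assumes p: "0 \<le> p" and u: "u \<in> Lp p" and v: "v \<in> Lp p"
  shows "(\<lambda>x. u x + v x) \<in> Lp p"
proof -
  note [measurable] = Lp_D(1)[OF u] Lp_D(1)[OF v]
  have "integrable lborel (\<lambda>x. norm (u x + v x) powr p)"
  proof (rule Bochner_Integration.integrable_bound)
    show "integrable lborel (\<lambda>x. 2 powr p * (norm (u x) powr p + norm (v x) powr p))"
      by (intro integrable_mult_right Bochner_Integration.integrable_add Lp_D(2)[OF u] Lp_D(2)[OF v])
    show "AE x in lborel. norm (norm (u x + v x) powr p) \<le> norm (2 powr p * (norm (u x) powr p + norm (v x) powr p))"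
      using norm_add_powr_le[OF p] by (intro AE_I2) simp
  qed measurable
  then show ?thesis by (simp add: Lp_def)
qed

lemma Lp_scale:
  assumes "u \<in> Lp p"
  shows "(\<lambda>x. c * u x) \<in> Lp p"
proof -
  note [measurable] = Lp_D(1)[OF assms]
  have "norm (c * u x) powr p = norm c powr p * norm (u x) powr p" for x
    by (simp add: norm_mult powr_mult)
  then have "integrable lborel (\<lambda>x. norm (c * u x) powr p)"
    using Lp_D(2)[OF assms] by simp
  then show ?thesis by (simp add: Lp_def)
qed

lemma Lp_sum:
  assumes p: "0 < p" and u: "\<And>i. i \<in> A \<Longrightarrow> u i \<in> Lp p"
  shows "(\<lambda>x. \<Sum>i\<in>A. u i x) \<in> Lp p"
  using u
proof (induction A rule: infinite_finite_induct)
  case (insert i A)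
  have "(\<lambda>x. u i x + (\<Sum>i\<in>A. u i x)) \<in> Lp p"
    using p insert.prems by (intro Lp_add insert.IH) auto
  then show ?case using insert.hyps by simp
qed (use p in \<open>simp_all add: Lp_def\<close>)

lemma Lp_2_iff:
  "u \<in> Lp 2 \<longleftrightarrow> u \<in> borel_measurable borel \<and> integrable lborel (\<lambda>x. (norm (u x))\<^sup>2)"
proof -
  have "(\<lambda>x. norm (u x) powr 2) = (\<lambda>x. (norm (u x))\<^sup>2)" by (simp add: fun_eq_iff)
  then show ?thesis unfolding Lp_def by (simp only: mem_Collect_eq measurable_lborel2)
qed

lemma hermite_nd_Lp_2: "(\<lambda>x. complex_of_real (hermite_nd \<alpha> x)) \<in> Lp 2"
proof -
  have "(norm (complex_of_real (hermite_nd \<alpha> x)))\<^sup>2 = hermite_nd \<alpha> x * hermite_nd \<alpha> x" for x :: 'a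
    by (simp add: power2_eq_square)
  then show ?thesis
    unfolding Lp_2_iff using integrable_hermite_nd_mult[of \<alpha> \<alpha>] by simp
qed

section \<open>The spectral function on a block of eigenvalues\<close>

text \<open>Bessel's inequality for vectors indexed by \<open>K\<close>: \<open>w\<close> is what
  remains of \<open>v\<close> after projection on the conjugates of the vectors \<open>c n\<close>,
  and its square sum is the difference of the two sides.\<close>

lemma bessel_finite:
  fixes c :: "'n \<Rightarrow> 'k \<Rightarrow> complex" and v :: "'k \<Rightarrow> real"
  assumes "finite F" "finite K"
    and orth: "\<And>n m. n \<in> F \<Longrightarrow> m \<in> F \<Longrightarrow> (\<Sum>\<alpha>\<in>K. c n \<alpha> * cnj (c m \<alpha>)) = (if n = m then 1 else 0)"
  shows "(\<Sum>n\<in>F. (norm (\<Sum>\<alpha>\<in>K. c n \<alpha> * of_real (v \<alpha>)))\<^sup>2) \<le> (\<Sum>\<alpha>\<in>K. (v \<alpha>)\<^sup>2)"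
proof -
  define a where "a n = (\<Sum>\<alpha>\<in>K. c n \<alpha> * of_real (v \<alpha>))" for n
  define w where "w \<alpha> = of_real (v \<alpha>) - (\<Sum>n\<in>F. cnj (c n \<alpha>) * a n)" for \<alpha>
  have a1: "a n * z = (\<Sum>\<alpha>\<in>K. of_real (v \<alpha>) * (c n \<alpha> * z))" for n z
    unfolding a_def sum_distrib_right by (rule sum.cong) (simp_all add: mult_ac)
  have a2: "z * cnj (a n) = (\<Sum>\<alpha>\<in>K. of_real (v \<alpha>) * (cnj (c n \<alpha>) * z))" for n z
    unfolding a_def cnj_sum sum_distrib_left by (rule sum.cong) (simp_all add: mult_ac)
  have 1: "(\<Sum>\<alpha>\<in>K. of_real (v \<alpha>) * (\<Sum>n\<in>F. c n \<alpha> * cnj (a n))) = (\<Sum>n\<in>F. a n * cnj (a n))"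
    unfolding sum_distrib_left by (subst sum.swap) (rule sum.cong[OF refl], rule a1[symmetric])
  have 2: "(\<Sum>\<alpha>\<in>K. of_real (v \<alpha>) * (\<Sum>n\<in>F. cnj (c n \<alpha>) * a n)) = (\<Sum>n\<in>F. a n * cnj (a n))"
    unfolding sum_distrib_left by (subst sum.swap) (rule sum.cong[OF refl], rule a2[symmetric])
  have 3: "(\<Sum>\<alpha>\<in>K. (\<Sum>n\<in>F. cnj (c n \<alpha>) * a n) * (\<Sum>m\<in>F. c m \<alpha> * cnj (a m))) = (\<Sum>n\<in>F. a n * cnj (a n))"
  proof -
    have "(\<Sum>\<alpha>\<in>K. (\<Sum>n\<in>F. cnj (c n \<alpha>) * a n) * (\<Sum>m\<in>F. c m \<alpha> * cnj (a m)))
      = (\<Sum>\<alpha>\<in>K. \<Sum>n\<in>F. \<Sum>m\<in>F. a n * cnj (a m) * (c m \<alpha> * cnj (c n \<alpha>)))"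
      unfolding sum_product by (intro sum.cong refl) (simp add: mult_ac)
    also have "\<dots> = (\<Sum>n\<in>F. \<Sum>m\<in>F. a n * cnj (a m) * (\<Sum>\<alpha>\<in>K. c m \<alpha> * cnj (c n \<alpha>)))"
      unfolding sum_distrib_left by (subst sum.swap, rule sum.cong[OF refl], rule sum.swap)
    also have "\<dots> = (\<Sum>n\<in>F. \<Sum>m\<in>F. if n = m then a n * cnj (a m) else 0)"
      by (intro sum.cong refl) (auto simp: orth)
    also have "\<dots> = (\<Sum>n\<in>F. a n * cnj (a n))" using assms(1) by simp
    finally show ?thesis .
  qed
  have "complex_of_real (\<Sum>\<alpha>\<in>K. (norm (w \<alpha>))\<^sup>2) = (\<Sum>\<alpha>\<in>K. w \<alpha> * cnj (w \<alpha>))"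
    by (simp only: of_real_sum complex_norm_square)
  also have "\<dots> = (\<Sum>\<alpha>\<in>K. of_real (v \<alpha>) * of_real (v \<alpha>)
       - of_real (v \<alpha>) * (\<Sum>n\<in>F. c n \<alpha> * cnj (a n))
       - of_real (v \<alpha>) * (\<Sum>n\<in>F. cnj (c n \<alpha>) * a n)
       + (\<Sum>n\<in>F. cnj (c n \<alpha>) * a n) * (\<Sum>m\<in>F. c m \<alpha> * cnj (a m)))"
    by (intro sum.cong refl) (simp add: w_def cnj_sum algebra_simps)
  also have "\<dots> = (\<Sum>\<alpha>\<in>K. of_real (v \<alpha>) * of_real (v \<alpha>)) - (\<Sum>n\<in>F. a n * cnj (a n))"
    by (simp only: sum.distrib sum_subtractf 1 2 3) simp
  also have "\<dots> = complex_of_real ((\<Sum>\<alpha>\<in>K. (v \<alpha>)\<^sup>2) - (\<Sum>n\<in>F. (norm (a n))\<^sup>2))"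
    by (simp only: complex_norm_square[symmetric] of_real_sum[symmetric] of_real_diff[symmetric] of_real_mult[symmetric] power2_eq_square)
  finally have "(\<Sum>\<alpha>\<in>K. (norm (w \<alpha>))\<^sup>2) = (\<Sum>\<alpha>\<in>K. (v \<alpha>)\<^sup>2) - (\<Sum>n\<in>F. (norm (a n))\<^sup>2)"
    by (simp only: of_real_eq_iff)
  moreover have "(\<Sum>\<alpha>\<in>K. (norm (w \<alpha>))\<^sup>2) \<ge> 0" by (intro sum_nonneg) auto
  ultimately show ?thesis by (simp add: a_def)
qed

text \<open>Extensionality determines a multi-index by its values on \<open>B\<close>, so the set is
  finite and a sum over it counts each Hermite product once.\<close>

definition multi_indices :: "'a set \<Rightarrow> nat \<Rightarrow> ('a \<Rightarrow> nat) set" where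
  "multi_indices B k = {\<alpha> \<in> extensional B. sum \<alpha> B = k}"

lemma multi_indices_subset:
  assumes "finite B"
  shows "multi_indices B k \<subseteq> B \<rightarrow>\<^sub>E {..k}"
proof
  fix \<alpha> assume \<alpha>: "\<alpha> \<in> multi_indices B k"
  have "\<alpha> b \<le> sum \<alpha> B" if "b \<in> B" for b
    by (rule member_le_sum[OF that _ assms]) simp
  then show "\<alpha> \<in> B \<rightarrow>\<^sub>E {..k}" using \<alpha> by (simp add: multi_indices_def PiE_iff)
qed

lemma finite_multi_indices:
  assumes "finite B"
  shows "finite (multi_indices B k)"
proof -
  have "finite (B \<rightarrow>\<^sub>E {..k})" by (rule finite_PiE[OF assms]) simp
  then show ?thesis by (rule finite_subset[OF multi_indices_subset[OF assms]])
qed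

text \<open>The total being fixed, the value at one \<open>b\<close> is determined by the others;
  this is the \<open>- 1\<close> in the exponent.\<close>

lemma card_multi_indices_le:
  assumes "finite B" "B \<noteq> {}"
  shows "card (multi_indices B k) \<le> (k + 1) ^ (card B - 1)"
proof -
  obtain b where b: "b \<in> B" using assms by blast
  have "card (multi_indices B k) \<le> card (B - {b} \<rightarrow>\<^sub>E {..k})"
  proof (rule card_inj_on_le[where f = "\<lambda>\<alpha>. restrict \<alpha> (B - {b})"])
    show "inj_on (\<lambda>\<alpha>. restrict \<alpha> (B - {b})) (multi_indices B k)"
    proof (rule inj_onI)
      fix \<alpha> \<beta> assume a: "\<alpha> \<in> multi_indices B k" "\<beta> \<in> multi_indices B k"
        and eq: "restrict \<alpha> (B - {b}) = restrict \<beta> (B - {b})"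
      have o: "\<alpha> i = \<beta> i" if "i \<in> B - {b}" for i using fun_cong[OF eq, of i] that by simp
      have "\<alpha> b + sum \<alpha> (B - {b}) = \<beta> b + sum \<beta> (B - {b})"
        using a b assms by (simp add: multi_indices_def flip: sum.remove)
      moreover have "sum \<alpha> (B - {b}) = sum \<beta> (B - {b})" by (intro sum.cong refl o)
      ultimately have "\<alpha> b = \<beta> b" by simp
      then show "\<alpha> = \<beta>" using a o by (intro extensionalityI[of _ B]) (auto simp: multi_indices_def)
    qed
    show "(\<lambda>\<alpha>. restrict \<alpha> (B - {b})) ` multi_indices B k \<subseteq> B - {b} \<rightarrow>\<^sub>E {..k}"
    proof (intro image_subsetI)
      fix \<alpha> assume "\<alpha> \<in> multi_indices B k"
      then have "\<alpha> \<in> B \<rightarrow>\<^sub>E {..k}" using multi_indices_subset[OF assms(1)] by blast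
      then show "restrict \<alpha> (B - {b}) \<in> B - {b} \<rightarrow>\<^sub>E {..k}" by (auto simp: restrict_PiE_iff)
    qed
    show "finite (B - {b} \<rightarrow>\<^sub>E {..k})" using assms by (intro finite_PiE) auto
  qed
  also have "\<dots> = (k + 1) ^ (card B - 1)"
    using assms b by (simp add: card_PiE card_Diff_singleton)
  finally show ?thesis .
qed

text \<open>An iterated Cauchy product: the new index takes a value \<open>i\<close> and leaves
  \<open>k - i\<close> for the rest. Resetting it to \<open>undefined\<close> restores
  extensionality in the inverse map.\<close>

lemma fps_nth_prod_multi_indices:
  assumes "finite B"
  shows "fps_nth (\<Prod>b\<in>B. f b) k = (\<Sum>\<alpha>\<in>multi_indices B k. \<Prod>b\<in>B. fps_nth (f b) (\<alpha> b))"
  using assms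
proof (induction B arbitrary: k rule: finite_induct)
  case empty
  have e: "multi_indices {} k = (if k = 0 then {\<lambda>_. undefined} else {})"
    by (rule set_eqI) (simp add: multi_indices_def)
  show ?case unfolding e by simp
next
  case (insert b B)
  have "fps_nth (\<Prod>b\<in>insert b B. f b) k =
     (\<Sum>i=0..k. \<Sum>\<alpha>\<in>multi_indices B (k - i). fps_nth (f b) i * (\<Prod>b\<in>B. fps_nth (f b) (\<alpha> b)))"
    using insert by (simp add: fps_mult_nth sum_distrib_left)
  also have "\<dots> = (\<Sum>(i, \<alpha>)\<in>Sigma {0..k} (\<lambda>i. multi_indices B (k - i)). fps_nth (f b) i * (\<Prod>b\<in>B. fps_nth (f b) (\<alpha> b)))"
    using insert by (subst sum.Sigma) (auto intro: finite_multi_indices)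
  also have "\<dots> = (\<Sum>\<alpha>\<in>multi_indices (insert b B) k. \<Prod>b\<in>insert b B. fps_nth (f b) (\<alpha> b))"
  proof (rule sum.reindex_bij_witness[of _ "\<lambda>\<alpha>. (\<alpha> b, \<alpha>(b := undefined))" "\<lambda>(i, \<alpha>). \<alpha>(b := i)"])
    have upd: "sum (\<alpha>(b := i)) B = sum \<alpha> B" for \<alpha> :: "_ \<Rightarrow> nat" and i
      using insert.hyps by (intro sum.cong) auto
    fix a assume "a \<in> Sigma {0..k} (\<lambda>i. multi_indices B (k - i))"
    then obtain i \<alpha> where a: "a = (i, \<alpha>)" "i \<le> k" "\<alpha> \<in> extensional B" "sum \<alpha> B = k - i"
      by (auto simp: multi_indices_def)
    have "\<alpha>(b := undefined) = \<alpha>"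
      using a(3) insert.hyps by (intro fun_upd_idem) (simp add: extensional_def)
    then show "((case a of (i, \<alpha>) \<Rightarrow> \<alpha>(b := i)) b, (case a of (i, \<alpha>) \<Rightarrow> \<alpha>(b := i))(b := undefined)) = a"
      by (simp add: a(1))
    have "\<alpha>(b := i) \<in> extensional (insert b B)" using a(3) by (simp add: extensional_def)
    moreover have "sum (\<alpha>(b := i)) (insert b B) = k"
      unfolding sum.insert[OF insert.hyps] upd using a by simp
    ultimately show "(case a of (i, \<alpha>) \<Rightarrow> \<alpha>(b := i)) \<in> multi_indices (insert b B) k"
      unfolding a(1) multi_indices_def by simp
    have "(\<Prod>b'\<in>B. fps_nth (f b') ((\<alpha>(b := i)) b')) = (\<Prod>b\<in>B. fps_nth (f b) (\<alpha> b))"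
      using insert.hyps by (intro prod.cong) auto
    then show "(\<Prod>b'\<in>insert b B. fps_nth (f b') ((case a of (i, \<alpha>) \<Rightarrow> \<alpha>(b := i)) b')) =
      (case a of (i, \<alpha>) \<Rightarrow> fps_nth (f b) i * (\<Prod>b\<in>B. fps_nth (f b) (\<alpha> b)))"
      using insert.hyps by (simp add: a(1))
  next
    fix \<alpha> assume \<alpha>: "\<alpha> \<in> multi_indices (insert b B) k"
    show "(case (\<alpha> b, \<alpha>(b := undefined)) of (i, \<alpha>) \<Rightarrow> \<alpha>(b := i)) = \<alpha>" by simp
    have "sum (\<alpha>(b := undefined)) B = sum \<alpha> B" using insert.hyps by (intro sum.cong) auto
    then show "(\<alpha> b, \<alpha>(b := undefined)) \<in> Sigma {0..k} (\<lambda>i. multi_indices B (k - i))"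
      using \<alpha> insert.hyps by (simp add: multi_indices_def extensional_def) linarith
  qed
  finally show ?case .
qed

lemma sum_hermite_nd_sq:
  "(\<Sum>\<alpha>\<in>multi_indices Basis k. (hermite_nd \<alpha> x)\<^sup>2) = fps_nth (\<Prod>b\<in>Basis. hermite_sq (x \<bullet> b)) k"
  by (subst fps_nth_prod_multi_indices) (auto simp: hermite_nd_def hermite_sq_def prod_power_distrib)

lemma gamma_exp_nonneg: "d \<ge> 2 \<Longrightarrow> gamma_exp d \<ge> 0"
  by (simp add: gamma_exp_def)

text \<open>The spectral function of one level, uniformly in \<open>x\<close>. In dimension one the
  turning-point exponent \<open>-1/6\<close> remains; otherwise at least one factor
  \<open>S(0)\<close> is present and \<open>hermite_sq_power_bound\<close> applies.\<close>

lemma sum_hermite_nd_sq_bound: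
  "\<exists>C\<ge>0. \<forall>k. \<forall>x::'a::euclidean_space.
     (\<Sum>\<alpha>\<in>multi_indices Basis k. (hermite_nd \<alpha> x)\<^sup>2) \<le> C * (real k + 1) powr gamma_exp DIM('a)"
proof (cases "DIM('a) = 1")
  case True
  then obtain b :: 'a where b: "Basis = {b}" using card_1_singletonE by blast
  show ?thesis
    unfolding sum_hermite_nd_sq using hermite_sq_uniform
    by (intro exI[of _ 1512]) (simp add: b gamma_exp_def)
next
  case False
  moreover have "DIM('a) \<ge> 1" by (simp add: Suc_leI)
  ultimately have d: "DIM('a) \<ge> 2" by linarith
  then have "DIM('a) - 1 \<ge> 1" by simp
  from hermite_sq_power_bound[OF this] obtain C where C: "C \<ge> 0"
    "\<And>k r. r \<ge> 0 \<Longrightarrow> fps_nth (hermite_sq r * hermite_sq 0 ^ (DIM('a) - 1)) k \<le> C * (real k + 1) powr ((real (DIM('a) - 1) - 1) / 2)"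
    by blast
  have g: "(real (DIM('a) - 1) - 1) / 2 = gamma_exp DIM('a)"
    using d by (simp add: gamma_exp_def of_nat_diff field_simps)
  show ?thesis
    unfolding sum_hermite_nd_sq prod_hermite_sq[OF finite_Basis nonempty_Basis]
  proof (intro exI[of _ C] conjI allI)
    show "fps_nth (hermite_sq (sqrt (\<Sum>b\<in>Basis. (x \<bullet> b)\<^sup>2)) * hermite_sq 0 ^ (DIM('a) - 1)) k
      \<le> C * (real k + 1) powr gamma_exp DIM('a)" for x :: 'a and k
      unfolding g[symmetric] by (intro C(2)) (simp add: sum_nonneg)
  qed (rule C(1))
qed

lemma hermite_nd_restrict: "hermite_nd (restrict \<alpha> Basis) = hermite_nd \<alpha>"
  by (rule ext) (simp add: hermite_nd_def cong: prod.cong)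

lemma hermite_nd_orthonormal_complex:
  "(LINT x|lborel. complex_of_real (hermite_nd \<alpha> x) * of_real (hermite_nd \<beta> x)) =
     (if \<forall>b\<in>Basis. \<alpha> b = \<beta> b then 1 else 0)"
proof -
  have "(LINT x|lborel. complex_of_real (hermite_nd \<alpha> x) * of_real (hermite_nd \<beta> x)) =
     of_real (LINT x|lborel. hermite_nd \<alpha> x * hermite_nd \<beta> x)"
    by (simp flip: integral_complex_of_real)
  then show ?thesis by (simp add: hermite_nd_orthonormal)
qed

lemma multi_indices_eq_iff:
  "\<alpha> \<in> multi_indices B k \<Longrightarrow> \<beta> \<in> multi_indices B l \<Longrightarrow> (\<forall>b\<in>B. \<alpha> b = \<beta> b) \<longleftrightarrow> \<alpha> = \<beta>"
  unfolding multi_indices_def using extensionalityI[of \<alpha> B \<beta>] by blast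

section \<open>Arbitrary eigenbases: eigenvalues, expansions and blocks\<close>

locale oscillator_eigenbasis =
  fixes eig :: "nat \<Rightarrow> real" and \<phi> :: "nat \<Rightarrow> 'a::euclidean_space \<Rightarrow> complex"
  assumes eigenbasis: "harmonic_eigenbasis eig \<phi>"
begin

lemma phi_Lp_2: "\<phi> n \<in> Lp 2"
  using eigenbasis unfolding harmonic_eigenbasis_def L2_orthonormal_basis_def by blast

lemma phi_measurable [measurable]: "\<phi> n \<in> borel_measurable borel"
  using Lp_2_D(1)[OF phi_Lp_2] .

lemma phi_orthonormal: "(LINT x|lborel. \<phi> m x * cnj (\<phi> n x)) = (if m = n then 1 else 0)"
  using eigenbasis unfolding harmonic_eigenbasis_def L2_orthonormal_basis_def L2_inner_def by blast

lemma phi_norm: "(LINT x|lborel. (norm (\<phi> n x))\<^sup>2) = 1"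
proof -
  have "complex_of_real (LINT x|lborel. (norm (\<phi> n x))\<^sup>2) = (LINT x|lborel. \<phi> n x * cnj (\<phi> n x))"
    by (simp only: complex_norm_square[symmetric] integral_complex_of_real)
  also have "\<dots> = of_real 1" by (simp add: phi_orthonormal)
  finally show ?thesis by (simp only: of_real_eq_iff)
qed

lemma phi_orthogonal:
  "eig n \<noteq> 2 * real (\<Sum>b\<in>Basis. \<alpha> b) + real DIM('a) \<Longrightarrow> (LINT x|lborel. \<phi> n x * of_real (hermite_nd \<alpha> x)) = 0"
  by (rule harmonic_oscillator_orthogonal) (use eigenbasis in \<open>auto simp: harmonic_eigenbasis_def\<close>)

text \<open>With any other eigenvalue \<open>\<phi> n\<close> would be orthogonal to all Hermite
  products, hence zero, against its norm \<open>1\<close>.\<close>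

lemma eig_value: "\<exists>k. eig n = 2 * real k + real DIM('a)"
proof (rule ccontr)
  assume "\<not> ?thesis"
  then have "AE x in lborel. \<phi> n x = 0"
    by (intro hermite_nd_complete phi_Lp_2 phi_orthogonal) blast
  then have "(LINT x|lborel. (norm (\<phi> n x))\<^sup>2) = (LINT x|(lborel::'a measure). 0)"
    by (intro integral_cong_AE) auto
  then show False by (simp add: phi_norm)
qed

definition "coef n \<alpha> = (LINT x|lborel. \<phi> n x * of_real (hermite_nd \<alpha> x))"

text \<open>The difference is orthogonal to every Hermite product: on the level \<open>k\<close> by
  the choice of \<open>coef\<close>, off it because both contributions vanish. The sum being finite,
  completeness gives an identity almost everywhere with no limit involved.\<close>

lemma phi_expansion:
  assumes n: "eig n = 2 * real k + real DIM('a)"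
  shows "AE x in lborel. \<phi> n x = (\<Sum>\<alpha>\<in>multi_indices Basis k. coef n \<alpha> * of_real (hermite_nd \<alpha> x))"
proof -
  let ?K = "multi_indices (Basis :: 'a set) k"
  let ?S = "\<lambda>x. \<Sum>\<alpha>\<in>?K. - coef n \<alpha> * of_real (hermite_nd \<alpha> x)"
  have K: "finite ?K" by (simp add: finite_multi_indices)
  have "AE x in lborel. \<phi> n x + ?S x = 0"
  proof (rule hermite_nd_complete)
    show "(\<lambda>x. \<phi> n x + ?S x) \<in> Lp 2"
      by (intro Lp_add phi_Lp_2 Lp_sum Lp_scale hermite_nd_Lp_2) simp_all
    fix \<beta> :: "'a \<Rightarrow> nat"
    \<comment> \<open>\<open>\<beta>\<close> is arbitrary off \<open>Basis\<close>; its restriction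
      can be compared with the extensional members of \<open>?K\<close>.\<close>
    define \<beta>' where "\<beta>' = restrict \<beta> Basis"
    have h: "hermite_nd \<beta> = hermite_nd \<beta>'" by (simp add: \<beta>'_def hermite_nd_restrict)
    have i1: "integrable lborel (\<lambda>x. \<phi> n x * of_real (hermite_nd \<beta>' x))"
      by (intro integrable_Lp_2_gauss_poly phi_Lp_2 hermite_nd_in_gauss_poly)
    have i2: "integrable lborel (\<lambda>x. complex_of_real (hermite_nd \<alpha> x) * of_real (hermite_nd \<beta>' x))" for \<alpha>
      by (intro integrable_Lp_2_gauss_poly hermite_nd_Lp_2 hermite_nd_in_gauss_poly)
    have "(LINT x|lborel. (\<phi> n x + ?S x) * of_real (hermite_nd \<beta> x)) =
      (LINT x|lborel. \<phi> n x * of_real (hermite_nd \<beta>' x) +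
         (\<Sum>\<alpha>\<in>?K. - coef n \<alpha> * (of_real (hermite_nd \<alpha> x) * of_real (hermite_nd \<beta>' x))))"
      by (simp only: h distrib_right sum_distrib_right mult.assoc)
    also have "\<dots> = coef n \<beta>' + (\<Sum>\<alpha>\<in>?K. - coef n \<alpha> * (if \<forall>b\<in>Basis. \<alpha> b = \<beta>' b then 1 else 0))"
      unfolding coef_def[of n \<beta>'] hermite_nd_orthonormal_complex[symmetric]
      by (simp only: Bochner_Integration.integral_add Bochner_Integration.integral_sum integrable_mult_right
           Bochner_Integration.integrable_sum i1 i2 integral_mult_right_zero)
    also have "\<dots> = 0"
    proof (cases "\<beta>' \<in> ?K")
      case True
      have "(\<Sum>\<alpha>\<in>?K. - coef n \<alpha> * (if \<forall>b\<in>Basis. \<alpha> b = \<beta>' b then 1 else 0)) = (\<Sum>\<alpha>\<in>?K. if \<alpha> = \<beta>' then - coef n \<alpha> else 0)"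
        using True by (intro sum.cong refl) (simp add: multi_indices_eq_iff)
      then show ?thesis using True K by simp
    next
      case False
      then have "sum \<beta>' Basis \<noteq> k" by (auto simp: multi_indices_def \<beta>'_def)
      then have "real k \<noteq> real (sum \<beta>' Basis)" by (metis of_nat_eq_iff)
      then have "eig n \<noteq> 2 * real (sum \<beta>' Basis) + real DIM('a)" unfolding n by linarith
      then have "coef n \<beta>' = 0" unfolding coef_def by (rule phi_orthogonal)
      moreover have "\<not> (\<forall>b\<in>Basis. \<alpha> b = \<beta>' b)" if "\<alpha> \<in> ?K" for \<alpha>
      proof
        assume "\<forall>b\<in>Basis. \<alpha> b = \<beta>' b"
        then have "sum \<alpha> Basis = sum \<beta>' Basis" by (intro sum.cong) auto
        then show False using that \<open>sum \<beta>' Basis \<noteq> k\<close> by (simp add: multi_indices_def)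
      qed
      ultimately show ?thesis by (simp only: add_0) (intro sum.neutral, fastforce)
    qed
    finally show "(LINT x|lborel. (\<phi> n x + ?S x) * of_real (hermite_nd \<beta> x)) = 0" .
  qed
  then show ?thesis by eventually_elim (simp add: sum_negf)
qed

text \<open>Only \<open>\<phi> m\<close> is expanded; the integrals of \<open>\<phi> n\<close>
  against the Hermite products are then the coefficients of \<open>\<phi> n\<close>.\<close>

lemma coef_orthonormal:
  assumes n: "eig n = 2 * real k + real DIM('a)" and m: "eig m = 2 * real k + real DIM('a)"
  shows "(\<Sum>\<alpha>\<in>multi_indices Basis k. coef n \<alpha> * cnj (coef m \<alpha>)) = (if n = m then 1 else 0)"
proof -
  let ?K = "multi_indices (Basis :: 'a set) k"
  have i1: "integrable lborel (\<lambda>x. \<phi> n x * of_real (hermite_nd \<alpha> x))" for \<alpha>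
    by (intro integrable_Lp_2_gauss_poly phi_Lp_2 hermite_nd_in_gauss_poly)
  have "(if n = m then 1 else 0) = (LINT x|lborel. \<phi> n x * cnj (\<phi> m x))"
    by (simp add: phi_orthonormal)
  also have "\<dots> = (LINT x|lborel. (\<Sum>\<alpha>\<in>?K. cnj (coef m \<alpha>) * (\<phi> n x * of_real (hermite_nd \<alpha> x))))"
  proof (rule integral_cong_AE)
    show "AE x in lborel. \<phi> n x * cnj (\<phi> m x) = (\<Sum>\<alpha>\<in>?K. cnj (coef m \<alpha>) * (\<phi> n x * of_real (hermite_nd \<alpha> x)))"
      using phi_expansion[OF m] by eventually_elim (simp add: cnj_sum sum_distrib_left mult_ac)
    have [measurable]: "(\<lambda>x. cnj (\<phi> m x)) \<in> borel_measurable borel"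
      by (rule measurable_compose[OF phi_measurable borel_measurable_continuous_onI]) (intro continuous_intros)
    show "(\<lambda>x. \<phi> n x * cnj (\<phi> m x)) \<in> borel_measurable lborel" by measurable
    show "(\<lambda>x. \<Sum>\<alpha>\<in>?K. cnj (coef m \<alpha>) * (\<phi> n x * of_real (hermite_nd \<alpha> x))) \<in> borel_measurable lborel"
      by (rule borel_measurable_integrable) (intro Bochner_Integration.integrable_sum integrable_mult_right i1)
  qed
  also have "\<dots> = (\<Sum>\<alpha>\<in>?K. cnj (coef m \<alpha>) * coef n \<alpha>)"
    unfolding coef_def[of n]
    by (simp only: Bochner_Integration.integral_sum integrable_mult_right i1 integral_mult_right_zero)
  finally show ?thesis by (simp add: mult.commute)
qed

text \<open>At almost every \<open>x\<close> the values \<open>\<phi> n x\<close> are the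
  coordinates of the vector of Hermite values along orthonormal vectors, so Bessel's inequality
  applies. Here \<open>F\<close> is any finite part of the eigenspace, whose dimension is not yet
  known to be finite.\<close>

lemma phi_sum_le:
  assumes F: "finite F" "\<And>n. n \<in> F \<Longrightarrow> eig n = 2 * real k + real DIM('a)"
  shows "AE x in lborel. (\<Sum>n\<in>F. (norm (\<phi> n x))\<^sup>2) \<le> (\<Sum>\<alpha>\<in>multi_indices Basis k. (hermite_nd \<alpha> x)\<^sup>2)"
proof -
  have "AE x in lborel. \<forall>n\<in>F. \<phi> n x = (\<Sum>\<alpha>\<in>multi_indices Basis k. coef n \<alpha> * of_real (hermite_nd \<alpha> x))"
    using F by (intro AE_finite_allI phi_expansion) auto
  then show ?thesis
  proof eventually_elim
    fix x assume "\<forall>n\<in>F. \<phi> n x = (\<Sum>\<alpha>\<in>multi_indices Basis k. coef n \<alpha> * of_real (hermite_nd \<alpha> x))"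
    then have "(\<Sum>n\<in>F. (norm (\<phi> n x))\<^sup>2) =
       (\<Sum>n\<in>F. (norm (\<Sum>\<alpha>\<in>multi_indices Basis k. coef n \<alpha> * of_real (hermite_nd \<alpha> x)))\<^sup>2)"
      by (intro sum.cong) auto
    also have "\<dots> \<le> (\<Sum>\<alpha>\<in>multi_indices Basis k. (hermite_nd \<alpha> x)\<^sup>2)"
      using F by (intro bessel_finite coef_orthonormal) (auto simp: finite_multi_indices)
    finally show "(\<Sum>n\<in>F. (norm (\<phi> n x))\<^sup>2) \<le> (\<Sum>\<alpha>\<in>multi_indices Basis k. (hermite_nd \<alpha> x)\<^sup>2)" .
  qed
qed

text \<open>Integrating \<open>phi_sum_le\<close> counts the functions on both sides, since all of
  them are normalised.\<close>

lemma card_eigenspace_le: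
  assumes F: "finite F" "\<And>n. n \<in> F \<Longrightarrow> eig n = 2 * real k + real DIM('a)"
  shows "card F \<le> (k + 1) ^ (DIM('a) - 1)"
proof -
  let ?K = "multi_indices (Basis :: 'a set) k"
  have i: "integrable lborel (\<lambda>x. (hermite_nd \<alpha> x)\<^sup>2)" for \<alpha> :: "'a \<Rightarrow> nat"
    using integrable_hermite_nd_mult[of \<alpha> \<alpha>] by (simp add: power2_eq_square)
  have "real (card F) = (\<Sum>n\<in>F. LINT x|lborel. (norm (\<phi> n x))\<^sup>2)" by (simp add: phi_norm)
  also have "\<dots> = (LINT x|lborel. (\<Sum>n\<in>F. (norm (\<phi> n x))\<^sup>2))"
    by (rule Bochner_Integration.integral_sum[symmetric]) (rule Lp_2_D[OF phi_Lp_2])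
  also have "\<dots> \<le> (LINT x|lborel. (\<Sum>\<alpha>\<in>?K. (hermite_nd \<alpha> x)\<^sup>2))"
    by (intro integral_mono_AE phi_sum_le F Bochner_Integration.integrable_sum Lp_2_D[OF phi_Lp_2] i)
  also have "\<dots> = (\<Sum>\<alpha>\<in>?K. LINT x|lborel. (hermite_nd \<alpha> x)\<^sup>2)"
    by (rule Bochner_Integration.integral_sum) (rule i)
  also have "\<dots> = (\<Sum>\<alpha>\<in>?K. 1)"
    by (intro sum.cong refl) (simp add: power2_eq_square hermite_nd_orthonormal)
  also have "\<dots> = real (card ?K)" by simp
  also have "card ?K \<le> (k + 1) ^ (DIM('a) - 1)" by (rule card_multi_indices_le) auto
  finally show ?thesis by (simp only: of_nat_le_iff)
qed

text \<open>A block has length \<open>2\<close>, the spacing of the levels, so it meets at most one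
  of them. In dimension one \<open>gamma_exp\<close> is negative and a bound in \<open>k + 1\<close>
  passes to \<open>j\<close> only if \<open>k + 1 \<ge> j\<close>, which \<open>k = j\<close>
  provides.\<close>

lemma eig_block_level:
  "\<exists>k\<le>j. (DIM('a) = 1 \<longrightarrow> k = j) \<and> (\<forall>n\<in>eig_block eig j. eig n = 2 * real k + real DIM('a))"
proof (cases "eig_block eig j = {}")
  case False
  then obtain m where m: "m \<in> eig_block eig j" by blast
  obtain k where k: "eig m = 2 * real k + real DIM('a)" using eig_value by blast
  have d: "DIM('a) \<ge> 1" by (simp add: Suc_leI)
  have bl: "2 * j \<le> 2 * l + DIM('a)" "2 * l + DIM('a) < 2 * j + 2"
    if "n \<in> eig_block eig j" "eig n = 2 * real l + real DIM('a)" for n l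
  proof -
    have "real (2 * j) \<le> real (2 * l + DIM('a))" "real (2 * l + DIM('a)) < real (2 * j + 2)"
      using that by (auto simp: eig_block_def)
    then show "2 * j \<le> 2 * l + DIM('a)" "2 * l + DIM('a) < 2 * j + 2" by (simp_all only: of_nat_le_iff of_nat_less_iff)
  qed
  show ?thesis
  proof (intro exI[of _ k] conjI ballI impI)
    show "k \<le> j" using bl[OF m k] d by linarith
    show "k = j" if "DIM('a) = 1" using bl[OF m k] that by linarith
    fix n assume n: "n \<in> eig_block eig j"
    obtain l where l: "eig n = 2 * real l + real DIM('a)" using eig_value by blast
    have "l = k" using bl[OF m k] bl[OF n l] by linarith
    then show "eig n = 2 * real k + real DIM('a)" using l by simp
  qed
qed auto

lemma finite_eig_block: "finite (eig_block eig j)"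
proof -
  obtain k where k: "\<forall>n\<in>eig_block eig j. eig n = 2 * real k + real DIM('a)"
    using eig_block_level by blast
  show ?thesis
  proof (rule conjunct1[OF finite_if_finite_subsets_card_bdd])
    fix F assume "F \<subseteq> eig_block eig j" "finite F"
    then show "card F \<le> (k + 1) ^ (DIM('a) - 1)" using k by (intro card_eigenspace_le) auto
  qed
qed

lemma eig_block_bounds:
  "\<exists>C\<ge>0. \<forall>j\<ge>1. real (card (eig_block eig j)) \<le> C * real j powr (real DIM('a) - 1) \<and>
     (AE x in lborel. (\<Sum>n\<in>eig_block eig j. (norm (\<phi> n x))\<^sup>2) \<le> C * real j powr gamma_exp DIM('a))"
proof -
  let ?d = "DIM('a)"
  have d: "?d \<ge> 1" by (simp add: Suc_leI)
  obtain C where C: "C \<ge> 0" "\<And>k x::'a. (\<Sum>\<alpha>\<in>multi_indices Basis k. (hermite_nd \<alpha> x)\<^sup>2) \<le> C * (real k + 1) powr gamma_exp ?d"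
    using sum_hermite_nd_sq_bound by blast
  \<comment> \<open>The first term serves the cardinality and the second the pointwise bound. The
    factor \<open>1 + 2 powr gamma_exp ?d\<close> covers both signs of the exponent:
    \<open>k + 1 \<le> 2 j\<close> for a nonnegative one, \<open>k + 1 \<ge> j\<close> in dimension
    one.\<close>
  define D where "D = 2 ^ (?d - 1) + C * (1 + 2 powr gamma_exp ?d)"
  have D: "D \<ge> 2 ^ (?d - 1)" "D \<ge> C * (1 + 2 powr gamma_exp ?d)" using C by (auto simp: D_def)
  have D0: "D \<ge> 0" using D(1) by (rule order_trans[rotated]) simp
  have "real (card (eig_block eig j)) \<le> D * real j powr (real ?d - 1) \<and>
     (AE x in lborel. (\<Sum>n\<in>eig_block eig j. (norm (\<phi> n x))\<^sup>2) \<le> D * real j powr gamma_exp ?d)" if j: "j \<ge> 1" for j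
  proof -
    obtain k where k: "k \<le> j" "?d = 1 \<longrightarrow> k = j" "\<forall>n\<in>eig_block eig j. eig n = 2 * real k + real ?d"
      using eig_block_level by blast
    have "real (card (eig_block eig j)) \<le> real ((k + 1) ^ (?d - 1))"
      using k(3) by (intro of_nat_mono card_eigenspace_le finite_eig_block) auto
    also have "\<dots> \<le> (2 * real j) ^ (?d - 1)"
      unfolding of_nat_power using k(1) j by (intro power_mono) auto
    also have "\<dots> = 2 ^ (?d - 1) * real j powr (real ?d - 1)"
      using j d by (simp add: power_mult_distrib of_nat_diff flip: powr_realpow)
    also have "\<dots> \<le> D * real j powr (real ?d - 1)" by (intro mult_right_mono D) auto
    finally have 1: "real (card (eig_block eig j)) \<le> D * real j powr (real ?d - 1)" .
    have pw: "(real k + 1) powr gamma_exp ?d \<le> (1 + 2 powr gamma_exp ?d) * real j powr gamma_exp ?d"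
    proof (cases "?d = 1")
      case True
      then have "(real k + 1) powr gamma_exp ?d \<le> real j powr gamma_exp ?d"
        using k(2) j by (intro powr_mono2') (auto simp: gamma_exp_def)
      also have "\<dots> \<le> (1 + 2 powr gamma_exp ?d) * real j powr gamma_exp ?d" by (simp add: distrib_right)
      finally show ?thesis .
    next
      case False
      then have "?d \<ge> 2" using d by linarith
      then have "(real k + 1) powr gamma_exp ?d \<le> (2 * real j) powr gamma_exp ?d"
        using k(1) j gamma_exp_nonneg by (intro powr_mono2) auto
      then show ?thesis by (simp add: powr_mult distrib_right add_increasing)
    qed
    have "AE x in lborel. (\<Sum>n\<in>eig_block eig j. (norm (\<phi> n x))\<^sup>2) \<le> (\<Sum>\<alpha>\<in>multi_indices Basis k. (hermite_nd \<alpha> x)\<^sup>2)"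
      using k(3) by (intro phi_sum_le finite_eig_block) auto
    then have 2: "AE x in lborel. (\<Sum>n\<in>eig_block eig j. (norm (\<phi> n x))\<^sup>2) \<le> D * real j powr gamma_exp ?d"
    proof eventually_elim
      fix x assume "(\<Sum>n\<in>eig_block eig j. (norm (\<phi> n x))\<^sup>2) \<le> (\<Sum>\<alpha>\<in>multi_indices Basis k. (hermite_nd \<alpha> x)\<^sup>2)"
      also have "\<dots> \<le> C * (real k + 1) powr gamma_exp ?d" by (rule C)
      also have "\<dots> \<le> C * ((1 + 2 powr gamma_exp ?d) * real j powr gamma_exp ?d)"
        using pw C by (intro mult_left_mono) auto
      also have "\<dots> \<le> D * real j powr gamma_exp ?d"
        unfolding mult.assoc[symmetric] by (intro mult_right_mono D) auto
      finally show "(\<Sum>n\<in>eig_block eig j. (norm (\<phi> n x))\<^sup>2) \<le> D * real j powr gamma_exp ?d" .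
    qed
    show ?thesis using 1 2 by blast
  qed
  then show ?thesis using D0 by blast
qed

end

section \<open>Moments of sums of independent random variables\<close>

lemma power_mult_le_add_power:
  fixes x y :: real
  assumes "0 \<le> x" "0 \<le> y"
  shows "x ^ i * y ^ j \<le> x ^ (i + j) + y ^ (i + j)"
proof (cases "x \<le> y")
  case True
  have "x ^ i * y ^ j \<le> y ^ i * y ^ j" using True assms by (intro mult_right_mono power_mono) auto
  also have "\<dots> \<le> x ^ (i + j) + y ^ (i + j)" using assms by (simp add: power_add)
  finally show ?thesis .
next
  case False
  have "x ^ i * y ^ j \<le> x ^ i * x ^ j" using False assms by (intro mult_left_mono power_mono) auto
  also have "\<dots> \<le> x ^ (i + j) + y ^ (i + j)" using assms by (simp add: power_add)
  finally show ?thesis .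
qed

lemma power_add_le:
  fixes x y :: real
  assumes "0 \<le> x" "0 \<le> y"
  shows "(x + y) ^ k \<le> 2 ^ k * (x ^ k + y ^ k)"
proof -
  have "(x + y) ^ k \<le> (2 * max x y) ^ k" using assms by (intro power_mono) auto
  also have "\<dots> = 2 ^ k * max x y ^ k" by (rule power_mult_distrib)
  also have "\<dots> \<le> 2 ^ k * (x ^ k + y ^ k)" using assms by (intro mult_left_mono) (auto simp: max_def)
  finally show ?thesis .
qed

text \<open>All binomial terms but the last two contain \<open>b^2\<close>; it is factored out, and
  the remaining powers of \<open>|s|\<close> and \<open>|b|\<close>, of total degree
  \<open>2 m\<close>, are separated. The linear term is kept exact because its expectation will
  vanish.\<close>

lemma even_power_add_le:
  fixes s b x :: real
  shows "(s + b * x) ^ (2 * m + 2) \<le> s ^ (2 * m + 2) + real (2 * m + 2) * b * (s ^ (2 * m + 1) * x)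
     + b\<^sup>2 * ((b\<^sup>2) ^ m + s ^ (2 * m)) * (\<Sum>i\<le>2 * m. real ((2 * m + 2) choose i) * \<bar>x\<bar> ^ (2 * m + 2 - i))"
proof -
  let ?n = "2 * m + 2"
  let ?A = "\<Sum>i\<le>2 * m. real (?n choose i) * s ^ i * (b * x) ^ (?n - i)"
  let ?P = "real ?n * b * (s ^ (2 * m + 1) * x)"
  let ?W = "\<Sum>i\<le>2 * m. real (?n choose i) * \<bar>x\<bar> ^ (?n - i)"
  have "(s + b * x) ^ ?n = (\<Sum>i\<le>?n. real (?n choose i) * s ^ i * (b * x) ^ (?n - i))"
    by (rule binomial_ring)
  also have "\<dots> = ?A + real (?n choose (2 * m + 1)) * s ^ (2 * m + 1) * (b * x) + s ^ ?n"
    by (simp add: numeral_2_eq_2)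
  finally have eq: "(s + b * x) ^ ?n = ?A + real (?n choose (2 * m + 1)) * s ^ (2 * m + 1) * (b * x) + s ^ ?n" .
  have "?n choose (2 * m + 1) = ?n"
    using binomial_symmetric[of "2 * m + 1" ?n] by simp
  then have P: "real (?n choose (2 * m + 1)) * s ^ (2 * m + 1) * (b * x) = ?P"
    by (simp only: mult_ac)
  have "?A \<le> (\<Sum>i\<le>2 * m. b\<^sup>2 * ((b\<^sup>2) ^ m + s ^ (2 * m)) * (real (?n choose i) * \<bar>x\<bar> ^ (?n - i)))"
  proof (rule sum_mono)
    fix i assume "i \<in> {..2 * m}"
    then have i: "i \<le> 2 * m" by simp
    have "\<bar>s\<bar> ^ i * \<bar>b\<bar> ^ (?n - i) = b\<^sup>2 * (\<bar>s\<bar> ^ i * \<bar>b\<bar> ^ (2 * m - i))"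
    proof -
      have "?n - i = (2 * m - i) + 2" using i by simp
      then have "\<bar>b\<bar> ^ (?n - i) = \<bar>b\<bar> ^ (2 * m - i) * b\<^sup>2" by (simp only: power_add power2_abs)
      then show ?thesis by (simp only: mult_ac)
    qed
    also have "\<dots> \<le> b\<^sup>2 * (\<bar>s\<bar> ^ (i + (2 * m - i)) + \<bar>b\<bar> ^ (i + (2 * m - i)))"
      by (intro mult_left_mono power_mult_le_add_power) auto
    also have "\<dots> = b\<^sup>2 * ((b\<^sup>2) ^ m + s ^ (2 * m))"
      using i by (simp add: power_mult)
    finally have 1: "\<bar>s\<bar> ^ i * \<bar>b\<bar> ^ (?n - i) \<le> b\<^sup>2 * ((b\<^sup>2) ^ m + s ^ (2 * m))" .
    have "real (?n choose i) * s ^ i * (b * x) ^ (?n - i) \<le> \<bar>real (?n choose i) * s ^ i * (b * x) ^ (?n - i)\<bar>"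
      by (rule abs_ge_self)
    also have "\<dots> = (real (?n choose i) * \<bar>x\<bar> ^ (?n - i)) * (\<bar>s\<bar> ^ i * \<bar>b\<bar> ^ (?n - i))"
      by (simp add: abs_mult power_abs power_mult_distrib)
    also have "\<dots> \<le> (real (?n choose i) * \<bar>x\<bar> ^ (?n - i)) * (b\<^sup>2 * ((b\<^sup>2) ^ m + s ^ (2 * m)))"
      by (intro mult_left_mono 1) auto
    finally show "real (?n choose i) * s ^ i * (b * x) ^ (?n - i) \<le>
        b\<^sup>2 * ((b\<^sup>2) ^ m + s ^ (2 * m)) * (real (?n choose i) * \<bar>x\<bar> ^ (?n - i))"
      by (simp add: mult.commute)
  qed
  then have le: "?A \<le> b\<^sup>2 * ((b\<^sup>2) ^ m + s ^ (2 * m)) * ?W"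
    unfolding sum_distrib_left .
  show ?thesis
    unfolding eq P using add_right_mono[OF le, of "s ^ ?n + ?P"] by (simp only: add_ac)
qed

text \<open>Bernoulli's inequality for a real exponent, derived from Young's inequality.\<close>

lemma powr_ge_tangent:
  fixes y q :: real
  assumes "0 \<le> y" "1 \<le> q"
  shows "1 + q * (y - 1) \<le> y powr q"
proof (cases "y = 0")
  case False
  then have y: "y > 0" using assms by simp
  have "(y powr q) powr (1 / q) * 1 powr (1 - 1 / q) \<le> 1 / q * (y powr q) + (1 - 1 / q) * 1"
    using assms y by (intro Youngs_inequality_0) auto
  moreover have "(y powr q) powr (1 / q) = y" using assms y by (simp add: powr_powr)
  ultimately have "q * y \<le> q * (1 / q * (y powr q) + (1 - 1 / q))"
    using assms by (intro mult_left_mono) auto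
  then show ?thesis using assms by (simp add: algebra_simps)
qed (use assms in simp)

text \<open>Convexity of \<open>|.|^p\<close> on the plane as a tangent bound linear in
  \<open>h\<close>. It is \<open>powr_ge_tangent\<close> with exponent \<open>p / 2\<close> at
  \<open>|s + h|^2 / |s|^2\<close>, whence \<open>p \<ge> 2\<close>.\<close>

lemma norm_powr_ge_tangent:
  fixes s h :: complex
  assumes "2 \<le> p"
  shows "norm s powr p + p * (norm s powr (p - 2) * Re (cnj s * h)) \<le> norm (s + h) powr p"
proof (cases "s = 0")
  case False
  define t where "t = (norm s)\<^sup>2"
  have t: "t > 0" using False by (simp add: t_def)
  define r where "r = Re (cnj s * h)"
  have e: "(norm (s + h))\<^sup>2 = t + 2 * r + (norm h)\<^sup>2"
    unfolding t_def r_def cmod_power2 by (simp add: power2_eq_square algebra_simps)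
  have pw: "x powr p = (x\<^sup>2) powr (p / 2)" if "x \<ge> 0" for x :: real
  proof -
    have "x\<^sup>2 = x powr 2" using that by (simp add: powr_numeral)
    then show ?thesis by (simp add: powr_powr)
  qed
  have "norm s powr p + p * (norm s powr (p - 2) * r) = t powr (p / 2) * (1 + p / 2 * (2 * r / t))"
  proof -
    have "norm s powr (p - 2) = norm s powr p / t"
      unfolding t_def using False by (simp add: powr_diff powr_numeral)
    then show ?thesis using pw[of "norm s"] t by (simp add: t_def[symmetric] field_simps)
  qed
  also have "\<dots> \<le> t powr (p / 2) * (1 + p / 2 * ((norm (s + h))\<^sup>2 / t - 1))"
  proof (intro mult_left_mono add_left_mono)
    have "2 * r / t \<le> (2 * r + (norm h)\<^sup>2) / t" using t by (intro divide_right_mono) auto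
    also have "\<dots> = (norm (s + h))\<^sup>2 / t - 1" unfolding e using t by (simp add: field_simps)
    finally show "2 * r / t \<le> (norm (s + h))\<^sup>2 / t - 1" .
  qed (use assms in auto)
  also have "\<dots> \<le> t powr (p / 2) * ((norm (s + h))\<^sup>2 / t) powr (p / 2)"
    using assms t by (intro mult_left_mono powr_ge_tangent) auto
  also have "\<dots> = norm (s + h) powr p"
    using t by (simp add: pw powr_divide)
  finally show ?thesis by (simp add: r_def)
qed simp

text \<open>Identical distribution enters the estimates only through the common absolute moments
  \<open>mom\<close>, which make the constants independent of \<open>n\<close>.\<close>

locale centered_sequence = prob_space M for M :: "'w measure" +
  fixes X :: "nat \<Rightarrow> 'w \<Rightarrow> real" and mom :: "nat \<Rightarrow> real"
  assumes indep: "indep_vars (\<lambda>_. borel) X UNIV"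
    and mean: "\<And>n. expectation (X n) = 0"
    and moment_integrable: "\<And>n k. integrable M (\<lambda>\<omega>. \<bar>X n \<omega>\<bar> ^ k)"
    and moment: "\<And>n k. expectation (\<lambda>\<omega>. \<bar>X n \<omega>\<bar> ^ k) = mom k"
begin

lemma X_measurable [measurable]: "X n \<in> borel_measurable M"
  using indep unfolding indep_vars_def2 by simp

lemma X_integrable: "integrable M (X n)"
  using moment_integrable[of n 1] integrable_abs_cancel[OF _ X_measurable, of n] by simp

text \<open>The history before time \<open>n\<close> as a point of a product space: functions of it
  are independent of \<open>X n\<close>, and events of the past are measurable sets there.\<close>

definition past :: "nat \<Rightarrow> 'w \<Rightarrow> nat \<Rightarrow> real" where
  "past n \<omega> = restrict (\<lambda>i. X i \<omega>) {..<n}"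

lemma past_measurable [measurable]: "past n \<in> M \<rightarrow>\<^sub>M PiM {..<n} (\<lambda>_. borel)"
  unfolding past_def[abs_def] by measurable

lemma
  fixes f :: "(nat \<Rightarrow> real) \<Rightarrow> real" and g :: "real \<Rightarrow> real"
  assumes f: "f \<in> borel_measurable (PiM {..<n} (\<lambda>_. borel))" and g: "g \<in> borel_measurable borel"
    and fi: "integrable M (\<lambda>\<omega>. f (past n \<omega>))" and gi: "integrable M (\<lambda>\<omega>. g (X n \<omega>))"
  shows expectation_past_mult: "expectation (\<lambda>\<omega>. f (past n \<omega>) * g (X n \<omega>)) =
      expectation (\<lambda>\<omega>. f (past n \<omega>)) * expectation (\<lambda>\<omega>. g (X n \<omega>))"
    and integrable_past_mult: "integrable M (\<lambda>\<omega>. f (past n \<omega>) * g (X n \<omega>))"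
proof -
  have "indep_var (PiM {..<n} (\<lambda>_. borel)) (\<lambda>\<omega>. restrict (\<lambda>i. X i \<omega>) {..<n})
      (PiM {n} (\<lambda>_. borel)) (\<lambda>\<omega>. restrict (\<lambda>i. X i \<omega>) {n})"
    by (rule indep_var_restrict[OF indep]) auto
  moreover have "(\<lambda>x. g (x n)) \<in> borel_measurable (PiM {n} (\<lambda>_. borel))" using g by measurable
  ultimately have "indep_var borel (f \<circ> (\<lambda>\<omega>. restrict (\<lambda>i. X i \<omega>) {..<n})) borel ((\<lambda>x. g (x n)) \<circ> (\<lambda>\<omega>. restrict (\<lambda>i. X i \<omega>) {n}))"
    using f by (intro indep_var_compose)
  then have iv: "indep_var borel (\<lambda>\<omega>. f (past n \<omega>)) borel (\<lambda>\<omega>. g (X n \<omega>))"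
    by (simp add: comp_def past_def)
  show "expectation (\<lambda>\<omega>. f (past n \<omega>) * g (X n \<omega>)) =
      expectation (\<lambda>\<omega>. f (past n \<omega>)) * expectation (\<lambda>\<omega>. g (X n \<omega>))"
    by (rule indep_var_lebesgue_integral[OF iv fi gi])
  show "integrable M (\<lambda>\<omega>. f (past n \<omega>) * g (X n \<omega>))"
    by (rule indep_var_integrable[OF iv fi gi])
qed

lemma
  fixes f :: "(nat \<Rightarrow> real) \<Rightarrow> real"
  assumes f: "f \<in> borel_measurable (PiM {..<n} (\<lambda>_. borel))" and fi: "integrable M (\<lambda>\<omega>. f (past n \<omega>))"
  shows expectation_past_mult_X: "expectation (\<lambda>\<omega>. f (past n \<omega>) * X n \<omega>) = 0"
    and integrable_past_mult_X: "integrable M (\<lambda>\<omega>. f (past n \<omega>) * X n \<omega>)"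
proof -
  have id: "(\<lambda>x::real. x) \<in> borel_measurable borel" by simp
  show "expectation (\<lambda>\<omega>. f (past n \<omega>) * X n \<omega>) = 0"
    by (subst expectation_past_mult[OF f id fi X_integrable]) (simp only: mean mult_zero_right)
  show "integrable M (\<lambda>\<omega>. f (past n \<omega>) * X n \<omega>)"
    by (rule integrable_past_mult[OF f id fi X_integrable])
qed

definition psum :: "(nat \<Rightarrow> real) \<Rightarrow> nat \<Rightarrow> 'w \<Rightarrow> real" where
  "psum a N \<omega> = (\<Sum>n<N. a n * X n \<omega>)"

lemma psum_measurable [measurable]: "psum a N \<in> borel_measurable M"
  unfolding psum_def[abs_def] by measurable

lemma psum_past: "psum a N \<omega> = (\<Sum>n<N. a n * past N \<omega> n)"
  by (simp add: psum_def past_def)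

lemma psum_power_integrable: "integrable M (\<lambda>\<omega>. \<bar>psum a N \<omega>\<bar> ^ k)"
proof (induction N)
  case 0
  then show ?case by (simp add: psum_def)
next
  case (Suc N)
  show ?case
  proof (rule Bochner_Integration.integrable_bound)
    show "integrable M (\<lambda>\<omega>. 2 ^ k * (\<bar>psum a N \<omega>\<bar> ^ k + \<bar>a N\<bar> ^ k * \<bar>X N \<omega>\<bar> ^ k))"
      by (intro integrable_mult_right Bochner_Integration.integrable_add Suc moment_integrable)
    have "\<bar>psum a (Suc N) \<omega>\<bar> ^ k \<le> 2 ^ k * (\<bar>psum a N \<omega>\<bar> ^ k + \<bar>a N\<bar> ^ k * \<bar>X N \<omega>\<bar> ^ k)" for \<omega>
    proof -
      have "\<bar>psum a (Suc N) \<omega>\<bar> ^ k \<le> (\<bar>psum a N \<omega>\<bar> + \<bar>a N * X N \<omega>\<bar>) ^ k"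
        by (intro power_mono) (auto simp: psum_def)
      also have "\<dots> \<le> 2 ^ k * (\<bar>psum a N \<omega>\<bar> ^ k + \<bar>a N * X N \<omega>\<bar> ^ k)" by (intro power_add_le) auto
      finally show ?thesis by (simp add: abs_mult power_mult_distrib)
    qed
    then show "AE \<omega> in M. norm (\<bar>psum a (Suc N) \<omega>\<bar> ^ k) \<le>
        norm (2 ^ k * (\<bar>psum a N \<omega>\<bar> ^ k + \<bar>a N\<bar> ^ k * \<bar>X N \<omega>\<bar> ^ k))"
      by (intro AE_I2) (auto intro: order_trans[OF _ abs_ge_self])
  qed measurable
qed

lemma psum_power_integrable': "integrable M (\<lambda>\<omega>. psum a N \<omega> ^ k)"
proof (rule integrable_abs_cancel)
  show "integrable M (\<lambda>\<omega>. \<bar>psum a N \<omega> ^ k\<bar>)" unfolding power_abs by (rule psum_power_integrable)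
qed measurable

text \<open>
  The linear term of \<open>E (S + bX)\<^sup>2\<^sup>m\<close> vanishes, and the others are at most a constant times
  \<open>b\<^sup>2 \<tau>\<^sup>m\<^sup>-\<^sup>1\<close>, which is bounded by the increment of \<open>\<tau>\<^sup>m\<close>, where \<open>\<tau>\<close> is the sum of the squared coefficients.
\<close>

lemma psum_even_moment:
  "\<exists>K\<ge>0. \<forall>a N. expectation (\<lambda>\<omega>. psum a N \<omega> ^ (2 * m)) \<le> K * (\<Sum>n<N. (a n)\<^sup>2) ^ m"
proof (induction m)
  case 0
  show ?case by (intro exI[of _ 1]) (simp add: prob_space)
next
  case (Suc m)
  then obtain K0 where K0: "K0 \<ge> 0" "\<And>a N. expectation (\<lambda>\<omega>. psum a N \<omega> ^ (2 * m)) \<le> K0 * (\<Sum>n<N. (a n)\<^sup>2) ^ m"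
    by blast
  define W where "W x = (\<Sum>i\<le>2 * m. real ((2 * m + 2) choose i) * \<bar>x\<bar> ^ (2 * m + 2 - i))" for x :: real
  define EW where "EW = (\<Sum>i\<le>2 * m. real ((2 * m + 2) choose i) * mom (2 * m + 2 - i))"
  have Wi: "integrable M (\<lambda>\<omega>. W (X n \<omega>))" for n
    unfolding W_def by (intro Bochner_Integration.integrable_sum integrable_mult_right moment_integrable)
  have WE: "expectation (\<lambda>\<omega>. W (X n \<omega>)) = EW" for n
    unfolding W_def EW_def
    by (simp add: Bochner_Integration.integral_sum integrable_mult_right moment_integrable moment)
  have [measurable]: "W \<in> borel_measurable borel" unfolding W_def[abs_def] by measurable
  have EW: "EW \<ge> 0" unfolding WE[of 0, symmetric] by (intro integral_nonneg_AE AE_I2) (auto simp: W_def intro!: sum_nonneg)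
  define K where "K = (1 + K0) * EW"
  have K: "K \<ge> 0" using K0 EW by (simp add: K_def)
  have "expectation (\<lambda>\<omega>. psum a N \<omega> ^ (2 * Suc m)) \<le> K * (\<Sum>n<N. (a n)\<^sup>2) ^ Suc m" for a N
  proof (induction N)
    case 0
    then show ?case by (simp add: psum_def)
  next
    case (Suc N)
    define \<tau> where "\<tau> = (\<Sum>n<N. (a n)\<^sup>2)"
    define b where "b = a N"
    have t: "\<tau> \<ge> 0" by (simp add: \<tau>_def sum_nonneg)
    let ?s = "psum a N"
    have fm: "(\<lambda>x. (\<Sum>n<N. a n * x n) ^ k) \<in> borel_measurable (PiM {..<N} (\<lambda>_. borel :: real measure))" for k
      by measurable
    note fi = psum_power_integrable'[of a N, unfolded psum_past]
    have e1: "integrable M (\<lambda>\<omega>. ?s \<omega> ^ (2 * m + 1) * X N \<omega>)"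
        "expectation (\<lambda>\<omega>. ?s \<omega> ^ (2 * m + 1) * X N \<omega>) = 0"
      unfolding psum_past
      by (rule integrable_past_mult_X[OF fm fi]) (rule expectation_past_mult_X[OF fm fi])
    have Wm: "W \<in> borel_measurable borel" by measurable
    have e2: "integrable M (\<lambda>\<omega>. ?s \<omega> ^ (2 * m) * W (X N \<omega>))"
      unfolding psum_past by (rule integrable_past_mult[OF fm Wm fi Wi])
    have e3: "expectation (\<lambda>\<omega>. ?s \<omega> ^ (2 * m) * W (X N \<omega>)) = expectation (\<lambda>\<omega>. ?s \<omega> ^ (2 * m)) * EW"
      unfolding psum_past WE[of N, symmetric] by (rule expectation_past_mult[OF fm Wm fi Wi])
    let ?R = "\<lambda>\<omega>. ?s \<omega> ^ (2 * m + 2) + real (2 * m + 2) * b * (?s \<omega> ^ (2 * m + 1) * X N \<omega>)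
        + (b\<^sup>2 * (b\<^sup>2) ^ m * W (X N \<omega>) + b\<^sup>2 * (?s \<omega> ^ (2 * m) * W (X N \<omega>)))"
    have "expectation (\<lambda>\<omega>. psum a (Suc N) \<omega> ^ (2 * Suc m)) \<le> expectation ?R"
    proof (rule integral_mono)
      show "integrable M ?R"
        by (intro Bochner_Integration.integrable_add integrable_mult_right psum_power_integrable' e1(1) e2 Wi)
      fix \<omega>
      have "psum a (Suc N) \<omega> = ?s \<omega> + b * X N \<omega>" by (simp add: psum_def b_def)
      then show "psum a (Suc N) \<omega> ^ (2 * Suc m) \<le> ?R \<omega>"
        using even_power_add_le[of "?s \<omega>" b "X N \<omega>" m] by (simp add: W_def algebra_simps)
    qed (rule psum_power_integrable')
    also have "\<dots> = expectation (\<lambda>\<omega>. ?s \<omega> ^ (2 * m + 2)) + real (2 * m + 2) * b * expectation (\<lambda>\<omega>. ?s \<omega> ^ (2 * m + 1) * X N \<omega>)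
        + (b\<^sup>2 * (b\<^sup>2) ^ m * expectation (\<lambda>\<omega>. W (X N \<omega>)) + b\<^sup>2 * expectation (\<lambda>\<omega>. ?s \<omega> ^ (2 * m) * W (X N \<omega>)))"
      by (simp only: Bochner_Integration.integral_add Bochner_Integration.integrable_add integrable_mult_right
          psum_power_integrable' e1(1) e2 Wi integral_mult_right_zero)
    also have "\<dots> = expectation (\<lambda>\<omega>. ?s \<omega> ^ (2 * Suc m)) + b\<^sup>2 * ((b\<^sup>2) ^ m + expectation (\<lambda>\<omega>. ?s \<omega> ^ (2 * m))) * EW"
      unfolding e1(2) e3 WE by (simp add: algebra_simps)
    also have "\<dots> \<le> K * \<tau> ^ Suc m + b\<^sup>2 * ((\<tau> + b\<^sup>2) ^ m + K0 * (\<tau> + b\<^sup>2) ^ m) * EW"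
    proof (intro add_mono mult_right_mono mult_left_mono EW)
      show "expectation (\<lambda>\<omega>. ?s \<omega> ^ (2 * Suc m)) \<le> K * \<tau> ^ Suc m" using Suc by (simp add: \<tau>_def)
      show "(b\<^sup>2) ^ m \<le> (\<tau> + b\<^sup>2) ^ m" using t by (intro power_mono) auto
      have "expectation (\<lambda>\<omega>. ?s \<omega> ^ (2 * m)) \<le> K0 * \<tau> ^ m" unfolding \<tau>_def by (rule K0)
      also have "\<dots> \<le> K0 * (\<tau> + b\<^sup>2) ^ m" using t K0 by (intro mult_left_mono power_mono) auto
      finally show "expectation (\<lambda>\<omega>. ?s \<omega> ^ (2 * m)) \<le> K0 * (\<tau> + b\<^sup>2) ^ m" .
    qed auto
    also have "\<dots> = K * (\<tau> * \<tau> ^ m + b\<^sup>2 * (\<tau> + b\<^sup>2) ^ m)" by (simp add: K_def algebra_simps)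
    also have "\<dots> \<le> K * (\<tau> * (\<tau> + b\<^sup>2) ^ m + b\<^sup>2 * (\<tau> + b\<^sup>2) ^ m)"
      using t K by (intro mult_left_mono add_right_mono power_mono) auto
    also have "\<dots> = K * (\<tau> + b\<^sup>2) ^ Suc m" by (simp add: algebra_simps)
    finally show ?case by (simp add: \<tau>_def b_def)
  qed
  with K show ?case by blast
qed

definition csum :: "(nat \<Rightarrow> complex) \<Rightarrow> nat \<Rightarrow> 'w \<Rightarrow> complex" where
  "csum z N \<omega> = (\<Sum>n<N. z n * of_real (X n \<omega>))"

lemma csum_measurable [measurable]: "csum z N \<in> borel_measurable M"
  unfolding csum_def[abs_def] by measurable

lemma norm_csum_power_le:
  "norm (csum z N \<omega>) ^ (2 * m) \<le>
     2 ^ m * (psum (\<lambda>n. Re (z n)) N \<omega> ^ (2 * m) + psum (\<lambda>n. Im (z n)) N \<omega> ^ (2 * m))"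
proof -
  have "norm (csum z N \<omega>) ^ (2 * m) = ((Re (csum z N \<omega>))\<^sup>2 + (Im (csum z N \<omega>))\<^sup>2) ^ m"
    by (simp only: power_mult cmod_power2)
  also have "\<dots> \<le> 2 ^ m * (((Re (csum z N \<omega>))\<^sup>2) ^ m + ((Im (csum z N \<omega>))\<^sup>2) ^ m)"
    by (intro power_add_le) auto
  also have "Re (csum z N \<omega>) = psum (\<lambda>n. Re (z n)) N \<omega>" by (simp add: csum_def psum_def)
  also have "Im (csum z N \<omega>) = psum (\<lambda>n. Im (z n)) N \<omega>" by (simp add: csum_def psum_def)
  finally show ?thesis by (simp only: power_mult)
qed

lemma csum_even_moment:
  "\<exists>K\<ge>0. \<forall>z N. integrable M (\<lambda>\<omega>. norm (csum z N \<omega>) ^ (2 * m)) \<and>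
     expectation (\<lambda>\<omega>. norm (csum z N \<omega>) ^ (2 * m)) \<le> K * (\<Sum>n<N. (norm (z n))\<^sup>2) ^ m"
proof -
  obtain K where K: "K \<ge> 0" "\<And>a N. expectation (\<lambda>\<omega>. psum a N \<omega> ^ (2 * m)) \<le> K * (\<Sum>n<N. (a n)\<^sup>2) ^ m"
    using psum_even_moment by blast
  have "integrable M (\<lambda>\<omega>. norm (csum z N \<omega>) ^ (2 * m)) \<and>
     expectation (\<lambda>\<omega>. norm (csum z N \<omega>) ^ (2 * m)) \<le> (2 ^ m * (K + K)) * (\<Sum>n<N. (norm (z n))\<^sup>2) ^ m" for z N
  proof
    let ?R = "\<lambda>\<omega>. 2 ^ m * (psum (\<lambda>n. Re (z n)) N \<omega> ^ (2 * m) + psum (\<lambda>n. Im (z n)) N \<omega> ^ (2 * m))"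
    have R: "integrable M ?R"
      by (intro integrable_mult_right Bochner_Integration.integrable_add psum_power_integrable')
    show int: "integrable M (\<lambda>\<omega>. norm (csum z N \<omega>) ^ (2 * m))"
    proof (rule Bochner_Integration.integrable_bound[OF R])
      show "AE \<omega> in M. norm (norm (csum z N \<omega>) ^ (2 * m)) \<le> norm (?R \<omega>)"
        using norm_csum_power_le[of z N _ m]
        by (intro AE_I2) (auto simp del: power_mult intro: order_trans[OF _ abs_ge_self])
    qed measurable
    have "expectation (\<lambda>\<omega>. norm (csum z N \<omega>) ^ (2 * m)) \<le> expectation ?R"
      using int R norm_csum_power_le by (rule integral_mono)
    also have "\<dots> = 2 ^ m * (expectation (\<lambda>\<omega>. psum (\<lambda>n. Re (z n)) N \<omega> ^ (2 * m)) + expectation (\<lambda>\<omega>. psum (\<lambda>n. Im (z n)) N \<omega> ^ (2 * m)))"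
      by (simp only: integral_mult_right_zero Bochner_Integration.integral_add psum_power_integrable')
    also have "\<dots> \<le> 2 ^ m * (K * (\<Sum>n<N. (norm (z n))\<^sup>2) ^ m + K * (\<Sum>n<N. (norm (z n))\<^sup>2) ^ m)"
    proof (intro mult_left_mono add_mono)
      have le: "(Re w)\<^sup>2 \<le> (norm w)\<^sup>2" "(Im w)\<^sup>2 \<le> (norm w)\<^sup>2" for w
        by (simp_all add: cmod_power2)
      show "expectation (\<lambda>\<omega>. psum (\<lambda>n. Re (z n)) N \<omega> ^ (2 * m)) \<le> K * (\<Sum>n<N. (norm (z n))\<^sup>2) ^ m"
        by (rule order_trans[OF K(2)]) (intro mult_left_mono power_mono sum_mono le sum_nonneg K, auto)
      show "expectation (\<lambda>\<omega>. psum (\<lambda>n. Im (z n)) N \<omega> ^ (2 * m)) \<le> K * (\<Sum>n<N. (norm (z n))\<^sup>2) ^ m"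
        by (rule order_trans[OF K(2)]) (intro mult_left_mono power_mono sum_mono le sum_nonneg K, auto)
    qed auto
    finally show "expectation (\<lambda>\<omega>. norm (csum z N \<omega>) ^ (2 * m)) \<le> (2 ^ m * (K + K)) * (\<Sum>n<N. (norm (z n))\<^sup>2) ^ m"
      by (simp add: algebra_simps)
  qed
  then show ?thesis using K(1) by (intro exI[of _ "2 ^ m * (K + K)"]) auto
qed

text \<open>By homogeneity the sum is first divided by \<open>sqrt \<sigma>\<close>; then
  \<open>t powr p \<le> 1 + t^(2m)\<close> brings in an even moment without disturbing the power of
  \<open>\<sigma>\<close>. For \<open>\<sigma> = 0\<close> all terms vanish.\<close>

lemma csum_moment:
  assumes p: "0 < p"
  shows "\<exists>K\<ge>0. \<forall>z N. integrable M (\<lambda>\<omega>. norm (csum z N \<omega>) powr p) \<and>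
     expectation (\<lambda>\<omega>. norm (csum z N \<omega>) powr p) \<le> K * (\<Sum>n<N. (norm (z n))\<^sup>2) powr (p / 2)"
proof -
  define m where "m = nat \<lceil>p\<rceil>"
  have m: "p \<le> real (2 * m)" using p unfolding m_def by linarith
  obtain K where K: "K \<ge> 0" "\<And>z N. integrable M (\<lambda>\<omega>. norm (csum z N \<omega>) ^ (2 * m))"
     "\<And>z N. expectation (\<lambda>\<omega>. norm (csum z N \<omega>) ^ (2 * m)) \<le> K * (\<Sum>n<N. (norm (z n))\<^sup>2) ^ m"
    using csum_even_moment[of m] by blast
  have le: "t powr p \<le> 1 + t ^ (2 * m)" if "t \<ge> 0" for t :: real
  proof (cases "t \<le> 1")
    case True
    then have "t powr p \<le> 1 powr p" using that p by (intro powr_mono2) auto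
    then show ?thesis using that by (simp add: add_increasing2)
  next
    case False
    then have "t powr p \<le> t powr real (2 * m)" using m by (intro powr_mono) auto
    also have "\<dots> = t ^ (2 * m)" using False by (subst powr_realpow) auto
    finally show ?thesis by simp
  qed
  have "integrable M (\<lambda>\<omega>. norm (csum z N \<omega>) powr p) \<and>
     expectation (\<lambda>\<omega>. norm (csum z N \<omega>) powr p) \<le> (1 + K) * (\<Sum>n<N. (norm (z n))\<^sup>2) powr (p / 2)" for z N
  proof
    show int: "integrable M (\<lambda>\<omega>. norm (csum z N \<omega>) powr p)"
    proof (rule Bochner_Integration.integrable_bound)
      show "integrable M (\<lambda>\<omega>. 1 + norm (csum z N \<omega>) ^ (2 * m))"
        by (intro Bochner_Integration.integrable_add K integrable_const)
      show "AE \<omega> in M. norm (norm (csum z N \<omega>) powr p) \<le> norm (1 + norm (csum z N \<omega>) ^ (2 * m))"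
        using le[OF norm_ge_zero] by (intro AE_I2) simp
    qed measurable
    define \<sigma> where "\<sigma> = (\<Sum>n<N. (norm (z n))\<^sup>2)"
    have s0: "\<sigma> \<ge> 0" by (simp add: \<sigma>_def sum_nonneg)
    show "expectation (\<lambda>\<omega>. norm (csum z N \<omega>) powr p) \<le> (1 + K) * (\<Sum>n<N. (norm (z n))\<^sup>2) powr (p / 2)"
    proof (cases "\<sigma> = 0")
      case True
      then have "\<forall>n<N. z n = 0" unfolding \<sigma>_def by (subst (asm) sum_nonneg_eq_0_iff) auto
      then have "csum z N \<omega> = 0" for \<omega> by (simp add: csum_def)
      then show ?thesis using K(1) by simp
    next
      case False
      then have s: "\<sigma> > 0" using s0 by simp
      have "norm (csum z N \<omega>) powr p \<le> \<sigma> powr (p / 2) * (1 + norm (csum z N \<omega>) ^ (2 * m) / \<sigma> ^ m)" for \<omega>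
      proof -
        define t where "t = norm (csum z N \<omega>) / sqrt \<sigma>"
        have t: "t \<ge> 0" using s by (simp add: t_def)
        have "norm (csum z N \<omega>) powr p = (sqrt \<sigma> * t) powr p" using s by (simp add: t_def)
        also have "\<dots> = \<sigma> powr (p / 2) * t powr p"
          using s t by (simp add: powr_mult powr_powr flip: powr_half_sqrt)
        also have "\<dots> \<le> \<sigma> powr (p / 2) * (1 + t ^ (2 * m))" by (intro mult_left_mono le t) auto
        also have "t ^ (2 * m) = norm (csum z N \<omega>) ^ (2 * m) / \<sigma> ^ m"
          using s by (simp add: t_def power_divide power_mult)
        finally show ?thesis .
      qed
      then have "expectation (\<lambda>\<omega>. norm (csum z N \<omega>) powr p) \<le>
         expectation (\<lambda>\<omega>. \<sigma> powr (p / 2) * (1 + norm (csum z N \<omega>) ^ (2 * m) / \<sigma> ^ m))"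
        by (intro integral_mono int integrable_mult_right Bochner_Integration.integrable_add integrable_const
            Bochner_Integration.integrable_divide K)
      also have "\<dots> = \<sigma> powr (p / 2) * (1 + expectation (\<lambda>\<omega>. norm (csum z N \<omega>) ^ (2 * m)) / \<sigma> ^ m)"
        using K(2)[of z N] by (simp add: prob_space)
      also have "\<dots> \<le> \<sigma> powr (p / 2) * (1 + K * \<sigma> ^ m / \<sigma> ^ m)"
        using K(3)[of z N] s by (intro mult_left_mono add_left_mono divide_right_mono) (auto simp: \<sigma>_def)
      also have "\<dots> = (1 + K) * \<sigma> powr (p / 2)" using s by simp
      finally show ?thesis by (simp add: \<sigma>_def)
    qed
  qed
  then show ?thesis using K(1) by (intro exI[of _ "1 + K"]) auto
qed

lemma csum_past: "csum z N \<omega> = (\<Sum>n<N. z n * of_real (past N \<omega> n))"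
  by (simp add: csum_def past_def)

text \<open>In the tangent bound at \<open>csum z N\<close> the linear term is a function of the
  past times \<open>X N\<close>, hence of mean zero. Restriction to events of the past stands in for
  conditional expectation, and nonnegative integrals prepare the integration over space.\<close>

lemma csum_submartingale:
  assumes p: "2 \<le> p" and B: "B \<in> sets (PiM {..<N} (\<lambda>_. borel))"
  shows "(\<integral>\<^sup>+\<omega>. ennreal (norm (csum z N \<omega>) powr p) * indicator B (past N \<omega>) \<partial>M) \<le>
         (\<integral>\<^sup>+\<omega>. ennreal (norm (csum z (Suc N) \<omega>) powr p) * indicator B (past N \<omega>) \<partial>M)"
proof -
  have int: "integrable M (\<lambda>\<omega>. norm (csum z n \<omega>) powr p)" for n
    using csum_moment[of p] p by fastforce
  have [measurable]: "B \<in> sets (PiM {..<N} (\<lambda>_. borel))" by (rule B)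
  have indB: "integrable M (\<lambda>\<omega>. norm (csum z n \<omega>) powr p * indicator B (past N \<omega>))" for n
    by (rule Bochner_Integration.integrable_bound[OF int[of n]]) (auto simp: indicator_def)
  let ?f = "\<lambda>x. p * (norm (\<Sum>n<N. z n * of_real (x n)) powr (p - 2) *
      Re (cnj (\<Sum>n<N. z n * of_real (x n)) * z N)) * indicator B x"
  have cnj_meas [measurable]: "cnj \<in> borel_measurable borel"
    by (intro borel_measurable_continuous_onI continuous_intros)
  have f_meas: "?f \<in> borel_measurable (PiM {..<N} (\<lambda>_. borel :: real measure))" by measurable
  have f_eq: "?f (past N \<omega>) = p * (norm (csum z N \<omega>) powr (p - 2) * Re (cnj (csum z N \<omega>) * z N)) * indicator B (past N \<omega>)" for \<omega>
    unfolding csum_past ..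
  have f_int: "integrable M (\<lambda>\<omega>. ?f (past N \<omega>))"
  proof (rule Bochner_Integration.integrable_bound)
    show "integrable M (\<lambda>\<omega>. p * (norm (z N) * (1 + norm (csum z N \<omega>) powr p)))"
      by (intro integrable_mult_right Bochner_Integration.integrable_add integrable_const int)
    show "(\<lambda>\<omega>. ?f (past N \<omega>)) \<in> borel_measurable M"
      using measurable_compose[OF past_measurable f_meas] .
    show "AE \<omega> in M. norm (?f (past N \<omega>)) \<le> norm (p * (norm (z N) * (1 + norm (csum z N \<omega>) powr p)))"
    proof (rule AE_I2)
      fix \<omega>
      define s where "s = csum z N \<omega>"
      have "norm s powr (p - 2) * norm s \<le> 1 + norm s powr p"
      proof (cases "norm s \<le> 1")
        case True
        have "norm s powr (p - 2) \<le> 1 powr (p - 2)" using p True by (intro powr_mono2) auto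
        then have "norm s powr (p - 2) * norm s \<le> 1 * 1" using True by (intro mult_mono) auto
        then show ?thesis by (simp add: add_increasing2)
      next
        case False
        have "norm s powr ((p - 2) + 1) = norm s powr (p - 2) * norm s powr 1" by (rule powr_add)
        then have "norm s powr (p - 2) * norm s = norm s powr (p - 1)" using False by simp
        also have "\<dots> \<le> norm s powr p" using False by (intro powr_mono) auto
        finally show ?thesis by simp
      qed
      then have "(norm s powr (p - 2) * norm s) * norm (z N) \<le> (1 + norm s powr p) * norm (z N)"
        by (rule mult_right_mono) simp
      moreover have "\<bar>Re (cnj s * z N)\<bar> \<le> norm s * norm (z N)"
        using abs_Re_le_cmod[of "cnj s * z N"] by (simp add: norm_mult)
      then have "norm s powr (p - 2) * \<bar>Re (cnj s * z N)\<bar> \<le> norm s powr (p - 2) * (norm s * norm (z N))"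
        by (rule mult_left_mono) simp
      ultimately have "norm s powr (p - 2) * \<bar>Re (cnj s * z N)\<bar> \<le> norm (z N) * (1 + norm s powr p)"
        by (simp only: mult.assoc mult.commute[of "norm (z N)"])
      then have "p * (norm s powr (p - 2) * \<bar>Re (cnj s * z N)\<bar>) \<le> p * (norm (z N) * (1 + norm s powr p))"
        by (rule mult_left_mono) (use p in simp)
      moreover have "norm (?f (past N \<omega>)) = p * (norm s powr (p - 2) * \<bar>Re (cnj s * z N)\<bar>) * indicator B (past N \<omega>)"
        unfolding f_eq s_def[symmetric] using p by (simp only: real_norm_def abs_mult) (simp add: indicator_def)
      moreover have "p * (norm s powr (p - 2) * \<bar>Re (cnj s * z N)\<bar>) * indicator B (past N \<omega>) \<le>
          p * (norm s powr (p - 2) * \<bar>Re (cnj s * z N)\<bar>)"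
        using p by (simp add: indicator_def)
      ultimately have "norm (?f (past N \<omega>)) \<le> p * (norm (z N) * (1 + norm s powr p))" by linarith
      also have "\<dots> \<le> norm (p * (norm (z N) * (1 + norm s powr p)))" unfolding real_norm_def by (rule abs_ge_self)
      finally show "norm (?f (past N \<omega>)) \<le> norm (p * (norm (z N) * (1 + norm (csum z N \<omega>) powr p)))"
        by (simp only: s_def)
    qed
  qed
  have "expectation (\<lambda>\<omega>. norm (csum z N \<omega>) powr p * indicator B (past N \<omega>)) =
      expectation (\<lambda>\<omega>. norm (csum z N \<omega>) powr p * indicator B (past N \<omega>)) + expectation (\<lambda>\<omega>. ?f (past N \<omega>) * X N \<omega>)"
    by (simp only: expectation_past_mult_X[OF f_meas f_int] add_0_right)
  also have "\<dots> = expectation (\<lambda>\<omega>. norm (csum z N \<omega>) powr p * indicator B (past N \<omega>) + ?f (past N \<omega>) * X N \<omega>)"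
    by (intro Bochner_Integration.integral_add[symmetric] indB integrable_past_mult_X[OF f_meas f_int])
  also have "\<dots> \<le> expectation (\<lambda>\<omega>. norm (csum z (Suc N) \<omega>) powr p * indicator B (past N \<omega>))"
  proof (rule integral_mono)
    show "integrable M (\<lambda>\<omega>. norm (csum z N \<omega>) powr p * indicator B (past N \<omega>) + ?f (past N \<omega>) * X N \<omega>)"
      by (intro Bochner_Integration.integrable_add indB integrable_past_mult_X[OF f_meas f_int])
    fix \<omega>
    have "csum z (Suc N) \<omega> = csum z N \<omega> + z N * of_real (X N \<omega>)" by (simp add: csum_def)
    moreover have "Re (cnj s * (w * of_real x)) = Re (cnj s * w) * x" for s w x
      by (simp add: algebra_simps)
    ultimately have "norm (csum z N \<omega>) powr p + p * (norm (csum z N \<omega>) powr (p - 2) * (Re (cnj (csum z N \<omega>) * z N) * X N \<omega>))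
       \<le> norm (csum z (Suc N) \<omega>) powr p"
      using norm_powr_ge_tangent[OF p, of "csum z N \<omega>" "z N * of_real (X N \<omega>)"] by simp
    then show "norm (csum z N \<omega>) powr p * indicator B (past N \<omega>) + ?f (past N \<omega>) * X N \<omega> \<le>
        norm (csum z (Suc N) \<omega>) powr p * indicator B (past N \<omega>)"
      unfolding f_eq by (auto simp: indicator_def mult.assoc)
  qed (rule indB)
  finally have "expectation (\<lambda>\<omega>. norm (csum z N \<omega>) powr p * indicator B (past N \<omega>)) \<le>
      expectation (\<lambda>\<omega>. norm (csum z (Suc N) \<omega>) powr p * indicator B (past N \<omega>))" .
  moreover have "(\<integral>\<^sup>+\<omega>. ennreal (norm (csum z n \<omega>) powr p) * indicator B (past N \<omega>) \<partial>M) =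
      ennreal (expectation (\<lambda>\<omega>. norm (csum z n \<omega>) powr p * indicator B (past N \<omega>)))" for n
    by (subst nn_integral_eq_integral[OF indB, symmetric])
      (auto intro!: nn_integral_cong simp: indicator_def)
  ultimately show ?thesis by (simp add: ennreal_leI)
qed

end

section \<open>A maximal inequality in \<open>L\<^sup>p\<close>\<close>

text \<open>
  Multiplication by a Gaussian reduces the existence of an almost everywhere convergent
  subsequence to the case \<open>p = 1\<close>.
\<close>

lemma Lp_Cauchy_imp_AE_subseq:
  fixes F :: "nat \<Rightarrow> 'a::euclidean_space \<Rightarrow> complex"
  assumes p: "1 \<le> p" and F: "\<And>n. F n \<in> Lp p"
    and cauchy: "\<And>e. e > 0 \<Longrightarrow> \<exists>M. \<forall>n\<ge>M. \<forall>m\<ge>M. (\<integral>\<^sup>+x. ennreal (norm (F n x - F m x) powr p) \<partial>lborel) \<le> ennreal e"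
  shows "\<exists>r. strict_mono r \<and> (AE x in lborel. Cauchy (\<lambda>i. F (r i) x))"
proof -
  note [measurable] = Lp_D(1)[OF F]
  define g where "g x = exp (- 1 * (norm x)\<^sup>2)" for x :: 'a
  have g: "integrable lborel g" unfolding g_def by (rule integrable_exp_norm_sq) simp
  have [measurable]: "g \<in> borel_measurable borel" unfolding g_def[abs_def] by measurable
  have g1: "0 < g x" "g x \<le> 1" for x by (auto simp: g_def)
  \<comment> \<open>Where \<open>norm a \<le> \<delta>\<close> the mass of the Gaussian pays,
    elsewhere the \<open>p\<close>-th power does. For the Cauchy property in \<open>L^1\<close>,
    \<open>\<delta>\<close> is fixed first and the tolerance in \<open>L^p\<close>
    afterwards.\<close>
  have young: "norm a * g x \<le> \<delta> * g x + \<delta> powr (1 - p) * norm a powr p" if "\<delta> > 0" for \<delta> x and a :: complex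
  proof (cases "norm a \<le> \<delta>")
    case True
    then have "norm a * g x \<le> \<delta> * g x" using g1[of x] by (intro mult_right_mono) auto
    then show ?thesis by (simp add: add_increasing2)
  next
    case False
    then have "norm a powr (1 - p) \<le> \<delta> powr (1 - p)" using that p by (intro powr_mono2') auto
    then have "norm a powr (1 - p) * norm a powr p \<le> \<delta> powr (1 - p) * norm a powr p" by (intro mult_right_mono) auto
    moreover have "norm a powr (1 - p) * norm a powr p = norm a" using False that by (simp flip: powr_add)
    moreover have "norm a * g x \<le> norm a * 1" using g1[of x] by (intro mult_left_mono) auto
    moreover have "0 \<le> \<delta> * g x" using that g1[of x] by simp
    ultimately show ?thesis by linarith
  qed
  define s where "s n x = F n x * of_real (g x)" for n x
  have [measurable]: "s n \<in> borel_measurable borel" for n unfolding s_def[abs_def] by measurable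
  have norm_s: "norm (s n x - s m x) = norm (F n x - F m x) * g x" for n m x
  proof -
    have "s n x - s m x = (F n x - F m x) * of_real (g x)" by (simp add: s_def algebra_simps)
    then show ?thesis using g1[of x] by (simp add: norm_mult)
  qed
  have s_int: "integrable lborel (s n)" for n
  proof (rule Bochner_Integration.integrable_bound)
    show "integrable lborel (\<lambda>x. 1 * g x + 1 powr (1 - p) * norm (F n x) powr p)"
      by (intro Bochner_Integration.integrable_add integrable_mult_right g Lp_D(2)[OF F])
    show "AE x in lborel. norm (s n x) \<le> norm (1 * g x + 1 powr (1 - p) * norm (F n x) powr p)"
      using young[of 1] g1 by (intro AE_I2) (auto simp: s_def norm_mult abs_of_pos intro: order_trans[OF _ abs_ge_self])
  qed measurable
  define G where "G = (LINT x|lborel. g x)"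
  have G: "G \<ge> 0" unfolding G_def by (intro integral_nonneg_AE AE_I2 less_imp_le g1)
  have nnG: "(\<integral>\<^sup>+x. ennreal (g x) \<partial>lborel) = ennreal G"
    unfolding G_def using g g1 by (intro nn_integral_eq_integral) (auto intro: less_imp_le)
  have s_cauchy: "\<exists>N. \<forall>i\<ge>N. \<forall>j\<ge>N. (LINT x|lborel. norm (s i x - s j x)) < e" if e: "e > 0" for e
  proof -
    define \<delta> where "\<delta> = e / (4 * (G + 1))"
    have \<delta>: "\<delta> > 0" using e G by (simp add: \<delta>_def)
    define \<eta> where "\<eta> = e / 4 / \<delta> powr (1 - p)"
    have \<eta>: "\<eta> > 0" using e \<delta> by (simp add: \<eta>_def)
    obtain M where M: "\<And>n m. n \<ge> M \<Longrightarrow> m \<ge> M \<Longrightarrow> (\<integral>\<^sup>+x. ennreal (norm (F n x - F m x) powr p) \<partial>lborel) \<le> ennreal \<eta>"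
      using cauchy[OF \<eta>] by blast
    have "(LINT x|lborel. norm (s n x - s m x)) < e" if nm: "n \<ge> M" "m \<ge> M" for n m
    proof -
      have "ennreal (LINT x|lborel. norm (s n x - s m x)) = (\<integral>\<^sup>+x. ennreal (norm (s n x - s m x)) \<partial>lborel)"
        by (intro nn_integral_eq_integral[symmetric] integrable_norm Bochner_Integration.integrable_diff s_int) auto
      also have "\<dots> \<le> (\<integral>\<^sup>+x. ennreal \<delta> * ennreal (g x) + ennreal (\<delta> powr (1 - p)) * ennreal (norm (F n x - F m x) powr p) \<partial>lborel)"
      proof (rule nn_integral_mono)
        fix x
        have "ennreal (norm (s n x - s m x)) \<le> ennreal (\<delta> * g x + \<delta> powr (1 - p) * norm (F n x - F m x) powr p)"
          unfolding norm_s using young[OF \<delta>] by (rule ennreal_leI)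
        then show "ennreal (norm (s n x - s m x)) \<le> ennreal \<delta> * ennreal (g x) + ennreal (\<delta> powr (1 - p)) * ennreal (norm (F n x - F m x) powr p)"
          using \<delta> g1[of x] by (simp add: ennreal_plus ennreal_mult less_imp_le)
      qed
      also have "\<dots> = ennreal \<delta> * ennreal G + ennreal (\<delta> powr (1 - p)) * (\<integral>\<^sup>+x. ennreal (norm (F n x - F m x) powr p) \<partial>lborel)"
        by (simp add: nn_integral_add nn_integral_cmult nnG)
      also have "\<dots> \<le> ennreal \<delta> * ennreal G + ennreal (\<delta> powr (1 - p)) * ennreal \<eta>"
        by (intro add_left_mono mult_left_mono M nm) auto
      also have "\<dots> = ennreal (\<delta> * G + \<delta> powr (1 - p) * \<eta>)"
        using \<delta> G \<eta> by (simp add: ennreal_plus ennreal_mult)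
      finally have "(LINT x|lborel. norm (s n x - s m x)) \<le> \<delta> * G + \<delta> powr (1 - p) * \<eta>"
        using \<delta> G \<eta> by (subst (asm) ennreal_le_iff) auto
      also have "\<delta> powr (1 - p) * \<eta> = e / 4" using \<delta> by (simp add: \<eta>_def)
      also have "\<delta> * G \<le> e / 4" using e G by (simp add: \<delta>_def field_simps)
      finally show ?thesis using e by linarith
    qed
    then show ?thesis by blast
  qed
  obtain r where r: "strict_mono r" "AE x in lborel. Cauchy (\<lambda>i. s (r i) x)"
    using cauchy_L1_AE_cauchy_subseq[OF s_int s_cauchy] by blast
  have "AE x in lborel. Cauchy (\<lambda>i. F (r i) x)"
    using r(2)
  proof eventually_elim
    fix x assume "Cauchy (\<lambda>i. s (r i) x)"
    then have "convergent (\<lambda>i. s (r i) x)" by (simp add: Cauchy_convergent_iff)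
    then obtain L where "(\<lambda>i. s (r i) x) \<longlonglongrightarrow> L" by (auto simp: convergent_def)
    then have "(\<lambda>i. s (r i) x / of_real (g x)) \<longlonglongrightarrow> L / of_real (g x)"
      using g1[of x] by (intro tendsto_divide tendsto_const) auto
    moreover have "s n x / of_real (g x) = F n x" for n using g1[of x] by (simp add: s_def)
    ultimately have "(\<lambda>i. F (r i) x) \<longlonglongrightarrow> L / of_real (g x)" by simp
    then show "Cauchy (\<lambda>i. F (r i) x)" by (rule LIMSEQ_imp_Cauchy)
  qed
  with r(1) show ?thesis by blast
qed

text \<open>The almost everywhere limit of the subsequence is the limit of the whole sequence, by
  Fatou's lemma applied to \<open>F n - F (r i)\<close> as \<open>i\<close> grows.\<close>

lemma Lp_convergent_if_Cauchy:
  fixes F :: "nat \<Rightarrow> 'a::euclidean_space \<Rightarrow> complex"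
  assumes p: "1 \<le> p" and F: "\<And>n. F n \<in> Lp p"
    and cauchy: "\<And>e. e > 0 \<Longrightarrow> \<exists>M. \<forall>n\<ge>M. \<forall>m\<ge>M. (\<integral>\<^sup>+x. ennreal (norm (F n x - F m x) powr p) \<partial>lborel) \<le> ennreal e"
  shows "Lp_convergent p F"
proof -
  note [measurable] = Lp_D(1)[OF F]
  obtain r where r: "strict_mono r" "AE x in lborel. Cauchy (\<lambda>i. F (r i) x)"
    using Lp_Cauchy_imp_AE_subseq[OF assms] by blast
  define f where "f x = lim (\<lambda>i. F (r i) x)" for x
  have f_meas [measurable]: "f \<in> borel_measurable borel"
    unfolding f_def[abs_def] by (rule borel_measurable_lim_metric) measurable
  have f_lim: "AE x in lborel. (\<lambda>i. F (r i) x) \<longlonglongrightarrow> f x"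
    using r(2) by eventually_elim (simp add: f_def Cauchy_convergent_iff convergent_LIMSEQ_iff)
  have dist: "\<exists>M. \<forall>n\<ge>M. (\<integral>\<^sup>+x. ennreal (norm (F n x - f x) powr p) \<partial>lborel) \<le> ennreal e" if e: "e > 0" for e
  proof -
    obtain M where M: "\<And>n m. n \<ge> M \<Longrightarrow> m \<ge> M \<Longrightarrow> (\<integral>\<^sup>+x. ennreal (norm (F n x - F m x) powr p) \<partial>lborel) \<le> ennreal e"
      using cauchy[OF e] by blast
    have "(\<integral>\<^sup>+x. ennreal (norm (F n x - f x) powr p) \<partial>lborel) \<le> ennreal e" if n: "n \<ge> M" for n
    proof -
      have "(\<integral>\<^sup>+x. ennreal (norm (F n x - f x) powr p) \<partial>lborel) =
         (\<integral>\<^sup>+x. liminf (\<lambda>i. ennreal (norm (F n x - F (r i) x) powr p)) \<partial>lborel)"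
      proof (rule nn_integral_cong_AE)
        show "AE x in lborel. ennreal (norm (F n x - f x) powr p) = liminf (\<lambda>i. ennreal (norm (F n x - F (r i) x) powr p))"
          using f_lim
        proof eventually_elim
          fix x assume "(\<lambda>i. F (r i) x) \<longlonglongrightarrow> f x"
          then have "(\<lambda>i. norm (F n x - F (r i) x) powr p) \<longlonglongrightarrow> norm (F n x - f x) powr p"
            using p by (intro tendsto_powr' tendsto_intros) auto
          then have "(\<lambda>i. ennreal (norm (F n x - F (r i) x) powr p)) \<longlonglongrightarrow> ennreal (norm (F n x - f x) powr p)"
            by (rule tendsto_ennrealI)
          then show "ennreal (norm (F n x - f x) powr p) = liminf (\<lambda>i. ennreal (norm (F n x - F (r i) x) powr p))"
            by (rule lim_imp_Liminf[OF sequentially_bot, symmetric])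
        qed
      qed
      also have "\<dots> \<le> liminf (\<lambda>i. \<integral>\<^sup>+x. ennreal (norm (F n x - F (r i) x) powr p) \<partial>lborel)"
        by (rule nn_integral_liminf) measurable
      also have "\<dots> \<le> ennreal e"
      proof (rule Liminf_le)
        have "M \<le> r i" if "M \<le> i" for i using seq_suble[OF r(1), of i] that by linarith
        then show "\<forall>\<^sub>F i in sequentially. (\<integral>\<^sup>+x. ennreal (norm (F n x - F (r i) x) powr p) \<partial>lborel) \<le> ennreal e"
          using M n by (auto simp: eventually_sequentially)
      qed simp
      finally show ?thesis .
    qed
    then show ?thesis by blast
  qed
  obtain M where M: "(\<integral>\<^sup>+x. ennreal (norm (F M x - f x) powr p) \<partial>lborel) \<le> ennreal 1"
    using dist[of 1] by auto
  have diff: "(\<lambda>x. F M x - f x) \<in> Lp p"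
    by (rule Lp_I) (use M in \<open>auto intro: le_less_trans\<close>)
  have "(\<lambda>x. F M x + (- 1) * (F M x - f x)) \<in> Lp p"
    using p by (intro Lp_add Lp_scale diff F) auto
  then have f: "f \<in> Lp p" by simp
  have fin: "(\<lambda>x. F n x - f x) \<in> Lp p" for n
  proof -
    have "(\<lambda>x. F n x + (- 1) * f x) \<in> Lp p" using p by (intro Lp_add Lp_scale f F) auto
    then show ?thesis by simp
  qed
  have "(\<lambda>n. LINT x|lborel. norm (F n x - f x) powr p) \<longlonglongrightarrow> 0"
  proof (rule LIMSEQ_I)
    fix e :: real assume e: "e > 0"
    then obtain N where N: "\<And>n. n \<ge> N \<Longrightarrow> (\<integral>\<^sup>+x. ennreal (norm (F n x - f x) powr p) \<partial>lborel) \<le> ennreal (e / 2)"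
      using dist[of "e / 2"] by auto
    have "norm ((LINT x|lborel. norm (F n x - f x) powr p) - 0) < e" if "n \<ge> N" for n
    proof -
      have nn: "0 \<le> (LINT x|lborel. norm (F n x - f x) powr p)" by (intro integral_nonneg_AE AE_I2) simp
      have "ennreal (LINT x|lborel. norm (F n x - f x) powr p) \<le> ennreal (e / 2)"
        using N[OF that] nn_integral_eq_integral[OF Lp_D(2)[OF fin]] by simp
      then have "(LINT x|lborel. norm (F n x - f x) powr p) \<le> e / 2"
        using e by (subst (asm) ennreal_le_iff) auto
      then show ?thesis using nn e by simp
    qed
    then show "\<exists>N. \<forall>n\<ge>N. norm ((LINT x|lborel. norm (F n x - f x) powr p) - 0) < e" by blast
  qed
  then have "(\<lambda>n. (LINT x|lborel. norm (F n x - f x) powr p) powr (1 / p)) \<longlonglongrightarrow> 0 powr (1 / p)"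
    using p by (intro tendsto_powr' tendsto_const) (auto intro!: always_eventually integral_nonneg_AE)
  then have "(\<lambda>n. Lp_norm p (\<lambda>x. F n x - f x)) \<longlonglongrightarrow> 0" unfolding Lp_norm_def by simp
  with F f show ?thesis unfolding Lp_convergent_def Lp_tendsto_def by blast
qed

text \<open>The \<open>p\<close>-th power of the norm of a partial sum, as a function of the sample
  values; \<open>path_energy\<close> is the same quantity along \<open>\<omega>\<close>. This form
  exhibits it as a function of the past.\<close>

definition energy :: "(nat \<Rightarrow> 'a::euclidean_space \<Rightarrow> complex) \<Rightarrow> real \<Rightarrow> nat \<Rightarrow> (nat \<Rightarrow> real) \<Rightarrow> ennreal" where
  "energy z p k x = (\<integral>\<^sup>+s. ennreal (norm (\<Sum>n<k. z n s * of_real (x n)) powr p) \<partial>lborel)"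

definition (in centered_sequence) path_energy ::
    "(nat \<Rightarrow> 'a::euclidean_space \<Rightarrow> complex) \<Rightarrow> real \<Rightarrow> nat \<Rightarrow> 'w \<Rightarrow> ennreal" where
  "path_energy z p k \<omega> = (\<integral>\<^sup>+s. ennreal (norm (csum (\<lambda>n. z n s) k \<omega>) powr p) \<partial>lborel)"

context centered_sequence
begin

context
  fixes z :: "nat \<Rightarrow> 'a::euclidean_space \<Rightarrow> complex" and p :: real
  assumes p: "2 \<le> p" and z: "\<And>n. z n \<in> borel_measurable borel"
begin

lemma energy_measurable:
  assumes "k \<le> l"
  shows "energy z p k \<in> borel_measurable (PiM {..<l} (\<lambda>_. borel))"
proof -
  note [measurable] = z
  have [measurable]: "(\<lambda>x. x n) \<in> PiM {..<l} (\<lambda>_. borel :: real measure) \<rightarrow>\<^sub>M borel" if "n \<in> {..<k}" for n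
    using that assms by (intro measurable_component_singleton) auto
  have "(\<lambda>(x, s). \<Sum>n<k. z n s * complex_of_real (x n)) \<in> borel_measurable (PiM {..<l} (\<lambda>_. borel) \<Otimes>\<^sub>M lborel)"
    unfolding case_prod_beta' by (rule borel_measurable_sum) measurable
  then have "(\<lambda>(x, s). ennreal (norm (\<Sum>n<k. z n s * complex_of_real (x n)) powr p)) \<in> borel_measurable (PiM {..<l} (\<lambda>_. borel) \<Otimes>\<^sub>M lborel)"
    unfolding case_prod_beta' by measurable
  then show ?thesis
    unfolding energy_def[abs_def] by (rule sigma_finite_measure.borel_measurable_nn_integral[OF sigma_finite_lborel])
qed

lemma path_energy_eq: "k \<le> l \<Longrightarrow> path_energy z p k \<omega> = energy z p k (past l \<omega>)"
  unfolding path_energy_def energy_def csum_def past_def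
  by (intro nn_integral_cong arg_cong[where f = "\<lambda>w. ennreal (norm w powr p)"] sum.cong) auto

lemma path_energy_measurable [measurable]: "path_energy z p k \<in> borel_measurable M"
proof -
  have "(\<lambda>\<omega>. energy z p k (past k \<omega>)) \<in> borel_measurable M"
    by (rule measurable_compose[OF past_measurable energy_measurable]) simp
  then show ?thesis unfolding path_energy_eq[OF order_refl, symmetric] .
qed

lemma integrand_measurable:
  "(\<lambda>(\<omega>, s). ennreal (norm (csum (\<lambda>n. z n s) k \<omega>) powr p)) \<in> borel_measurable (M \<Otimes>\<^sub>M lborel)"
  unfolding csum_def case_prod_beta' using z by measurable

text \<open>Tonelli's theorem with an indicator of the past carried along, so that the scalar
  submartingale property can be used at each point \<open>s\<close>.\<close>

lemma path_energy_expectation: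
  "(\<integral>\<^sup>+\<omega>. path_energy z p k \<omega> * indicator B (past l \<omega>) \<partial>M) =
     (\<integral>\<^sup>+s. (\<integral>\<^sup>+\<omega>. ennreal (norm (csum (\<lambda>n. z n s) k \<omega>) powr p) * indicator B (past l \<omega>) \<partial>M) \<partial>lborel)"
  if B: "B \<in> sets (PiM {..<l} (\<lambda>_. borel))"
proof -
  interpret pair_sigma_finite M "lborel :: 'a measure" by (intro pair_sigma_finite.intro sigma_finite_lborel) unfold_locales
  note [measurable] = B
  have [measurable]: "(\<lambda>x. ennreal (norm (csum (\<lambda>n. z n (snd x)) k (fst x)) powr p)) \<in> borel_measurable (M \<Otimes>\<^sub>M lborel)"
    using integrand_measurable[of k] by (simp add: case_prod_beta')
  have "(\<integral>\<^sup>+\<omega>. path_energy z p k \<omega> * indicator B (past l \<omega>) \<partial>M) =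
     (\<integral>\<^sup>+\<omega>. (\<integral>\<^sup>+s. ennreal (norm (csum (\<lambda>n. z n s) k \<omega>) powr p) * indicator B (past l \<omega>) \<partial>lborel) \<partial>M)"
    unfolding path_energy_def
  proof (intro nn_integral_cong nn_integral_multc[symmetric])
    fix \<omega> assume w: "\<omega> \<in> space M"
    have "(\<lambda>s. ennreal (norm (csum (\<lambda>n. z n (snd (\<omega>, s))) k (fst (\<omega>, s))) powr p)) \<in> borel_measurable lborel"
      using w by measurable
    then show "(\<lambda>s. ennreal (norm (csum (\<lambda>n. z n s) k \<omega>) powr p)) \<in> borel_measurable lborel" by simp
  qed
  also have "\<dots> = (\<integral>\<^sup>+s. (\<integral>\<^sup>+\<omega>. ennreal (norm (csum (\<lambda>n. z n s) k \<omega>) powr p) * indicator B (past l \<omega>) \<partial>M) \<partial>lborel)"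
  proof (rule Fubini'[symmetric])
    have "(\<lambda>x. ennreal (norm (csum (\<lambda>n. z n (snd x)) k (fst x)) powr p) * indicator B (past l (fst x))) \<in> borel_measurable (M \<Otimes>\<^sub>M lborel)"
      by measurable
    then show "(\<lambda>(\<omega>, s). ennreal (norm (csum (\<lambda>n. z n s) k \<omega>) powr p) * indicator B (past l \<omega>)) \<in> borel_measurable (M \<Otimes>\<^sub>M lborel)"
      by (simp add: case_prod_beta')
  qed
  finally show ?thesis .
qed

lemma path_energy_submartingale_step:
  assumes "B \<in> sets (PiM {..<k} (\<lambda>_. borel))"
  shows "(\<integral>\<^sup>+\<omega>. path_energy z p k \<omega> * indicator B (past k \<omega>) \<partial>M) \<le>
     (\<integral>\<^sup>+\<omega>. path_energy z p (Suc k) \<omega> * indicator B (past k \<omega>) \<partial>M)"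
  unfolding path_energy_expectation[OF assms]
  by (intro nn_integral_mono csum_submartingale p assms)

text \<open>Kolmogorov's inequality: decompose according to the first exceedance of the level \<open>t\<close>.\<close>

lemma path_energy_maximal:
  assumes bound: "\<And>k. (\<integral>\<^sup>+\<omega>. path_energy z p k \<omega> \<partial>M) \<le> e"
  shows "t * emeasure M {\<omega> \<in> space M. \<exists>k. t < path_energy z p k \<omega>} \<le> e"
proof -
  define A where "A k = {\<omega> \<in> space M. (\<forall>i<k. path_energy z p i \<omega> \<le> t) \<and> t < path_energy z p k \<omega>}" for k
  have A_meas [measurable]: "A k \<in> sets M" for k unfolding A_def by measurable
  have A_disj: "disjoint_family A"
    unfolding disjoint_family_on_def
  proof (intro ballI impI)
    fix i j :: nat assume "i \<noteq> j"
    then show "A i \<inter> A j = {}" unfolding A_def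
      by (cases i j rule: linorder_cases) (auto simp: not_le[symmetric])
  qed
  have A_mono: "(\<integral>\<^sup>+\<omega>. path_energy z p k \<omega> * indicator (A k) \<omega> \<partial>M) \<le> (\<integral>\<^sup>+\<omega>. path_energy z p l \<omega> * indicator (A k) \<omega> \<partial>M)"
    if "k \<le> l" for k l
    using that
  proof (induction l rule: dec_induct)
    case (step l)
    \<comment> \<open>The event \<open>A k\<close> read off from the path up to time
      \<open>l\<close>, the form in which the submartingale step accepts it.\<close>
    define B where "B = {x \<in> space (PiM {..<l} (\<lambda>_. borel)). (\<forall>i<k. energy z p i x \<le> t) \<and> t < energy z p k x}"
    have B: "B \<in> sets (PiM {..<l} (\<lambda>_. borel))"
    proof -
      let ?P = "PiM {..<l} (\<lambda>_. borel) :: (nat \<Rightarrow> real) measure"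
      have 1: "{x \<in> space ?P. energy z p i x \<le> t} \<in> sets ?P" if "i \<in> {..<k}" for i
      proof -
        have [measurable]: "energy z p i \<in> borel_measurable ?P"
          by (rule energy_measurable) (use that step.hyps in simp)
        show ?thesis by measurable
      qed
      have 2: "{x \<in> space ?P. t < energy z p k x} \<in> sets ?P"
      proof -
        have [measurable]: "energy z p k \<in> borel_measurable ?P" by (rule energy_measurable) (rule step.hyps)
        show ?thesis by measurable
      qed
      have "{x \<in> space ?P. \<forall>i\<in>{..<k}. energy z p i x \<le> t} \<inter> {x \<in> space ?P. t < energy z p k x} \<in> sets ?P"
        by (intro sets.Int sets.sets_Collect_finite_All 1 2) auto
      moreover have "B = {x \<in> space ?P. \<forall>i\<in>{..<k}. energy z p i x \<le> t} \<inter> {x \<in> space ?P. t < energy z p k x}"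
        unfolding B_def by auto
      ultimately show ?thesis by simp
    qed
    have ind: "indicator (A k) \<omega> = (indicator B (past l \<omega>) :: ennreal)" if "\<omega> \<in> space M" for \<omega>
    proof -
      have "path_energy z p i \<omega> = energy z p i (past l \<omega>)" if "i \<le> k" for i
        using that step.hyps by (intro path_energy_eq) auto
      moreover have "past l \<omega> \<in> space (PiM {..<l} (\<lambda>_. borel))" by (simp add: past_def space_PiM)
      ultimately have "\<omega> \<in> A k \<longleftrightarrow> past l \<omega> \<in> B" using that by (auto simp: A_def B_def)
      then show ?thesis by (simp add: indicator_def)
    qed
    have "(\<integral>\<^sup>+\<omega>. path_energy z p l \<omega> * indicator (A k) \<omega> \<partial>M) \<le> (\<integral>\<^sup>+\<omega>. path_energy z p (Suc l) \<omega> * indicator (A k) \<omega> \<partial>M)"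
      using path_energy_submartingale_step[OF B] by (simp add: ind cong: nn_integral_cong)
    with step.IH show ?case by (rule order_trans)
  qed simp
  have finite_bound: "t * emeasure M (\<Union>k\<le>K. A k) \<le> e" for K
  proof -
    have "t * emeasure M (\<Union>k\<le>K. A k) = (\<Sum>k\<le>K. t * emeasure M (A k))"
      using A_disj by (subst sum_emeasure[symmetric]) (auto simp: disjoint_family_on_def sum_distrib_left)
    also have "\<dots> \<le> (\<Sum>k\<le>K. \<integral>\<^sup>+\<omega>. path_energy z p K \<omega> * indicator (A k) \<omega> \<partial>M)"
    proof (rule sum_mono)
      fix k assume k: "k \<in> {..K}"
      have "t * emeasure M (A k) = (\<integral>\<^sup>+\<omega>. t * indicator (A k) \<omega> \<partial>M)" by (simp add: nn_integral_cmult)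
      also have "\<dots> \<le> (\<integral>\<^sup>+\<omega>. path_energy z p k \<omega> * indicator (A k) \<omega> \<partial>M)"
        by (intro nn_integral_mono) (auto simp: A_def indicator_def)
      also have "\<dots> \<le> (\<integral>\<^sup>+\<omega>. path_energy z p K \<omega> * indicator (A k) \<omega> \<partial>M)" using k by (intro A_mono) auto
      finally show "t * emeasure M (A k) \<le> (\<integral>\<^sup>+\<omega>. path_energy z p K \<omega> * indicator (A k) \<omega> \<partial>M)" .
    qed
    also have "\<dots> = (\<integral>\<^sup>+\<omega>. (\<Sum>k\<le>K. path_energy z p K \<omega> * indicator (A k) \<omega>) \<partial>M)"
      by (rule nn_integral_sum[symmetric]) measurable
    also have "\<dots> \<le> (\<integral>\<^sup>+\<omega>. path_energy z p K \<omega> \<partial>M)"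
    proof (rule nn_integral_mono)
      fix \<omega>
      have "(\<Sum>k\<le>K. path_energy z p K \<omega> * indicator (A k) \<omega>) = path_energy z p K \<omega> * (\<Sum>k\<le>K. indicator (A k) \<omega>)"
        by (rule sum_distrib_left[symmetric])
      also have "(\<Sum>k\<le>K. indicator (A k) \<omega>) = (indicator (\<Union>k\<le>K. A k) \<omega> :: ennreal)"
        using A_disj by (intro indicator_UN_disjoint[symmetric]) (auto simp: disjoint_family_on_def)
      also have "path_energy z p K \<omega> * indicator (\<Union>k\<le>K. A k) \<omega> \<le> path_energy z p K \<omega>"
        by (auto simp: indicator_def)
      finally show "(\<Sum>k\<le>K. path_energy z p K \<omega> * indicator (A k) \<omega>) \<le> path_energy z p K \<omega>" .
    qed
    also have "\<dots> \<le> e" by (rule bound)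
    finally show ?thesis .
  qed
  have union: "{\<omega> \<in> space M. \<exists>k. t < path_energy z p k \<omega>} = (\<Union>K. \<Union>k\<le>K. A k)"
  proof (intro equalityI subsetI)
    fix \<omega> assume w: "\<omega> \<in> {\<omega> \<in> space M. \<exists>k. t < path_energy z p k \<omega>}"
    define k where "k = (LEAST k. t < path_energy z p k \<omega>)"
    from w obtain k0 where "t < path_energy z p k0 \<omega>" by auto
    then have "t < path_energy z p k \<omega>" unfolding k_def by (rule LeastI[of "\<lambda>k. t < path_energy z p k \<omega>"])
    moreover have "path_energy z p i \<omega> \<le> t" if "i < k" for i using not_less_Least[of i "\<lambda>k. t < path_energy z p k \<omega>"] that
      unfolding k_def by (simp add: not_less)
    ultimately have "\<omega> \<in> A k" using w by (simp add: A_def)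
    then show "\<omega> \<in> (\<Union>K. \<Union>k\<le>K. A k)" by blast
  qed (auto simp: A_def)
  have "t * emeasure M (\<Union>K. \<Union>k\<le>K. A k) = (SUP K. t * emeasure M (\<Union>k\<le>K. A k))"
  proof -
    have "emeasure M (\<Union>K. \<Union>k\<le>K. A k) = (SUP K. emeasure M (\<Union>k\<le>K. A k))"
      by (intro SUP_emeasure_incseq[symmetric]) (auto simp: incseq_def intro: order_trans)
    then show ?thesis by (simp add: SUP_mult_left_ennreal)
  qed
  also have "\<dots> \<le> e" by (rule SUP_least) (rule finite_bound)
  finally show ?thesis unfolding union .
qed

end

end

section \<open>Convergence of the random series\<close>

text \<open>Jensen's inequality for the weights \<open>w j / W\<close>, proved by the tangent at the
  mean \<open>a = s / W\<close>.\<close>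

lemma weighted_powr_mean_le:
  fixes v w :: "'j \<Rightarrow> real"
  assumes "finite J" and w: "\<And>j. j \<in> J \<Longrightarrow> 0 \<le> w j" and v: "\<And>j. j \<in> J \<Longrightarrow> 0 \<le> v j" and q: "1 \<le> q"
  shows "(\<Sum>j\<in>J. w j * v j) powr q \<le> (\<Sum>j\<in>J. w j) powr (q - 1) * (\<Sum>j\<in>J. w j * v j powr q)"
proof -
  define W where "W = (\<Sum>j\<in>J. w j)"
  define s where "s = (\<Sum>j\<in>J. w j * v j)"
  have W0: "W \<ge> 0" unfolding W_def by (intro sum_nonneg w)
  have s0: "s \<ge> 0" unfolding s_def by (intro sum_nonneg mult_nonneg_nonneg w v)
  have R0: "(\<Sum>j\<in>J. w j * v j powr q) \<ge> 0" by (intro sum_nonneg mult_nonneg_nonneg w) auto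
  show ?thesis
  proof (cases "s = 0")
    case True
    then show ?thesis using R0 by (simp add: s_def[symmetric])
  next
    case False
    then have s: "s > 0" using s0 by simp
    have W: "W > 0"
    proof (rule ccontr)
      assume "\<not> W > 0"
      then have "W = 0" using W0 by simp
      then have "\<forall>j\<in>J. w j = 0" unfolding W_def using assms(1) w by (simp add: sum_nonneg_eq_0_iff)
      then show False using False by (simp add: s_def)
    qed
    define a where "a = s / W"
    have a: "a > 0" using s W by (simp add: a_def)
    have "W * a powr q = (\<Sum>j\<in>J. w j * (a powr q * (1 + q * (v j / a - 1))))"
    proof -
      have "(\<Sum>j\<in>J. w j * (a powr q * (1 + q * (v j / a - 1)))) = (\<Sum>j\<in>J. a powr q * (1 - q) * w j + a powr q * q / a * (w j * v j))"
        by (intro sum.cong refl) (simp add: algebra_simps)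
      also have "\<dots> = a powr q * (1 - q) * W + a powr q * q / a * s"
        by (simp only: sum.distrib sum_distrib_left W_def s_def)
      also have "\<dots> = a powr q * W" using W s by (simp add: a_def field_simps)
      finally show ?thesis by simp
    qed
    also have "\<dots> \<le> (\<Sum>j\<in>J. w j * v j powr q)"
    proof (intro sum_mono mult_left_mono w)
      fix j assume j: "j \<in> J"
      have "a powr q * (1 + q * (v j / a - 1)) \<le> a powr q * (v j / a) powr q"
        using a v[OF j] q by (intro mult_left_mono powr_ge_tangent) auto
      also have "\<dots> = v j powr q" using a v[OF j] by (simp add: powr_divide)
      finally show "a powr q * (1 + q * (v j / a - 1)) \<le> v j powr q" .
    qed
    finally have "W powr (q - 1) * (W * a powr q) \<le> W powr (q - 1) * (\<Sum>j\<in>J. w j * v j powr q)"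
      by (rule mult_left_mono) simp
    moreover have "W powr (q - 1) * (W * a powr q) = s powr q"
    proof -
      have "W powr (q - 1) * W = W powr q"
      proof -
        have "W powr ((q - 1) + 1) = W powr (q - 1) * W powr 1" by (rule powr_add)
        then show ?thesis using W by simp
      qed
      then have "W powr (q - 1) * (W * a powr q) = W powr q * a powr q" by (simp only: mult.assoc[symmetric])
      also have "\<dots> = (W * a) powr q" using W a by (simp add: powr_mult)
      also have "W * a = s" using W by (simp add: a_def)
      finally show ?thesis .
    qed
    ultimately show ?thesis by (simp add: s_def W_def)
  qed
qed

context oscillator_eigenbasis
begin

text \<open>Each \<open>\<phi> n\<close> is bounded by the spectral function of its level, and then
  \<open>|f|^p \<le> B^(p/2-1) |f|^2\<close>.\<close>

lemma phi_Lp: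
  assumes p: "2 \<le> p"
  shows "\<phi> n \<in> Lp p"
proof -
  obtain k where k: "eig n = 2 * real k + real DIM('a)" using eig_value by blast
  obtain C where C: "\<And>k x::'a. (\<Sum>\<alpha>\<in>multi_indices Basis k. (hermite_nd \<alpha> x)\<^sup>2) \<le> C * (real k + 1) powr gamma_exp DIM('a)"
    using sum_hermite_nd_sq_bound by blast
  define B where "B = C * (real k + 1) powr gamma_exp DIM('a)"
  have "AE x in lborel. (\<Sum>n\<in>{n}. (norm (\<phi> n x))\<^sup>2) \<le> (\<Sum>\<alpha>\<in>multi_indices Basis k. (hermite_nd \<alpha> x)\<^sup>2)"
    using k by (intro phi_sum_le) auto
  then have B: "AE x in lborel. (norm (\<phi> n x))\<^sup>2 \<le> B"
  proof eventually_elim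
    case (elim x)
    then have "(norm (\<phi> n x))\<^sup>2 \<le> (\<Sum>\<alpha>\<in>multi_indices Basis k. (hermite_nd \<alpha> x)\<^sup>2)" by simp
    from order_trans[OF this C] show ?case unfolding B_def .
  qed
  have "integrable lborel (\<lambda>x. norm (\<phi> n x) powr p)"
  proof (rule Bochner_Integration.integrable_bound)
    show "integrable lborel (\<lambda>x. B powr (p / 2 - 1) * (norm (\<phi> n x))\<^sup>2)"
      by (intro integrable_mult_right Lp_2_D[OF phi_Lp_2])
    show "AE x in lborel. norm (norm (\<phi> n x) powr p) \<le> norm (B powr (p / 2 - 1) * (norm (\<phi> n x))\<^sup>2)"
      using B
    proof eventually_elim
      fix x assume le: "(norm (\<phi> n x))\<^sup>2 \<le> B"
      have "norm (\<phi> n x) powr p \<le> B powr (p / 2 - 1) * (norm (\<phi> n x))\<^sup>2"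
      proof (cases "\<phi> n x = 0")
        case False
        define t where "t = (norm (\<phi> n x))\<^sup>2"
        have t: "t > 0" using False by (simp add: t_def)
        have "norm (\<phi> n x) powr p = (norm (\<phi> n x) powr 2) powr (p / 2)" by (simp only: powr_powr) simp
        also have "norm (\<phi> n x) powr 2 = t" by (simp add: t_def)
        also have "t powr (p / 2) = t powr ((p / 2 - 1) + 1)" by simp
        also have "\<dots> = t powr (p / 2 - 1) * t" using t by (subst powr_add) simp
        also have "\<dots> \<le> B powr (p / 2 - 1) * t"
          using t le p by (intro mult_right_mono powr_mono2) (auto simp: t_def)
        finally show ?thesis by (simp add: t_def)
      qed simp
      then show "norm (norm (\<phi> n x) powr p) \<le> norm (B powr (p / 2 - 1) * (norm (\<phi> n x))\<^sup>2)" by simp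
    qed
  qed measurable
  then show ?thesis by (simp add: Lp_def)
qed

definition block_sum :: "nat \<Rightarrow> 'a \<Rightarrow> real" where
  "block_sum j x = (\<Sum>n\<in>eig_block eig j. (norm (\<phi> n x))\<^sup>2)"

lemma block_sum_nonneg: "0 \<le> block_sum j x"
  unfolding block_sum_def by (intro sum_nonneg) auto

lemma block_sum_measurable [measurable]: "block_sum j \<in> borel_measurable borel"
  unfolding block_sum_def[abs_def] by measurable

lemma block_sum_integral: "(\<integral>\<^sup>+x. ennreal (block_sum j x) \<partial>lborel) = ennreal (real (card (eig_block eig j)))"
proof -
  have i: "integrable lborel (\<lambda>x. block_sum j x)"
    unfolding block_sum_def by (intro Bochner_Integration.integrable_sum Lp_2_D[OF phi_Lp_2])
  have "(LINT x|lborel. block_sum j x) = (\<Sum>n\<in>eig_block eig j. LINT x|lborel. (norm (\<phi> n x))\<^sup>2)"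
    unfolding block_sum_def by (rule Bochner_Integration.integral_sum) (rule Lp_2_D[OF phi_Lp_2])
  also have "\<dots> = real (card (eig_block eig j))" by (simp add: phi_norm)
  finally show ?thesis using nn_integral_eq_integral[OF i] block_sum_nonneg by simp
qed

lemma gamma_plus_beta: "gamma_exp DIM('a) + beta_exp DIM('a) = real DIM('a) - 1"
proof -
  have "DIM('a) \<ge> 1" by (simp add: Suc_leI)
  then show ?thesis by (auto simp: gamma_exp_def beta_exp_def)
qed

text \<open>Interpolation between \<open>L\<^sup>1\<close> and \<open>L\<^sup>\<infinity>\<close>.\<close>

lemma block_sum_Lq:
  "\<exists>C>0. \<forall>q\<ge>1. \<forall>j\<ge>1. (\<integral>\<^sup>+x. ennreal ((block_sum j x / real j powr (gamma_exp DIM('a) + beta_exp DIM('a) / q)) powr q) \<partial>lborel)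
     \<le> ennreal (C powr q)"
proof -
  let ?g = "gamma_exp DIM('a)" and ?b = "beta_exp DIM('a)"
  obtain C0 where C0: "C0 \<ge> 0" "\<And>j. j \<ge> 1 \<Longrightarrow> real (card (eig_block eig j)) \<le> C0 * real j powr (real DIM('a) - 1)"
     "\<And>j. j \<ge> 1 \<Longrightarrow> AE x in lborel. (\<Sum>n\<in>eig_block eig j. (norm (\<phi> n x))\<^sup>2) \<le> C0 * real j powr ?g"
    using eig_block_bounds by blast
  define C where "C = C0 + 1"
  have C: "C > 0" "C0 \<le> C" using C0(1) by (auto simp: C_def)
  have "(\<integral>\<^sup>+x. ennreal ((block_sum j x / real j powr (?g + ?b / q)) powr q) \<partial>lborel) \<le> ennreal (C powr q)"
    if q: "q \<ge> 1" and j: "j \<ge> 1" for q j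
  proof -
    define B where "B = C * real j powr ?g"
    have B: "B > 0" using C j by (simp add: B_def)
    have le: "AE x in lborel. block_sum j x \<le> B"
      using C0(3)[OF j]
    proof eventually_elim
      fix x assume "(\<Sum>n\<in>eig_block eig j. (norm (\<phi> n x))\<^sup>2) \<le> C0 * real j powr ?g"
      also have "\<dots> \<le> B" unfolding B_def using C by (intro mult_right_mono) auto
      finally show "block_sum j x \<le> B" by (simp add: block_sum_def)
    qed
    define D where "D = real j powr (?g + ?b / q)"
    have D: "D > 0" using j by (simp add: D_def)
    have Dq: "D powr q = real j powr (?g * q + ?b)" using q by (simp add: D_def powr_powr distrib_right)
    have "(\<integral>\<^sup>+x. ennreal ((block_sum j x / D) powr q) \<partial>lborel) \<le> (\<integral>\<^sup>+x. ennreal (B powr (q - 1) / D powr q) * ennreal (block_sum j x) \<partial>lborel)"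
    proof (rule nn_integral_mono_AE)
      show "AE x in lborel. ennreal ((block_sum j x / D) powr q) \<le> ennreal (B powr (q - 1) / D powr q) * ennreal (block_sum j x)"
        using le
      proof eventually_elim
        fix x assume le: "block_sum j x \<le> B"
        have "block_sum j x powr q \<le> B powr (q - 1) * block_sum j x"
        proof (cases "block_sum j x = 0")
          case False
          then have t: "block_sum j x > 0" using block_sum_nonneg[of j x] by simp
          have "block_sum j x powr ((q - 1) + 1) = block_sum j x powr (q - 1) * block_sum j x powr 1" by (rule powr_add)
          then have "block_sum j x powr q = block_sum j x powr (q - 1) * block_sum j x" using t by simp
          also have "\<dots> \<le> B powr (q - 1) * block_sum j x"
            using t le q by (intro mult_right_mono powr_mono2) auto
          finally show ?thesis .
        qed simp
        then have "(block_sum j x / D) powr q \<le> B powr (q - 1) * block_sum j x / D powr q"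
          using D block_sum_nonneg[of j x] by (simp add: powr_divide divide_right_mono)
        then have "ennreal ((block_sum j x / D) powr q) \<le> ennreal (B powr (q - 1) / D powr q * block_sum j x)"
          by (intro ennreal_leI) simp
        also have "\<dots> = ennreal (B powr (q - 1) / D powr q) * ennreal (block_sum j x)"
          by (rule ennreal_mult) (auto simp: block_sum_nonneg)
        finally show "ennreal ((block_sum j x / D) powr q) \<le> ennreal (B powr (q - 1) / D powr q) * ennreal (block_sum j x)" .
      qed
    qed
    also have "\<dots> = ennreal (B powr (q - 1) / D powr q) * ennreal (real (card (eig_block eig j)))"
      by (simp add: nn_integral_cmult block_sum_integral)
    also have "\<dots> = ennreal (B powr (q - 1) / D powr q * real (card (eig_block eig j)))"
      by (rule ennreal_mult[symmetric]) auto
    also have "\<dots> \<le> ennreal (B powr (q - 1) / D powr q * (C * real j powr (real DIM('a) - 1)))"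
    proof (intro ennreal_leI mult_left_mono)
      show "real (card (eig_block eig j)) \<le> C * real j powr (real DIM('a) - 1)"
        using C0(2)[OF j] mult_right_mono[OF C(2), of "real j powr (real DIM('a) - 1)"] by simp
    qed auto
    \<comment> \<open>The normalisation is exact: by \<open>gamma_plus_beta\<close>, the powers of
      \<open>j\<close> from the supremum and from the cardinality multiply to
      \<open>D powr q\<close>.\<close>
    also have "B powr (q - 1) / D powr q * (C * real j powr (real DIM('a) - 1)) = C powr q"
    proof -
      have "C powr (q - 1) * C powr 1 = C powr ((q - 1) + 1)" by (rule powr_add[symmetric])
      then have c: "C powr (q - 1) * C = C powr q" using C by simp
      have "real j powr (?g * (q - 1)) * real j powr (real DIM('a) - 1) = real j powr (?g * (q - 1) + (real DIM('a) - 1))"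
        by (rule powr_add[symmetric])
      also have "?g * (q - 1) + (real DIM('a) - 1) = ?g * q + ?b" using gamma_plus_beta by (simp add: algebra_simps)
      finally have d: "real j powr (?g * (q - 1)) * real j powr (real DIM('a) - 1) = D powr q" unfolding Dq .
      have "B powr (q - 1) = C powr (q - 1) * real j powr (?g * (q - 1))"
        using C j by (simp add: B_def powr_mult powr_powr)
      then have "B powr (q - 1) * (C * real j powr (real DIM('a) - 1)) =
         (C powr (q - 1) * C) * (real j powr (?g * (q - 1)) * real j powr (real DIM('a) - 1))" by (simp only: mult_ac)
      also have "\<dots> = C powr q * D powr q" unfolding c d ..
      finally show ?thesis using D by simp
    qed
    finally show ?thesis unfolding D_def .
  qed
  then show ?thesis using C(1) by blast
qed

text \<open>Minkowski's inequality in \<open>L^q\<close>, obtained from Jensen's: divided by its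
  normalisation \<open>D j\<close>, each \<open>block_sum j\<close> has norm at most
  \<open>C\<close>.\<close>

lemma weighted_block_sum_Lq:
  "\<exists>C>0. \<forall>q\<ge>1. \<forall>m J. finite J \<longrightarrow> (\<forall>j\<in>J. 1 \<le> j \<and> 0 \<le> m j) \<longrightarrow>
     (\<integral>\<^sup>+x. ennreal ((\<Sum>j\<in>J. m j * block_sum j x) powr q) \<partial>lborel) \<le>
     ennreal ((C * (\<Sum>j\<in>J. real j powr (gamma_exp DIM('a) + beta_exp DIM('a) / q) * m j)) powr q)"
proof -
  obtain C where C: "C > 0" "\<And>q j. q \<ge> 1 \<Longrightarrow> j \<ge> 1 \<Longrightarrow>
     (\<integral>\<^sup>+x. ennreal ((block_sum j x / real j powr (gamma_exp DIM('a) + beta_exp DIM('a) / q)) powr q) \<partial>lborel) \<le> ennreal (C powr q)"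
    using block_sum_Lq by blast
  have "(\<integral>\<^sup>+x. ennreal ((\<Sum>j\<in>J. m j * block_sum j x) powr q) \<partial>lborel) \<le>
     ennreal ((C * (\<Sum>j\<in>J. real j powr (gamma_exp DIM('a) + beta_exp DIM('a) / q) * m j)) powr q)"
    if q: "q \<ge> 1" and J: "finite J" "\<forall>j\<in>J. 1 \<le> j \<and> 0 \<le> m j" for q m J
  proof -
    define D where "D j = real j powr (gamma_exp DIM('a) + beta_exp DIM('a) / q)" for j
    have D: "D j > 0" if "j \<in> J" for j using J(2) that by (auto simp: D_def)
    define v where "v j x = block_sum j x / D j" for j x
    define w where "w j = D j * m j" for j
    define W where "W = (\<Sum>j\<in>J. w j)"
    have w: "w j \<ge> 0" if "j \<in> J" for j using J(2) D[OF that] that by (simp add: w_def)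
    have v: "v j x \<ge> 0" for j x by (simp add: v_def block_sum_nonneg D_def)
    have W: "W \<ge> 0" unfolding W_def by (intro sum_nonneg w)
    have [measurable]: "v j \<in> borel_measurable borel" for j unfolding v_def[abs_def] by measurable
    have "(\<integral>\<^sup>+x. ennreal ((\<Sum>j\<in>J. m j * block_sum j x) powr q) \<partial>lborel) =
        (\<integral>\<^sup>+x. ennreal ((\<Sum>j\<in>J. w j * v j x) powr q) \<partial>lborel)"
    proof (intro nn_integral_cong arg_cong[where f = "\<lambda>s. ennreal (s powr q)"] sum.cong refl)
      fix x j assume "j \<in> J"
      from D[OF this] show "m j * block_sum j x = w j * v j x" by (simp add: w_def v_def)
    qed
    also have "\<dots> \<le> (\<integral>\<^sup>+x. ennreal (W powr (q - 1)) * (\<Sum>j\<in>J. ennreal (w j) * ennreal (v j x powr q)) \<partial>lborel)"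
    proof (rule nn_integral_mono)
      fix x
      have "(\<Sum>j\<in>J. w j * v j x) powr q \<le> W powr (q - 1) * (\<Sum>j\<in>J. w j * v j x powr q)"
        unfolding W_def using w v q by (intro weighted_powr_mean_le J) auto
      then have "ennreal ((\<Sum>j\<in>J. w j * v j x) powr q) \<le> ennreal (W powr (q - 1) * (\<Sum>j\<in>J. w j * v j x powr q))"
        by (rule ennreal_leI)
      also have "\<dots> = ennreal (W powr (q - 1)) * (\<Sum>j\<in>J. ennreal (w j * v j x powr q))"
        using w by (subst ennreal_mult) (auto intro!: sum_nonneg)
      also have "(\<Sum>j\<in>J. ennreal (w j * v j x powr q)) = (\<Sum>j\<in>J. ennreal (w j) * ennreal (v j x powr q))"
        using w by (intro sum.cong refl ennreal_mult) auto
      finally show "ennreal ((\<Sum>j\<in>J. w j * v j x) powr q) \<le> ennreal (W powr (q - 1)) * (\<Sum>j\<in>J. ennreal (w j) * ennreal (v j x powr q))" .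
    qed
    also have "\<dots> = ennreal (W powr (q - 1)) * (\<Sum>j\<in>J. ennreal (w j) * (\<integral>\<^sup>+x. ennreal (v j x powr q) \<partial>lborel))"
      by (simp add: nn_integral_cmult nn_integral_sum)
    also have "\<dots> \<le> ennreal (W powr (q - 1)) * (\<Sum>j\<in>J. ennreal (w j) * ennreal (C powr q))"
      using J(2) unfolding v_def D_def by (intro mult_left_mono sum_mono C(2) q) auto
    also have "\<dots> = ennreal (W powr (q - 1)) * (ennreal W * ennreal (C powr q))"
      using w by (simp only: sum_distrib_right[symmetric] W_def sum_ennreal)
    also have "\<dots> = ennreal (W powr (q - 1) * (W * C powr q))" using W by (simp add: ennreal_mult)
    also have "W powr (q - 1) * (W * C powr q) = (C * W) powr q"
    proof (cases "W = 0")
      case False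
      then have W': "W > 0" using W by simp
      have "W powr ((q - 1) + 1) = W powr (q - 1) * W powr 1" by (rule powr_add)
      then have "W powr (q - 1) * W = W powr q" using W' by simp
      then show ?thesis using W' C(1) by (simp add: powr_mult flip: mult.assoc)
    qed simp
    finally show ?thesis by (simp add: W_def w_def D_def)
  qed
  then show ?thesis using C(1) by blast
qed

text \<open>Only finitely many finite blocks lie below a given level, so a tail in \<open>n\<close>
  is contained in a tail in \<open>j\<close>.\<close>

lemma eventually_eig_ge: "\<exists>M. \<forall>n\<ge>M. 2 * real J \<le> eig n"
proof -
  have "{n. eig n < 2 * real J} \<subseteq> (\<Union>j<J. eig_block eig j)"
  proof
    fix n assume n: "n \<in> {n. eig n < 2 * real J}"
    obtain k where k: "eig n = 2 * real k + real DIM('a)" using eig_value by blast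
    define j where "j = nat \<lfloor>eig n / 2\<rfloor>"
    have "real j \<le> eig n / 2" "eig n / 2 < real j + 1" using k unfolding j_def by linarith+
    then have "n \<in> eig_block eig j" "j < J" using n by (auto simp: eig_block_def)
    then show "n \<in> (\<Union>j<J. eig_block eig j)" by blast
  qed
  then have "finite {n. eig n < 2 * real J}"
    by (rule finite_subset) (auto intro: finite_eig_block)
  then obtain M where "\<forall>n\<in>{n. eig n < 2 * real J}. n < M" using finite_nat_set_iff_bounded by blast
  then show ?thesis by (intro exI[of _ M]) (auto simp: not_less[symmetric])
qed

text \<open>With \<open>p = 2 q\<close>, the weight in \<open>Z_space\<close> is the normalisation
  of \<open>block_sum j\<close> in \<open>L^q\<close>. Within a block the coefficients are replaced
  by their maximum, leaving a tail of the summable series of the hypothesis.\<close>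

lemma tail_square_function_Lq:
  assumes q: "1 \<le> q" and c: "c \<in> Z_space DIM('a) eig (- 2 * beta_exp DIM('a) * (1 / 2 - 1 / (2 * q)))" and e: "0 < e"
  shows "\<exists>M. \<forall>N. (\<integral>\<^sup>+x. ennreal ((\<Sum>n=M..<N. (norm (c n))\<^sup>2 * (norm (\<phi> n x))\<^sup>2) powr q) \<partial>lborel) \<le> ennreal e"
proof -
  let ?s = "gamma_exp DIM('a) + beta_exp DIM('a) / q"
  define m where "m j = Max (insert 0 ((\<lambda>n. (norm (c n))\<^sup>2) ` eig_block eig j))" for j
  have m: "m j \<ge> 0" "n \<in> eig_block eig j \<Longrightarrow> (norm (c n))\<^sup>2 \<le> m j" for j n
    unfolding m_def using finite_eig_block by (auto intro!: Max_ge)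
  have ex: "- 2 * beta_exp DIM('a) * (1 / 2 - 1 / (2 * q)) + real DIM('a) - 1 = ?s"
    using Z_weight_exponent[of "DIM('a)" "2 * q"] q by (simp add: Suc_leI)
  have "summable (\<lambda>i. real (Suc i) powr ?s * m (Suc i))"
    using c unfolding Z_space_def Let_def m_def ex by simp
  then have sm: "summable (\<lambda>j. real j powr ?s * m j)"
    by (subst summable_Suc_iff[symmetric])
  from weighted_block_sum_Lq obtain C where C0: "C > 0"
    and C1: "\<forall>q\<ge>1. \<forall>m J. finite J \<longrightarrow> (\<forall>j\<in>J. 1 \<le> j \<and> 0 \<le> m j) \<longrightarrow>
     (\<integral>\<^sup>+x. ennreal ((\<Sum>j\<in>J. m j * block_sum j x) powr q) \<partial>lborel) \<le>
     ennreal ((C * (\<Sum>j\<in>J. real j powr (gamma_exp DIM('a) + beta_exp DIM('a) / q) * m j)) powr q)"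
    by (elim exE conjE)
  note C = C0 C1[rule_format, OF q]
  define \<eta> where "\<eta> = e powr (1 / q) / C"
  have \<eta>: "\<eta> > 0" using e C by (simp add: \<eta>_def)
  obtain J0 where J0: "\<And>a b. a \<ge> J0 \<Longrightarrow> norm (\<Sum>j=a..<b. real j powr ?s * m j) < \<eta>"
    using sm \<eta> unfolding summable_Cauchy by blast
  \<comment> \<open>\<open>Suc\<close> keeps the blocks at \<open>j \<ge> 1\<close>, where their
    bounds hold.\<close>
  define J where "J = Suc J0"
  obtain M where M: "\<And>n. n \<ge> M \<Longrightarrow> 2 * real J \<le> eig n" using eventually_eig_ge by blast
  have "(\<integral>\<^sup>+x. ennreal ((\<Sum>n=M..<N. (norm (c n))\<^sup>2 * (norm (\<phi> n x))\<^sup>2) powr q) \<partial>lborel) \<le> ennreal e" for N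
  proof -
    define lev where "lev n = nat \<lfloor>eig n / 2\<rfloor>" for n
    have lev: "n \<in> eig_block eig (lev n)" "J \<le> lev n" if "n \<ge> M" for n
    proof -
      have r: "real (lev n) \<le> eig n / 2" "eig n / 2 < real (lev n) + 1" using M[OF that] unfolding lev_def by linarith+
      then show "n \<in> eig_block eig (lev n)" by (auto simp: eig_block_def)
      have "real J < real (lev n) + 1" using r M[OF that] by linarith
      then show "J \<le> lev n" by linarith
    qed
    define J' where "J' = Suc (Max (insert 0 (lev ` {M..<N})))"
    have J': "lev n < J'" if "n \<in> {M..<N}" for n
      unfolding J'_def using that by (auto simp: less_Suc_eq_le intro!: Max_ge)
    have le: "(\<Sum>n=M..<N. (norm (c n))\<^sup>2 * (norm (\<phi> n x))\<^sup>2) \<le> (\<Sum>j=J..<J'. m j * block_sum j x)" for x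
    proof -
      let ?g = "\<lambda>n. (norm (c n))\<^sup>2 * (norm (\<phi> n x))\<^sup>2"
      have "(\<Sum>n=M..<N. ?g n) = (\<Sum>j=J..<J'. \<Sum>n\<in>{n \<in> {M..<N}. lev n = j}. ?g n)"
        using lev J' by (intro sum.group[symmetric]) auto
      also have "\<dots> \<le> (\<Sum>j=J..<J'. m j * block_sum j x)"
      proof (rule sum_mono)
        fix j
        have "(\<Sum>n\<in>{n \<in> {M..<N}. lev n = j}. ?g n) \<le> (\<Sum>n\<in>eig_block eig j. ?g n)"
          using lev(1) by (intro sum_mono2 finite_eig_block) auto
        also have "\<dots> \<le> (\<Sum>n\<in>eig_block eig j. m j * (norm (\<phi> n x))\<^sup>2)"
          by (intro sum_mono mult_right_mono m) auto
        also have "\<dots> = m j * block_sum j x" by (simp add: block_sum_def sum_distrib_left)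
        finally show "(\<Sum>n\<in>{n \<in> {M..<N}. lev n = j}. ?g n) \<le> m j * block_sum j x" .
      qed
      finally show ?thesis .
    qed
    have "(\<integral>\<^sup>+x. ennreal ((\<Sum>n=M..<N. (norm (c n))\<^sup>2 * (norm (\<phi> n x))\<^sup>2) powr q) \<partial>lborel) \<le>
       (\<integral>\<^sup>+x. ennreal ((\<Sum>j=J..<J'. m j * block_sum j x) powr q) \<partial>lborel)"
      using q by (intro nn_integral_mono ennreal_leI powr_mono2 le sum_nonneg) auto
    also have "\<dots> \<le> ennreal ((C * (\<Sum>j=J..<J'. real j powr ?s * m j)) powr q)"
      using m by (intro C(2)) (auto simp: J_def)
    also have "\<dots> \<le> ennreal ((C * \<eta>) powr q)"
    proof (intro ennreal_leI powr_mono2 mult_left_mono)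
      show "(\<Sum>j=J..<J'. real j powr ?s * m j) \<le> \<eta>"
        using J0[of J J'] by (simp add: J_def)
      show "0 \<le> C * (\<Sum>j=J..<J'. real j powr ?s * m j)"
        using C(1) m by (intro mult_nonneg_nonneg sum_nonneg) auto
    qed (use q C in auto)
    also have "(C * \<eta>) powr q = e" using C e q by (simp add: \<eta>_def powr_powr)
    finally show ?thesis .
  qed
  then show ?thesis by blast
qed

end

text \<open>All laws are compared with that of \<open>X 1\<close>, the variable in the moment
  hypotheses; the moment of order \<open>0\<close> is trivial.\<close>

lemma (in prob_space) centered_sequence_if_identically_distributed:
  fixes X :: "nat \<Rightarrow> 'a \<Rightarrow> real"
  assumes indep: "indep_vars (\<lambda>_. borel) X UNIV"
    and ident: "\<forall>n. distr M borel (X n) = distr M borel (X 0)"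
    and mean: "expectation (X 1) = 0"
    and moments: "\<forall>k\<ge>1. integrable M (\<lambda>\<omega>. \<bar>X 1 \<omega>\<bar> ^ k)"
  shows "centered_sequence M X (\<lambda>k. expectation (\<lambda>\<omega>. \<bar>X 1 \<omega>\<bar> ^ k))"
proof -
  have rv: "X n \<in> M \<rightarrow>\<^sub>M borel" for n using indep unfolding indep_vars_def2 by simp
  have eq: "distr M borel (X n) = distr M borel (X 1)" for n using ident by metis
  have E: "expectation (\<lambda>\<omega>. f (X n \<omega>)) = expectation (\<lambda>\<omega>. f (X 1 \<omega>))" if f: "f \<in> borel_measurable borel" for f :: "real \<Rightarrow> real" and n
    using integral_distr[OF rv[of n] f] integral_distr[OF rv[of 1] f] by (simp only: eq[of n])
  have I: "integrable M (\<lambda>\<omega>. f (X n \<omega>)) \<longleftrightarrow> integrable M (\<lambda>\<omega>. f (X 1 \<omega>))" if f: "f \<in> borel_measurable borel" for f :: "real \<Rightarrow> real" and n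
    using integrable_distr_eq[OF rv[of n] f] integrable_distr_eq[OF rv[of 1] f] by (simp only: eq[of n])
  have id: "(\<lambda>x::real. x) \<in> borel_measurable borel" by simp
  have pw: "(\<lambda>x::real. \<bar>x\<bar> ^ k) \<in> borel_measurable borel" for k by measurable
  show ?thesis
  proof (unfold_locales)
    show "expectation (X n) = 0" for n using E[OF id, of n] mean by (simp only:)
    have "integrable M (\<lambda>\<omega>. \<bar>X 1 \<omega>\<bar> ^ k)" for k
      using moments by (cases "k \<ge> 1") (auto simp: not_le)
    then show "integrable M (\<lambda>\<omega>. \<bar>X n \<omega>\<bar> ^ k)" for n k using I[OF pw, of n k] by (simp only:)
    show "expectation (\<lambda>\<omega>. \<bar>X n \<omega>\<bar> ^ k) = expectation (\<lambda>\<omega>. \<bar>X 1 \<omega>\<bar> ^ k)" for n k by (rule E[OF pw])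
  qed (rule indep)
qed

lemma (in centered_sequence) path_energy_expectation_bound:
  fixes z :: "nat \<Rightarrow> 'b::euclidean_space \<Rightarrow> complex"
  assumes p: "2 \<le> p" and z: "\<And>n. z n \<in> borel_measurable borel"
    and K: "K \<ge> 0" "\<And>y N. integrable M (\<lambda>\<omega>. norm (csum y N \<omega>) powr p)"
      "\<And>y N. expectation (\<lambda>\<omega>. norm (csum y N \<omega>) powr p) \<le> K * (\<Sum>n<N. (norm (y n))\<^sup>2) powr (p / 2)"
  shows "(\<integral>\<^sup>+\<omega>. path_energy z p k \<omega> \<partial>M) \<le>
     ennreal K * (\<integral>\<^sup>+s. ennreal ((\<Sum>n<k. (norm (z n s))\<^sup>2) powr (p / 2)) \<partial>lborel)"
proof -
  note [measurable] = z
  \<comment> \<open>The full space of histories of length \<open>0\<close> turns Tonelli's theorem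
    with an indicator into its unrestricted form.\<close>
  let ?B = "space (PiM {..<0::nat} (\<lambda>_. borel :: real measure))"
  have B: "past 0 \<omega> \<in> ?B" for \<omega> by (simp add: past_def space_PiM restrict_def)
  have "(\<integral>\<^sup>+\<omega>. path_energy z p k \<omega> \<partial>M) = (\<integral>\<^sup>+\<omega>. path_energy z p k \<omega> * indicator ?B (past 0 \<omega>) \<partial>M)"
    using B by simp
  also have "\<dots> = (\<integral>\<^sup>+s. (\<integral>\<^sup>+\<omega>. ennreal (norm (csum (\<lambda>n. z n s) k \<omega>) powr p) * indicator ?B (past 0 \<omega>) \<partial>M) \<partial>lborel)"
    by (rule path_energy_expectation[OF p z]) (rule sets.top)
  also have "\<dots> = (\<integral>\<^sup>+s. ennreal (expectation (\<lambda>\<omega>. norm (csum (\<lambda>n. z n s) k \<omega>) powr p)) \<partial>lborel)"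
    using B by (simp add: nn_integral_eq_integral[OF K(2)])
  also have "\<dots> \<le> (\<integral>\<^sup>+s. ennreal K * ennreal ((\<Sum>n<k. (norm (z n s))\<^sup>2) powr (p / 2)) \<partial>lborel)"
    using K(1) by (intro nn_integral_mono) (simp add: ennreal_leI K(3) flip: ennreal_mult)
  also have "\<dots> = ennreal K * (\<integral>\<^sup>+s. ennreal ((\<Sum>n<k. (norm (z n s))\<^sup>2) powr (p / 2)) \<partial>lborel)"
    by (rule nn_integral_cmult) measurable
  finally show ?thesis .
qed

theorem theorem2p2:
  fixes M :: "'w measure"
    and X :: "nat \<Rightarrow> 'w \<Rightarrow> real"
    and \<phi> :: "nat \<Rightarrow> 'a::euclidean_space \<Rightarrow> complex"
    and eig :: "nat \<Rightarrow> real"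
    and c :: "nat \<Rightarrow> complex"
    and p :: real
  assumes "harmonic_eigenbasis eig \<phi>"
    and "2 \<le> p"
    and "prob_space M"
    and "prob_space.indep_vars M (\<lambda>_. borel) X UNIV"
    and "\<forall>n. distr M borel (X n) = distr M borel (X 0)"
    and "\<not> (\<exists>a. AE \<omega> in M. X 1 \<omega> = a)"
    and "prob_space.expectation M (X 1) = 0"
    and "\<forall>k\<ge>1. integrable M (\<lambda>\<omega>. \<bar>X 1 \<omega>\<bar> ^ k)"
    and "c \<in> Z_space DIM('a) eig (- 2 * beta_exp DIM('a) * (1 / 2 - 1 / p))"
  shows "AE \<omega> in M. Lp_convergent p (\<lambda>N x. \<Sum>n<N. of_real (X n \<omega>) * c n * \<phi> n x)"
proof -
  note p = assms(2)
  interpret osc: oscillator_eigenbasis eig \<phi> by unfold_locales (rule assms(1))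
  interpret centered_sequence M X "\<lambda>k. prob_space.expectation M (\<lambda>\<omega>. \<bar>X 1 \<omega>\<bar> ^ k)"
    by (rule prob_space.centered_sequence_if_identically_distributed) (rule assms)+
  obtain K where K: "K \<ge> 0" "\<And>y N. integrable M (\<lambda>\<omega>. norm (csum y N \<omega>) powr p)"
      "\<And>y N. expectation (\<lambda>\<omega>. norm (csum y N \<omega>) powr p) \<le> K * (\<Sum>n<N. (norm (y n))\<^sup>2) powr (p / 2)"
    using csum_moment[of p] p by auto
  \<comment> \<open>\<open>z m\<close> replaces the first \<open>m\<close> terms by zero without
    shifting the indices, so the tails are themselves partial sums over the same variables
    \<open>X\<close>.\<close>
  define z where "z m n x = (if m \<le> n then c n * \<phi> n x else 0)" for m n x
  have z [measurable]: "z m n \<in> borel_measurable borel" for m n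
    unfolding z_def[abs_def] by measurable
  note [measurable] = path_energy_measurable[OF p z]
  have small: "\<exists>m. \<forall>k. (\<integral>\<^sup>+\<omega>. path_energy (z m) p k \<omega> \<partial>M) \<le> ennreal e" if e: "e > 0" for e
  proof -
    have "e / (K + 1) > 0" using e K(1) by simp
    then obtain m where m: "\<And>N. (\<integral>\<^sup>+x. ennreal ((\<Sum>n=m..<N. (norm (c n))\<^sup>2 * (norm (\<phi> n x))\<^sup>2) powr (p / 2)) \<partial>lborel) \<le> ennreal (e / (K + 1))"
      using osc.tail_square_function_Lq[of "p / 2" c "e / (K + 1)"] assms(9) p by auto
    have "(\<integral>\<^sup>+\<omega>. path_energy (z m) p k \<omega> \<partial>M) \<le> ennreal e" for k
    proof -
      have eq: "(\<Sum>n<k. (norm (z m n s))\<^sup>2) = (\<Sum>n=m..<k. (norm (c n))\<^sup>2 * (norm (\<phi> n s))\<^sup>2)" for s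
      proof -
        have "(\<Sum>n<k. (norm (z m n s))\<^sup>2) = (\<Sum>n=m..<k. (norm (z m n s))\<^sup>2)"
          by (rule sum.mono_neutral_right) (auto simp: z_def)
        also have "\<dots> = (\<Sum>n=m..<k. (norm (c n))\<^sup>2 * (norm (\<phi> n s))\<^sup>2)"
          by (intro sum.cong refl) (auto simp: z_def norm_mult power_mult_distrib)
        finally show ?thesis .
      qed
      have "(\<integral>\<^sup>+\<omega>. path_energy (z m) p k \<omega> \<partial>M) \<le> ennreal K * (\<integral>\<^sup>+s. ennreal ((\<Sum>n<k. (norm (z m n s))\<^sup>2) powr (p / 2)) \<partial>lborel)"
        by (rule path_energy_expectation_bound[OF p z K])
      also have "\<dots> \<le> ennreal K * ennreal (e / (K + 1))" unfolding eq by (intro mult_left_mono m) simp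
      also have "\<dots> = ennreal (K * (e / (K + 1)))" using K(1) e by (intro ennreal_mult[symmetric]) auto
      also have "\<dots> \<le> ennreal e" using K(1) e by (intro ennreal_leI) (simp add: field_simps)
      finally show ?thesis .
    qed
    then show ?thesis by blast
  qed
  \<comment> \<open>The bad event is that every tail exceeds the level \<open>t\<close> at some
    time. It is contained in the exceedance event of each single tail, so the maximal inequality
    bounds its probability by \<open>e / t\<close> for every \<open>e\<close>.\<close>
  have good: "AE \<omega> in M. \<exists>m. \<forall>k. path_energy (z m) p k \<omega> \<le> ennreal t" if t: "t > 0" for t
  proof -
    define B where "B = {\<omega> \<in> space M. \<forall>m. \<exists>k. ennreal t < path_energy (z m) p k \<omega>}"
    have [measurable]: "B \<in> sets M" unfolding B_def by measurable
    have le: "ennreal t * emeasure M B \<le> ennreal e" if e: "e > 0" for e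
    proof -
      obtain m where m: "\<And>k. (\<integral>\<^sup>+\<omega>. path_energy (z m) p k \<omega> \<partial>M) \<le> ennreal e" using small[OF e] by blast
      have "ennreal t * emeasure M B \<le> ennreal t * emeasure M {\<omega> \<in> space M. \<exists>k. ennreal t < path_energy (z m) p k \<omega>}"
        by (intro mult_left_mono emeasure_mono) (auto simp: B_def)
      also have "\<dots> \<le> ennreal e" by (rule path_energy_maximal[OF p z m])
      finally show ?thesis .
    qed
    have "ennreal t * emeasure M B \<le> 0"
    proof (rule ennreal_le_epsilon)
      fix e :: real assume "0 < e"
      then show "ennreal t * emeasure M B \<le> 0 + ennreal e" unfolding add_0 by (rule le)
    qed
    then have "emeasure M B = 0" using t by (simp add: ennreal_eq_0_iff)
    then have "B \<in> null_sets M" by (rule null_setsI) measurable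
    then have "AE \<omega> in M. \<omega> \<notin> B" by (rule AE_not_in)
    then show ?thesis
      using AE_space by eventually_elim (auto simp: B_def not_less)
  qed
  \<comment> \<open>Countably many levels suffice, so the exceptional sets combine into one null
    set.\<close>
  have "AE \<omega> in M. \<forall>j::nat. \<exists>m. \<forall>k. path_energy (z m) p k \<omega> \<le> ennreal (1 / real (Suc j))"
    by (intro AE_all_countable[THEN iffD2] allI good) simp
  then show ?thesis
  proof eventually_elim
    fix \<omega> assume \<omega>: "\<forall>j::nat. \<exists>m. \<forall>k. path_energy (z m) p k \<omega> \<le> ennreal (1 / real (Suc j))"
    let ?F = "\<lambda>N x. \<Sum>n<N. of_real (X n \<omega>) * c n * \<phi> n x"
    show "Lp_convergent p ?F"
    proof (rule Lp_convergent_if_Cauchy)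
      show "1 \<le> p" using p by simp
      show "?F N \<in> Lp p" for N using p by (intro Lp_sum Lp_scale osc.phi_Lp) auto
      fix e :: real assume e: "e > 0"
      \<comment> \<open>The denominator accounts for the two tails in a difference of partial sums
        and for the factor \<open>2 powr p\<close> of \<open>norm_add_powr_le\<close>.\<close>
      then obtain j where j: "1 / real (Suc j) < e / (2 * 2 powr p)"
        using nat_approx_posE[of "e / (2 * 2 powr p)"] by auto
      obtain m where m: "\<And>k. path_energy (z m) p k \<omega> \<le> ennreal (1 / real (Suc j))" using \<omega> by blast
      define S where "S k x = csum (\<lambda>n. z m n x) k \<omega>" for k x
      have [measurable]: "S k \<in> borel_measurable borel" for k unfolding S_def[abs_def] csum_def by measurable
      have F: "?F k x = (\<Sum>n<m. of_real (X n \<omega>) * c n * \<phi> n x) + S k x" if "k \<ge> m" for k x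
      proof -
        have "?F k x = (\<Sum>n<m. of_real (X n \<omega>) * c n * \<phi> n x) + (\<Sum>n=m..<k. of_real (X n \<omega>) * c n * \<phi> n x)"
          using that by (simp add: lessThan_atLeast0 sum.atLeastLessThan_concat)
        also have "(\<Sum>n=m..<k. of_real (X n \<omega>) * c n * \<phi> n x) = (\<Sum>n=m..<k. z m n x * of_real (X n \<omega>))"
          by (intro sum.cong refl) (auto simp: z_def)
        also have "\<dots> = S k x"
          unfolding S_def csum_def by (rule sum.mono_neutral_left) (auto simp: z_def)
        finally show ?thesis .
      qed
      have "(\<integral>\<^sup>+x. ennreal (norm (?F k x - ?F l x) powr p) \<partial>lborel) \<le> ennreal e" if kl: "k \<ge> m" "l \<ge> m" for k l
      proof -
        have "(\<integral>\<^sup>+x. ennreal (norm (?F k x - ?F l x) powr p) \<partial>lborel) \<le>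
          (\<integral>\<^sup>+x. ennreal (2 powr p) * (ennreal (norm (S k x) powr p) + ennreal (norm (S l x) powr p)) \<partial>lborel)"
        proof (rule nn_integral_mono)
          fix x
          have "norm (?F k x - ?F l x) powr p = norm (S k x + - S l x) powr p"
            unfolding F[OF kl(1)] F[OF kl(2)] by simp
          also have "\<dots> \<le> 2 powr p * (norm (S k x) powr p + norm (- S l x) powr p)"
            using p by (intro norm_add_powr_le) simp
          finally have "norm (?F k x - ?F l x) powr p \<le> 2 powr p * (norm (S k x) powr p + norm (S l x) powr p)" by simp
          then show "ennreal (norm (?F k x - ?F l x) powr p) \<le> ennreal (2 powr p) * (ennreal (norm (S k x) powr p) + ennreal (norm (S l x) powr p))"
            by (simp add: ennreal_leI flip: ennreal_mult ennreal_plus)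
        qed
        also have "\<dots> = ennreal (2 powr p) * (path_energy (z m) p k \<omega> + path_energy (z m) p l \<omega>)"
          unfolding path_energy_def S_def[symmetric] by (simp add: nn_integral_cmult nn_integral_add)
        also have "\<dots> \<le> ennreal (2 powr p) * (ennreal (1 / real (Suc j)) + ennreal (1 / real (Suc j)))"
          by (intro mult_left_mono add_mono m) auto
        also have "\<dots> = ennreal (2 powr p * (1 / real (Suc j) + 1 / real (Suc j)))"
          by (simp flip: ennreal_mult ennreal_plus)
        also have "\<dots> \<le> ennreal e" using j by (intro ennreal_leI) (simp add: field_simps)
        finally show ?thesis .
      qed
      then show "\<exists>M. \<forall>k\<ge>M. \<forall>l\<ge>M. (\<integral>\<^sup>+x. ennreal (norm (?F k x - ?F l x) powr p) \<partial>lborel) \<le> ennreal e" by blast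
    qed
  qed
qed

end
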